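(* For any symmetric monoidal functor $F:\mathcal A\to[\mathcal C,\mathcal B]$ and any symmetric monoidal category $\mathcal D$, the following diagram in $\mathrm{SMC}$ commutes, i.e. the two composites $[\mathcal D,\mathcal C]\to[\mathcal A,[\mathcal D,\mathcal B]]$ $$[\mathcal D,\mathcal C]\xrightarrow{[-,\mathcal B]}[[\mathcal C,\mathcal B],[\mathcal D,\mathcal B]]\xrightarrow{[F,1]}[\mathcal A,[\mathcal D,\mathcal B]]\quad\text{and}\quad[\mathcal D,\mathcal C]\xrightarrow{[1,F^*]}[\mathcal D,[\mathcal A,\mathcal B]]\xrightarrow{D}[\mathcal A,[\mathcal D,\mathcal B]]$$ are equal as symmetric monoidal functors.
   Context: All symmetric monoidal categories are small, with tensor $\otimes$, unit $I$ and natural isomorphisms $ass_{a,b,c}:a\otimes(b\otimes c)\to(a\otimes b)\otimes c$, $r_a:a\otimes I\to a$, $l_a:I\otimes a\to a$, $s_{a,b}:a\otimes b\to b\otimes a$ satisfying the usual coherence axioms. A symmetric monoidal functor $F:\mathcal A\to\mathcal B$ is a lax one: a functor with an arrow $F^0:I\to F(I)$ and a natural family $F^2_{x,y}:Fx\otimes Fy\to F(x\otimes y)$ satisfying the usual associativity, unit and symmetry axioms; it is strict if $F^0$ and all $F^2_{x,y}$ are identities. $\mathrm{SMC}$ is the 2-category of symmetric monoidal categories, symmetric monoidal functors and monoidal natural transformations. $[\mathcal A,\mathcal B]$ is the category $\mathrm{SMC}(\mathcal A,\mathcal B)$ with the pointwise symmetric monoidal structure: $(F\Box G)(a)=Fa\otimes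 Ga$, $(F\Box G)^0$ is $I\cong I\otimes I\xrightarrow{F^0\otimes G^0}F(I)\otimes G(I)$, $(F\Box G)^2_{a,b}$ is the canonical interchange $(Fa\otimes Ga)\otimes(Fb\otimes Gb)\cong(Fa\otimes Fb)\otimes(Ga\otimes Gb)$ followed by $F^2_{a,b}\otimes G^2_{a,b}$; $(\sigma\Box\tau)_a=\sigma_a\otimes\tau_a$; the unit is the constant functor at $I_{\mathcal B}$ (with $I\to I$ the identity and $I\otimes I\to I$ the canonical arrow); $ass,r,l,s$ are pointwise. For $F:\mathcal B\to\mathcal C$, $[\mathcal A,F]=[1,F]:[\mathcal A,\mathcal B]\to[\mathcal A,\mathcal C]$ is $H\mapsto F\circ H$, $\theta\mapsto F*\theta$, with $[\mathcal A,F]^0$ having all components $F^0$ and $[\mathcal A,F]^2_{H,K}$ having component $F^2_{Ha,Ka}$ at $a$. For $F:\mathcal C\to\mathcal A$, $[F,\mathcal B]=[F,1]:[\mathcal A,\mathcal B]\to[\mathcal C,\mathcal B]$ is precomposition with $F$, which is strict. For $F:\mathcal A\to[\mathcal B,\mathcal C]$ in $\mathrm{SMC}$, its dual $F^*:\mathcal B\to[\mathcal A,\mathcal C]$ is given by $F^*(b)(a)=F(a)(b)$, $F^*(b)(f)=F(f)_b$, $(F^*b)^0=(F^0)_b$, $(F^*b)^2_{a,a'}=(F^2_{a,a'})_b$, $F^*(g)_a=F(a)(g)$, $((F^* )^0)_a=(Fa)^0$, $((F^* )^2_{b,b'})_a=(Fa)^2_{b,b'}$; for a 2-cell $\theta:F\to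 G$, $(\theta^*_b)_a=(\theta_a)_b$. This gives a strict symmetric monoidal isomorphism $D:[\mathcal A,[\mathcal B,\mathcal C]]\to[\mathcal B,[\mathcal A,\mathcal C]]$, $F\mapsto F^*$, $\theta\mapsto\theta^*$. The strict symmetric monoidal functor $[\mathcal D,-]:[\mathcal C,\mathcal B]\to[[\mathcal D,\mathcal C],[\mathcal D,\mathcal B]]$ sends $H$ to $[\mathcal D,H]$ and a 2-cell $\sigma$ to $[\mathcal D,\sigma]$, $[\mathcal D,\sigma]_G=\sigma*G$. Its dual is the symmetric monoidal functor $[-,\mathcal B]:[\mathcal D,\mathcal C]\to[[\mathcal C,\mathcal B],[\mathcal D,\mathcal B]]$, which sends $G$ to $[G,\mathcal B]$ and $\tau$ to $[\tau,\mathcal B]$, $[\tau,\mathcal B]_H=H*\tau$. *)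

theory Defs
  imports "HOL-Library.FuncSet"
begin

section \<open>Small symmetric monoidal categories\<close>

text \<open>
  Composition and the tensor of arrows are total functions whose values are constrained only on
  composable pairs and on arrows of the category, respectively. \<open>g \<cdot>\<^bsub>C\<^esub> f\<close> is
  "\<open>g\<close> after \<open>f\<close>", \<open>\<otimes>\<close> is the tensor of objects and \<open>\<odot>\<close> that of arrows.
\<close>

record ('o, 'a) smcat =
  Obj  :: "'o set"
  Arr  :: "'a set"
  Dom  :: "'a \<Rightarrow> 'o"
  Cod  :: "'a \<Rightarrow> 'o"
  Id   :: "'o \<Rightarrow> 'a"
  Comp :: "'a \<Rightarrow> 'a \<Rightarrow> 'a"  (infixr "\<cdot>\<index>" 55)
  TObj :: "'o \<Rightarrow> 'o \<Rightarrow> 'o"  (infixr "\<otimes>\<index>" 70)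
  TArr :: "'a \<Rightarrow> 'a \<Rightarrow> 'a"  (infixr "\<odot>\<index>" 70)
  Unit :: "'o"               ("\<one>\<index>")
  Ass  :: "'o \<Rightarrow> 'o \<Rightarrow> 'o \<Rightarrow> 'a"
  Run  :: "'o \<Rightarrow> 'a"
  Lun  :: "'o \<Rightarrow> 'a"
  Sym  :: "'o \<Rightarrow> 'o \<Rightarrow> 'a"

definition Hom :: "('o, 'a) smcat \<Rightarrow> 'o \<Rightarrow> 'o \<Rightarrow> 'a set" where
  "Hom C x y = {f \<in> Arr C. Dom C f = x \<and> Cod C f = y}"

definition inverse_pair :: "('o, 'a) smcat \<Rightarrow> 'a \<Rightarrow> 'a \<Rightarrow> bool" where
  "inverse_pair C f g \<longleftrightarrow> f \<in> Arr C \<and> g \<in> Hom C (Cod C f) (Dom C f) \<and>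
     Comp C g f = Id C (Dom C f) \<and> Comp C f g = Id C (Cod C f)"

definition iso_arr :: "('o, 'a) smcat \<Rightarrow> 'a \<Rightarrow> bool" where
  "iso_arr C f \<longleftrightarrow> (\<exists>g. inverse_pair C f g)"

definition inv_arr :: "('o, 'a) smcat \<Rightarrow> 'a \<Rightarrow> 'a" where
  "inv_arr C f = (THE g. inverse_pair C f g)"

definition category :: "('o, 'a) smcat \<Rightarrow> bool" where
  "category C \<longleftrightarrow>
     (\<forall>f\<in>Arr C. Dom C f \<in> Obj C \<and> Cod C f \<in> Obj C) \<and>
     (\<forall>x\<in>Obj C. Id C x \<in> Hom C x x) \<and>
     (\<forall>f\<in>Arr C. \<forall>g\<in>Arr C. Cod C f = Dom C g \<longrightarrow> g \<cdot>\<^bsub>C\<^esub> f \<in> Hom C (Dom C f) (Cod C g)) \<and>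
     (\<forall>f\<in>Arr C. f \<cdot>\<^bsub>C\<^esub> Id C (Dom C f) = f \<and> Id C (Cod C f) \<cdot>\<^bsub>C\<^esub> f = f) \<and>
     (\<forall>f\<in>Arr C. \<forall>g\<in>Arr C. \<forall>h\<in>Arr C. Cod C f = Dom C g \<longrightarrow> Cod C g = Dom C h \<longrightarrow>
        (h \<cdot>\<^bsub>C\<^esub> g) \<cdot>\<^bsub>C\<^esub> f = h \<cdot>\<^bsub>C\<^esub> (g \<cdot>\<^bsub>C\<^esub> f))"

definition tensor_bifunctor :: "('o, 'a) smcat \<Rightarrow> bool" where
  "tensor_bifunctor C \<longleftrightarrow>
     (\<forall>x\<in>Obj C. \<forall>y\<in>Obj C. x \<otimes>\<^bsub>C\<^esub> y \<in> Obj C \<and>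
        Id C x \<odot>\<^bsub>C\<^esub> Id C y = Id C (x \<otimes>\<^bsub>C\<^esub> y)) \<and>
     (\<forall>f\<in>Arr C. \<forall>g\<in>Arr C.
        f \<odot>\<^bsub>C\<^esub> g \<in> Hom C (Dom C f \<otimes>\<^bsub>C\<^esub> Dom C g) (Cod C f \<otimes>\<^bsub>C\<^esub> Cod C g)) \<and>
     (\<forall>f\<in>Arr C. \<forall>f'\<in>Arr C. \<forall>g\<in>Arr C. \<forall>g'\<in>Arr C. Cod C f = Dom C f' \<longrightarrow> Cod C g = Dom C g' \<longrightarrow>
        (f' \<cdot>\<^bsub>C\<^esub> f) \<odot>\<^bsub>C\<^esub> (g' \<cdot>\<^bsub>C\<^esub> g) = (f' \<odot>\<^bsub>C\<^esub> g') \<cdot>\<^bsub>C\<^esub> (f \<odot>\<^bsub>C\<^esub> g))"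

definition structure_isos :: "('o, 'a) smcat \<Rightarrow> bool" where
  "structure_isos C \<longleftrightarrow>
     (\<forall>a\<in>Obj C. \<forall>b\<in>Obj C. \<forall>c\<in>Obj C. iso_arr C (Ass C a b c) \<and>
        Ass C a b c \<in> Hom C (a \<otimes>\<^bsub>C\<^esub> (b \<otimes>\<^bsub>C\<^esub> c)) ((a \<otimes>\<^bsub>C\<^esub> b) \<otimes>\<^bsub>C\<^esub> c)) \<and>
     (\<forall>a\<in>Obj C. iso_arr C (Run C a) \<and> Run C a \<in> Hom C (a \<otimes>\<^bsub>C\<^esub> \<one>\<^bsub>C\<^esub>) a) \<and>
     (\<forall>a\<in>Obj C. iso_arr C (Lun C a) \<and> Lun C a \<in> Hom C (\<one>\<^bsub>C\<^esub> \<otimes>\<^bsub>C\<^esub> a) a) \<and>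
     (\<forall>a\<in>Obj C. \<forall>b\<in>Obj C. iso_arr C (Sym C a b) \<and>
        Sym C a b \<in> Hom C (a \<otimes>\<^bsub>C\<^esub> b) (b \<otimes>\<^bsub>C\<^esub> a)) \<and>
     (\<forall>f\<in>Arr C. \<forall>g\<in>Arr C. \<forall>h\<in>Arr C.
        Ass C (Cod C f) (Cod C g) (Cod C h) \<cdot>\<^bsub>C\<^esub> (f \<odot>\<^bsub>C\<^esub> (g \<odot>\<^bsub>C\<^esub> h)) =
        ((f \<odot>\<^bsub>C\<^esub> g) \<odot>\<^bsub>C\<^esub> h) \<cdot>\<^bsub>C\<^esub> Ass C (Dom C f) (Dom C g) (Dom C h)) \<and>
     (\<forall>f\<in>Arr C. Run C (Cod C f) \<cdot>\<^bsub>C\<^esub> (f \<odot>\<^bsub>C\<^esub> Id C \<one>\<^bsub>C\<^esub>) = f \<cdot>\<^bsub>C\<^esub> Run C (Dom C f)) \<and>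
     (\<forall>f\<in>Arr C. Lun C (Cod C f) \<cdot>\<^bsub>C\<^esub> (Id C \<one>\<^bsub>C\<^esub> \<odot>\<^bsub>C\<^esub> f) = f \<cdot>\<^bsub>C\<^esub> Lun C (Dom C f)) \<and>
     (\<forall>f\<in>Arr C. \<forall>g\<in>Arr C.
        Sym C (Cod C f) (Cod C g) \<cdot>\<^bsub>C\<^esub> (f \<odot>\<^bsub>C\<^esub> g) = (g \<odot>\<^bsub>C\<^esub> f) \<cdot>\<^bsub>C\<^esub> Sym C (Dom C f) (Dom C g))"

text \<open>Pentagon, triangle, involutivity of the symmetry, unit axiom for the symmetry, hexagon.\<close>

definition coherence_axioms :: "('o, 'a) smcat \<Rightarrow> bool" where
  "coherence_axioms C \<longleftrightarrow>
     (\<forall>a\<in>Obj C. \<forall>b\<in>Obj C. \<forall>c\<in>Obj C. \<forall>d\<in>Obj C.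
        Ass C (a \<otimes>\<^bsub>C\<^esub> b) c d \<cdot>\<^bsub>C\<^esub> Ass C a b (c \<otimes>\<^bsub>C\<^esub> d) =
        (Ass C a b c \<odot>\<^bsub>C\<^esub> Id C d) \<cdot>\<^bsub>C\<^esub> Ass C a (b \<otimes>\<^bsub>C\<^esub> c) d \<cdot>\<^bsub>C\<^esub> (Id C a \<odot>\<^bsub>C\<^esub> Ass C b c d)) \<and>
     (\<forall>a\<in>Obj C. \<forall>c\<in>Obj C.
        (Run C a \<odot>\<^bsub>C\<^esub> Id C c) \<cdot>\<^bsub>C\<^esub> Ass C a \<one>\<^bsub>C\<^esub> c = Id C a \<odot>\<^bsub>C\<^esub> Lun C c) \<and>
     (\<forall>a\<in>Obj C. \<forall>b\<in>Obj C. Sym C b a \<cdot>\<^bsub>C\<^esub> Sym C a b = Id C (a \<otimes>\<^bsub>C\<^esub> b)) \<and>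
     (\<forall>a\<in>Obj C. Lun C a \<cdot>\<^bsub>C\<^esub> Sym C a \<one>\<^bsub>C\<^esub> = Run C a) \<and>
     (\<forall>a\<in>Obj C. \<forall>b\<in>Obj C. \<forall>c\<in>Obj C.
        Ass C c a b \<cdot>\<^bsub>C\<^esub> Sym C (a \<otimes>\<^bsub>C\<^esub> b) c \<cdot>\<^bsub>C\<^esub> Ass C a b c =
        (Sym C a c \<odot>\<^bsub>C\<^esub> Id C b) \<cdot>\<^bsub>C\<^esub> Ass C a c b \<cdot>\<^bsub>C\<^esub> (Id C a \<odot>\<^bsub>C\<^esub> Sym C b c))"

definition sm_category :: "('o, 'a) smcat \<Rightarrow> bool" where
  "sm_category C \<longleftrightarrow> category C \<and> tensor_bifunctor C \<and> \<one>\<^bsub>C\<^esub> \<in> Obj C \<and>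
     structure_isos C \<and> coherence_axioms C"

text \<open>
  The canonical interchange \<open>(a \<otimes> b) \<otimes> (c \<otimes> d) \<rightarrow> (a \<otimes> c) \<otimes> (b \<otimes> d)\<close>, as the composite
  \<open>(ab)(cd) \<rightarrow> a(b(cd)) \<rightarrow> a((bc)d) \<rightarrow> a((cb)d) \<rightarrow> a(c(bd)) \<rightarrow> (ac)(bd)\<close>.
\<close>

definition interchange :: "('o, 'a) smcat \<Rightarrow> 'o \<Rightarrow> 'o \<Rightarrow> 'o \<Rightarrow> 'o \<Rightarrow> 'a" where
  "interchange C a b c d =
     Ass C a c (b \<otimes>\<^bsub>C\<^esub> d) \<cdot>\<^bsub>C\<^esub>
     (Id C a \<odot>\<^bsub>C\<^esub> inv_arr C (Ass C c b d)) \<cdot>\<^bsub>C\<^esub>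
     (Id C a \<odot>\<^bsub>C\<^esub> (Sym C b c \<odot>\<^bsub>C\<^esub> Id C d)) \<cdot>\<^bsub>C\<^esub>
     (Id C a \<odot>\<^bsub>C\<^esub> Ass C b c d) \<cdot>\<^bsub>C\<^esub>
     inv_arr C (Ass C a b (c \<otimes>\<^bsub>C\<^esub> d))"


section \<open>Symmetric monoidal functors and monoidal natural transformations\<close>

text \<open>
  The map components are \<^const>\<open>extensional\<close> on their domains of definition, so that equality of
  records is equality of symmetric monoidal functors, respectively of monoidal transformations.
\<close>

record ('oa, 'aa, 'ob, 'ab) smfun =
  FO :: "'oa \<Rightarrow> 'ob"
  FA :: "'aa \<Rightarrow> 'ab"
  F0 :: "'ab"
  F2 :: "'oa \<times> 'oa \<Rightarrow> 'ab"

definition sm_functor ::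
  "('oa, 'aa) smcat \<Rightarrow> ('ob, 'ab) smcat \<Rightarrow> ('oa, 'aa, 'ob, 'ab) smfun \<Rightarrow> bool" where
  "sm_functor A B F \<longleftrightarrow>
     FO F \<in> extensional (Obj A) \<and> FA F \<in> extensional (Arr A) \<and>
     F2 F \<in> extensional (Obj A \<times> Obj A) \<and>
     (\<forall>x\<in>Obj A. FO F x \<in> Obj B \<and> FA F (Id A x) = Id B (FO F x)) \<and>
     (\<forall>f\<in>Arr A. FA F f \<in> Hom B (FO F (Dom A f)) (FO F (Cod A f))) \<and>
     (\<forall>f\<in>Arr A. \<forall>g\<in>Arr A. Cod A f = Dom A g \<longrightarrow> FA F (g \<cdot>\<^bsub>A\<^esub> f) = FA F g \<cdot>\<^bsub>B\<^esub> FA F f) \<and>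
     F0 F \<in> Hom B \<one>\<^bsub>B\<^esub> (FO F \<one>\<^bsub>A\<^esub>) \<and>
     (\<forall>x\<in>Obj A. \<forall>y\<in>Obj A. F2 F (x, y) \<in> Hom B (FO F x \<otimes>\<^bsub>B\<^esub> FO F y) (FO F (x \<otimes>\<^bsub>A\<^esub> y))) \<and>
     (\<forall>f\<in>Arr A. \<forall>g\<in>Arr A.
        F2 F (Cod A f, Cod A g) \<cdot>\<^bsub>B\<^esub> (FA F f \<odot>\<^bsub>B\<^esub> FA F g) =
        FA F (f \<odot>\<^bsub>A\<^esub> g) \<cdot>\<^bsub>B\<^esub> F2 F (Dom A f, Dom A g)) \<and>
     (\<forall>x\<in>Obj A. \<forall>y\<in>Obj A. \<forall>z\<in>Obj A.
        FA F (Ass A x y z) \<cdot>\<^bsub>B\<^esub> F2 F (x, y \<otimes>\<^bsub>A\<^esub> z) \<cdot>\<^bsub>B\<^esub> (Id B (FO F x) \<odot>\<^bsub>B\<^esub> F2 F (y, z)) =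
        F2 F (x \<otimes>\<^bsub>A\<^esub> y, z) \<cdot>\<^bsub>B\<^esub> (F2 F (x, y) \<odot>\<^bsub>B\<^esub> Id B (FO F z)) \<cdot>\<^bsub>B\<^esub>
          Ass B (FO F x) (FO F y) (FO F z)) \<and>
     (\<forall>x\<in>Obj A.
        FA F (Run A x) \<cdot>\<^bsub>B\<^esub> F2 F (x, \<one>\<^bsub>A\<^esub>) \<cdot>\<^bsub>B\<^esub> (Id B (FO F x) \<odot>\<^bsub>B\<^esub> F0 F) = Run B (FO F x)) \<and>
     (\<forall>x\<in>Obj A.
        FA F (Lun A x) \<cdot>\<^bsub>B\<^esub> F2 F (\<one>\<^bsub>A\<^esub>, x) \<cdot>\<^bsub>B\<^esub> (F0 F \<odot>\<^bsub>B\<^esub> Id B (FO F x)) = Lun B (FO F x)) \<and>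
     (\<forall>x\<in>Obj A. \<forall>y\<in>Obj A.
        FA F (Sym A x y) \<cdot>\<^bsub>B\<^esub> F2 F (x, y) = F2 F (y, x) \<cdot>\<^bsub>B\<^esub> Sym B (FO F x) (FO F y))"

record ('oa, 'aa, 'ob, 'ab) smtrans =
  Src :: "('oa, 'aa, 'ob, 'ab) smfun"
  Trg :: "('oa, 'aa, 'ob, 'ab) smfun"
  Cmp :: "'oa \<Rightarrow> 'ab"

definition sm_trans ::
  "('oa, 'aa) smcat \<Rightarrow> ('ob, 'ab) smcat \<Rightarrow> ('oa, 'aa, 'ob, 'ab) smtrans \<Rightarrow> bool" where
  "sm_trans A B \<sigma> \<longleftrightarrow>
     sm_functor A B (Src \<sigma>) \<and> sm_functor A B (Trg \<sigma>) \<and> Cmp \<sigma> \<in> extensional (Obj A) \<and>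
     (\<forall>x\<in>Obj A. Cmp \<sigma> x \<in> Hom B (FO (Src \<sigma>) x) (FO (Trg \<sigma>) x)) \<and>
     (\<forall>f\<in>Arr A. Cmp \<sigma> (Cod A f) \<cdot>\<^bsub>B\<^esub> FA (Src \<sigma>) f = FA (Trg \<sigma>) f \<cdot>\<^bsub>B\<^esub> Cmp \<sigma> (Dom A f)) \<and>
     Cmp \<sigma> \<one>\<^bsub>A\<^esub> \<cdot>\<^bsub>B\<^esub> F0 (Src \<sigma>) = F0 (Trg \<sigma>) \<and>
     (\<forall>x\<in>Obj A. \<forall>y\<in>Obj A.
        Cmp \<sigma> (x \<otimes>\<^bsub>A\<^esub> y) \<cdot>\<^bsub>B\<^esub> F2 (Src \<sigma>) (x, y) =
        F2 (Trg \<sigma>) (x, y) \<cdot>\<^bsub>B\<^esub> (Cmp \<sigma> x \<odot>\<^bsub>B\<^esub> Cmp \<sigma> y))"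

text \<open>Composite \<open>G \<circ> F\<close> of \<open>F : A \<rightarrow> B\<close> and \<open>G : B \<rightarrow> C\<close>.\<close>

definition comp_fun ::
  "('oa, 'aa) smcat \<Rightarrow> ('oc, 'ac) smcat \<Rightarrow> ('ob, 'ab, 'oc, 'ac) smfun \<Rightarrow>
   ('oa, 'aa, 'ob, 'ab) smfun \<Rightarrow> ('oa, 'aa, 'oc, 'ac) smfun" where
  "comp_fun A C G F =
     \<lparr> FO = (\<lambda>x\<in>Obj A. FO G (FO F x)),
       FA = (\<lambda>f\<in>Arr A. FA G (FA F f)),
       F0 = FA G (F0 F) \<cdot>\<^bsub>C\<^esub> F0 G,
       F2 = (\<lambda>(x, y)\<in>Obj A \<times> Obj A. FA G (F2 F (x, y)) \<cdot>\<^bsub>C\<^esub> F2 G (FO F x, FO F y)) \<rparr>"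

text \<open>\<open>whisker_l A C F \<theta>\<close> is \<open>F * \<theta>\<close> for \<open>\<theta> : H \<rightarrow> K : A \<rightarrow> B\<close> and \<open>F : B \<rightarrow> C\<close>.\<close>

definition whisker_l ::
  "('oa, 'aa) smcat \<Rightarrow> ('oc, 'ac) smcat \<Rightarrow> ('ob, 'ab, 'oc, 'ac) smfun \<Rightarrow>
   ('oa, 'aa, 'ob, 'ab) smtrans \<Rightarrow> ('oa, 'aa, 'oc, 'ac) smtrans" where
  "whisker_l A C F \<theta> =
     \<lparr> Src = comp_fun A C F (Src \<theta>), Trg = comp_fun A C F (Trg \<theta>),
       Cmp = (\<lambda>x\<in>Obj A. FA F (Cmp \<theta> x)) \<rparr>"

text \<open>\<open>whisker_r A C \<theta> F\<close> is \<open>\<theta> * F\<close> for \<open>F : A \<rightarrow> B\<close> and \<open>\<theta> : H \<rightarrow> K : B \<rightarrow> C\<close>.\<close>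

definition whisker_r ::
  "('oa, 'aa) smcat \<Rightarrow> ('oc, 'ac) smcat \<Rightarrow> ('ob, 'ab, 'oc, 'ac) smtrans \<Rightarrow>
   ('oa, 'aa, 'ob, 'ab) smfun \<Rightarrow> ('oa, 'aa, 'oc, 'ac) smtrans" where
  "whisker_r A C \<theta> F =
     \<lparr> Src = comp_fun A C (Src \<theta>) F, Trg = comp_fun A C (Trg \<theta>) F,
       Cmp = (\<lambda>x\<in>Obj A. Cmp \<theta> (FO F x)) \<rparr>"

text \<open>A strict symmetric monoidal functor, from its actions on objects and on arrows.\<close>

definition strict_fun ::
  "('oa, 'aa) smcat \<Rightarrow> ('ob, 'ab) smcat \<Rightarrow> ('oa \<Rightarrow> 'ob) \<Rightarrow> ('aa \<Rightarrow> 'ab) \<Rightarrow>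
   ('oa, 'aa, 'ob, 'ab) smfun" where
  "strict_fun A B fo fa =
     \<lparr> FO = restrict fo (Obj A), FA = restrict fa (Arr A), F0 = Id B \<one>\<^bsub>B\<^esub>,
       F2 = (\<lambda>(x, y)\<in>Obj A \<times> Obj A. Id B (fo x \<otimes>\<^bsub>B\<^esub> fo y)) \<rparr>"


section \<open>The internal hom\<close>

text \<open>
  The isomorphism \<open>I \<cong> I \<otimes> I\<close> is the inverse of \<open>r\<^sub>I\<close>, and the canonical arrow \<open>I \<otimes> I \<rightarrow> I\<close> is
  \<open>r\<^sub>I\<close>; in a symmetric monoidal category \<open>r\<^sub>I = l\<^sub>I\<close>.
\<close>

definition box_fun ::
  "('oa, 'aa) smcat \<Rightarrow> ('ob, 'ab) smcat \<Rightarrow> ('oa, 'aa, 'ob, 'ab) smfun \<Rightarrow>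
   ('oa, 'aa, 'ob, 'ab) smfun \<Rightarrow> ('oa, 'aa, 'ob, 'ab) smfun" where
  "box_fun A B F G =
     \<lparr> FO = (\<lambda>x\<in>Obj A. FO F x \<otimes>\<^bsub>B\<^esub> FO G x),
       FA = (\<lambda>f\<in>Arr A. FA F f \<odot>\<^bsub>B\<^esub> FA G f),
       F0 = (F0 F \<odot>\<^bsub>B\<^esub> F0 G) \<cdot>\<^bsub>B\<^esub> inv_arr B (Run B \<one>\<^bsub>B\<^esub>),
       F2 = (\<lambda>(x, y)\<in>Obj A \<times> Obj A.
               (F2 F (x, y) \<odot>\<^bsub>B\<^esub> F2 G (x, y)) \<cdot>\<^bsub>B\<^esub>
               interchange B (FO F x) (FO G x) (FO F y) (FO G y)) \<rparr>"

definition box_trans ::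
  "('oa, 'aa) smcat \<Rightarrow> ('ob, 'ab) smcat \<Rightarrow> ('oa, 'aa, 'ob, 'ab) smtrans \<Rightarrow>
   ('oa, 'aa, 'ob, 'ab) smtrans \<Rightarrow> ('oa, 'aa, 'ob, 'ab) smtrans" where
  "box_trans A B \<sigma> \<tau> =
     \<lparr> Src = box_fun A B (Src \<sigma>) (Src \<tau>), Trg = box_fun A B (Trg \<sigma>) (Trg \<tau>),
       Cmp = (\<lambda>x\<in>Obj A. Cmp \<sigma> x \<odot>\<^bsub>B\<^esub> Cmp \<tau> x) \<rparr>"

definition unit_fun ::
  "('oa, 'aa) smcat \<Rightarrow> ('ob, 'ab) smcat \<Rightarrow> ('oa, 'aa, 'ob, 'ab) smfun" where
  "unit_fun A B =
     \<lparr> FO = (\<lambda>x\<in>Obj A. \<one>\<^bsub>B\<^esub>), FA = (\<lambda>f\<in>Arr A. Id B \<one>\<^bsub>B\<^esub>), F0 = Id B \<one>\<^bsub>B\<^esub>,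
       F2 = (\<lambda>(x, y)\<in>Obj A \<times> Obj A. Run B \<one>\<^bsub>B\<^esub>) \<rparr>"

definition ihom ::
  "('oa, 'aa) smcat \<Rightarrow> ('ob, 'ab) smcat \<Rightarrow>
   (('oa, 'aa, 'ob, 'ab) smfun, ('oa, 'aa, 'ob, 'ab) smtrans) smcat" where
  "ihom A B =
     \<lparr> Obj = {F. sm_functor A B F},
       Arr = {\<sigma>. sm_trans A B \<sigma>},
       Dom = Src,
       Cod = Trg,
       Id = (\<lambda>F. \<lparr> Src = F, Trg = F, Cmp = (\<lambda>x\<in>Obj A. Id B (FO F x)) \<rparr>),
       Comp = (\<lambda>\<tau> \<sigma>. \<lparr> Src = Src \<sigma>, Trg = Trg \<tau>, Cmp = (\<lambda>x\<in>Obj A. Cmp \<tau> x \<cdot>\<^bsub>B\<^esub> Cmp \<sigma> x) \<rparr>),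
       TObj = box_fun A B,
       TArr = box_trans A B,
       Unit = unit_fun A B,
       Ass = (\<lambda>F G H. \<lparr> Src = box_fun A B F (box_fun A B G H),
                         Trg = box_fun A B (box_fun A B F G) H,
                         Cmp = (\<lambda>x\<in>Obj A. Ass B (FO F x) (FO G x) (FO H x)) \<rparr>),
       Run = (\<lambda>F. \<lparr> Src = box_fun A B F (unit_fun A B), Trg = F,
                     Cmp = (\<lambda>x\<in>Obj A. Run B (FO F x)) \<rparr>),
       Lun = (\<lambda>F. \<lparr> Src = box_fun A B (unit_fun A B) F, Trg = F,
                     Cmp = (\<lambda>x\<in>Obj A. Lun B (FO F x)) \<rparr>),
       Sym = (\<lambda>F G. \<lparr> Src = box_fun A B F G, Trg = box_fun A B G F,
                       Cmp = (\<lambda>x\<in>Obj A. Sym B (FO F x) (FO G x)) \<rparr>) \<rparr>"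

text \<open>\<open>postcomp A B C F\<close> is \<open>[A, F] = [1, F] : [A, B] \<rightarrow> [A, C]\<close> for \<open>F : B \<rightarrow> C\<close>.\<close>

definition postcomp ::
  "('oa, 'aa) smcat \<Rightarrow> ('ob, 'ab) smcat \<Rightarrow> ('oc, 'ac) smcat \<Rightarrow> ('ob, 'ab, 'oc, 'ac) smfun \<Rightarrow>
   (('oa, 'aa, 'ob, 'ab) smfun, ('oa, 'aa, 'ob, 'ab) smtrans,
    ('oa, 'aa, 'oc, 'ac) smfun, ('oa, 'aa, 'oc, 'ac) smtrans) smfun" where
  "postcomp A B C F =
     \<lparr> FO = (\<lambda>H\<in>Obj (ihom A B). comp_fun A C F H),
       FA = (\<lambda>\<theta>\<in>Arr (ihom A B). whisker_l A C F \<theta>),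
       F0 = \<lparr> Src = unit_fun A C, Trg = comp_fun A C F (unit_fun A B),
              Cmp = (\<lambda>a\<in>Obj A. F0 F) \<rparr>,
       F2 = (\<lambda>(H, K)\<in>Obj (ihom A B) \<times> Obj (ihom A B).
               \<lparr> Src = box_fun A C (comp_fun A C F H) (comp_fun A C F K),
                 Trg = comp_fun A C F (box_fun A B H K),
                 Cmp = (\<lambda>a\<in>Obj A. F2 F (FO H a, FO K a)) \<rparr>) \<rparr>"

text \<open>\<open>precomp C A B F\<close> is \<open>[F, B] = [F, 1] : [A, B] \<rightarrow> [C, B]\<close> for \<open>F : C \<rightarrow> A\<close>.\<close>

definition precomp ::
  "('oc, 'ac) smcat \<Rightarrow> ('oa, 'aa) smcat \<Rightarrow> ('ob, 'ab) smcat \<Rightarrow> ('oc, 'ac, 'oa, 'aa) smfun \<Rightarrow>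
   (('oa, 'aa, 'ob, 'ab) smfun, ('oa, 'aa, 'ob, 'ab) smtrans,
    ('oc, 'ac, 'ob, 'ab) smfun, ('oc, 'ac, 'ob, 'ab) smtrans) smfun" where
  "precomp C A B F =
     strict_fun (ihom A B) (ihom C B) (\<lambda>H. comp_fun C B H F) (\<lambda>\<theta>. whisker_r C B \<theta> F)"


section \<open>Duality\<close>

text \<open>For \<open>F : A \<rightarrow> [B, C]\<close>, \<open>dual_at A F b\<close> is \<open>F\<^sup>*(b) : A \<rightarrow> C\<close> and \<open>dual A B C F\<close> is \<open>F\<^sup>*\<close>.\<close>

definition dual_at ::
  "('oa, 'aa) smcat \<Rightarrow>
   ('oa, 'aa, ('ob, 'ab, 'oc, 'ac) smfun, ('ob, 'ab, 'oc, 'ac) smtrans) smfun \<Rightarrow> 'ob \<Rightarrow>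
   ('oa, 'aa, 'oc, 'ac) smfun" where
  "dual_at A F b =
     \<lparr> FO = (\<lambda>a\<in>Obj A. FO (FO F a) b),
       FA = (\<lambda>f\<in>Arr A. Cmp (FA F f) b),
       F0 = Cmp (F0 F) b,
       F2 = (\<lambda>(a, a')\<in>Obj A \<times> Obj A. Cmp (F2 F (a, a')) b) \<rparr>"

definition dual ::
  "('oa, 'aa) smcat \<Rightarrow> ('ob, 'ab) smcat \<Rightarrow> ('oc, 'ac) smcat \<Rightarrow>
   ('oa, 'aa, ('ob, 'ab, 'oc, 'ac) smfun, ('ob, 'ab, 'oc, 'ac) smtrans) smfun \<Rightarrow>
   ('ob, 'ab, ('oa, 'aa, 'oc, 'ac) smfun, ('oa, 'aa, 'oc, 'ac) smtrans) smfun" where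
  "dual A B C F =
     \<lparr> FO = (\<lambda>b\<in>Obj B. dual_at A F b),
       FA = (\<lambda>g\<in>Arr B. \<lparr> Src = dual_at A F (Dom B g), Trg = dual_at A F (Cod B g),
                          Cmp = (\<lambda>a\<in>Obj A. FA (FO F a) g) \<rparr>),
       F0 = \<lparr> Src = unit_fun A C, Trg = dual_at A F \<one>\<^bsub>B\<^esub>, Cmp = (\<lambda>a\<in>Obj A. F0 (FO F a)) \<rparr>,
       F2 = (\<lambda>(b, b')\<in>Obj B \<times> Obj B.
               \<lparr> Src = box_fun A C (dual_at A F b) (dual_at A F b'),
                 Trg = dual_at A F (b \<otimes>\<^bsub>B\<^esub> b'),
                 Cmp = (\<lambda>a\<in>Obj A. F2 (FO F a) (b, b')) \<rparr>) \<rparr>"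

definition dual_trans ::
  "('oa, 'aa) smcat \<Rightarrow> ('ob, 'ab) smcat \<Rightarrow> ('oc, 'ac) smcat \<Rightarrow>
   ('oa, 'aa, ('ob, 'ab, 'oc, 'ac) smfun, ('ob, 'ab, 'oc, 'ac) smtrans) smtrans \<Rightarrow>
   ('ob, 'ab, ('oa, 'aa, 'oc, 'ac) smfun, ('oa, 'aa, 'oc, 'ac) smtrans) smtrans" where
  "dual_trans A B C \<theta> =
     \<lparr> Src = dual A B C (Src \<theta>), Trg = dual A B C (Trg \<theta>),
       Cmp = (\<lambda>b\<in>Obj B. \<lparr> Src = dual_at A (Src \<theta>) b, Trg = dual_at A (Trg \<theta>) b,
                           Cmp = (\<lambda>a\<in>Obj A. Cmp (Cmp \<theta> a) b) \<rparr>) \<rparr>"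

text \<open>\<open>dualizer A B C\<close> is \<open>D : [A, [B, C]] \<rightarrow> [B, [A, C]]\<close>.\<close>

definition dualizer ::
  "('oa, 'aa) smcat \<Rightarrow> ('ob, 'ab) smcat \<Rightarrow> ('oc, 'ac) smcat \<Rightarrow>
   (('oa, 'aa, ('ob, 'ab, 'oc, 'ac) smfun, ('ob, 'ab, 'oc, 'ac) smtrans) smfun,
    ('oa, 'aa, ('ob, 'ab, 'oc, 'ac) smfun, ('ob, 'ab, 'oc, 'ac) smtrans) smtrans,
    ('ob, 'ab, ('oa, 'aa, 'oc, 'ac) smfun, ('oa, 'aa, 'oc, 'ac) smtrans) smfun,
    ('ob, 'ab, ('oa, 'aa, 'oc, 'ac) smfun, ('oa, 'aa, 'oc, 'ac) smtrans) smtrans) smfun" where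
  "dualizer A B C =
     strict_fun (ihom A (ihom B C)) (ihom B (ihom A C)) (dual A B C) (dual_trans A B C)"

text \<open>\<open>hom_from D C B\<close> is \<open>[D, -] : [C, B] \<rightarrow> [[D, C], [D, B]]\<close>.\<close>

definition hom_from ::
  "('od, 'ad) smcat \<Rightarrow> ('oc, 'ac) smcat \<Rightarrow> ('ob, 'ab) smcat \<Rightarrow>
   (('oc, 'ac, 'ob, 'ab) smfun, ('oc, 'ac, 'ob, 'ab) smtrans,
    (('od, 'ad, 'oc, 'ac) smfun, ('od, 'ad, 'oc, 'ac) smtrans,
     ('od, 'ad, 'ob, 'ab) smfun, ('od, 'ad, 'ob, 'ab) smtrans) smfun,
    (('od, 'ad, 'oc, 'ac) smfun, ('od, 'ad, 'oc, 'ac) smtrans,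
     ('od, 'ad, 'ob, 'ab) smfun, ('od, 'ad, 'ob, 'ab) smtrans) smtrans) smfun" where
  "hom_from D C B =
     strict_fun (ihom C B) (ihom (ihom D C) (ihom D B))
       (postcomp D C B)
       (\<lambda>\<sigma>. \<lparr> Src = postcomp D C B (Src \<sigma>), Trg = postcomp D C B (Trg \<sigma>),
              Cmp = (\<lambda>G\<in>Obj (ihom D C). whisker_r D B \<sigma> G) \<rparr>)"

text \<open>\<open>hom_into D C B\<close> is \<open>[-, B] : [D, C] \<rightarrow> [[C, B], [D, B]]\<close>, the dual of \<open>[D, -]\<close>.\<close>

definition hom_into ::
  "('od, 'ad) smcat \<Rightarrow> ('oc, 'ac) smcat \<Rightarrow> ('ob, 'ab) smcat \<Rightarrow>
   (('od, 'ad, 'oc, 'ac) smfun, ('od, 'ad, 'oc, 'ac) smtrans,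
    (('oc, 'ac, 'ob, 'ab) smfun, ('oc, 'ac, 'ob, 'ab) smtrans,
     ('od, 'ad, 'ob, 'ab) smfun, ('od, 'ad, 'ob, 'ab) smtrans) smfun,
    (('oc, 'ac, 'ob, 'ab) smfun, ('oc, 'ac, 'ob, 'ab) smtrans,
     ('od, 'ad, 'ob, 'ab) smfun, ('od, 'ad, 'ob, 'ab) smtrans) smtrans) smfun" where
  "hom_into D C B = dual (ihom C B) (ihom D C) (ihom D B) (hom_from D C B)"

end

theory Submission
  imports Defs "HOL-Library.Multiset"
begin

text \<open>
  Both composites send \<open>G : D \<rightarrow> C\<close> to the functor \<open>a \<mapsto> F(a) \<circ> G\<close> from \<open>A\<close> to \<open>[D, B]\<close> and an arrow \<open>\<tau>\<close> to
  the transformation with components \<open>F(a)(\<tau>\<^sub>d)\<close>. Their unit and tensor structures at \<open>a\<close> and \<open>d\<close>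
  are \<open>F(a)\<^sup>0\<close> and \<open>F(a)\<^sup>2\<close>, since \<open>[F, 1]\<close> and the duality isomorphism are
  strict and contribute identities. Hence the two agree componentwise (\<open>dual_at_transpose\<close>,
  \<open>dual_transpose\<close>, \<open>upper_eq_lower\<close>).

  The substance lies in the functors being well defined. The internal hom has to be a symmetric monoidal
  category (\<open>sm_category_ihom\<close>): pointwise tensor products of symmetric monoidal functors are symmetric
  monoidal, and the pointwise structure isomorphisms are monoidal transformations. Functors
  \<open>[A, F]\<close> (\<open>sm_functor_postcomp\<close>), \<open>[F, B]\<close> (\<open>sm_functor_precomp\<close>), \<open>[D, -]\<close> (\<open>sm_functor_hom_from\<close>) and
  duals (\<open>sm_functor_dual\<close>) then exist, and the first composite is symmetric monoidal as a composite of
  such functors; the second one is symmetric monoidal because it equals the first.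

  All of this rests on a few equations for the canonical interchange \<open>(ab)(cd) \<rightarrow> (ac)(bd)\<close>: it is natural,
  inverse to its own transpose, compatible with \<open>ass\<close>, \<open>r\<close>, \<open>l\<close> and \<open>s\<close>, and preserved by symmetric
  monoidal functors (\<open>F_interchange\<close>). Involutivity is what makes the dual of a functor symmetric
  monoidal: the tensor products over the two variables order the four factors differently. The equations
  in one category follow from a coherence theorem (\<open>coherence\<close>): every arrow built from
  the structure isomorphisms commutes with the canonical arrows that sort the factors, so
  parallel ones agree if the factors are distinct variables. The commutation of two insertions that
  this needs (\<open>ins_ins\<close>) is the Yang--Baxter equation, a consequence of the hexagon.
\<close>

section \<open>Calculating in a symmetric monoidal category\<close>

locale smc =
  fixes C :: "('o, 'a) smcat" (structure)
  assumes sm_category: "sm_category C"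
begin

lemma
  shows category: "category C"
    and tensor: "tensor_bifunctor C"
    and unit_obj [simp]: "\<one> \<in> Obj C"
    and isos: "structure_isos C"
    and coh: "coherence_axioms C"
  using sm_category by (auto simp: sm_category_def)

lemma dom_obj [simp]: "f \<in> Arr C \<Longrightarrow> Dom C f \<in> Obj C"
  and cod_obj [simp]: "f \<in> Arr C \<Longrightarrow> Cod C f \<in> Obj C"
  using category by (auto simp: category_def)

lemma id_arr [simp]:
  assumes "x \<in> Obj C"
  shows "Id C x \<in> Arr C" "Dom C (Id C x) = x" "Cod C (Id C x) = x"
  using category assms by (auto simp: category_def Hom_def)

lemma comp_arr [simp]:
  assumes "f \<in> Arr C" "g \<in> Arr C" "Cod C f = Dom C g"
  shows "g \<cdot> f \<in> Arr C" "Dom C (g \<cdot> f) = Dom C f" "Cod C (g \<cdot> f) = Cod C g"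
  using category assms by (auto simp: category_def Hom_def)

lemma comp_id [simp]:
  assumes "f \<in> Arr C"
  shows "Dom C f = x \<Longrightarrow> f \<cdot> Id C x = f" "Cod C f = x \<Longrightarrow> Id C x \<cdot> f = f"
  using category assms by (auto simp: category_def)

lemma comp_assoc [simp]:
  assumes "f \<in> Arr C" "g \<in> Arr C" "h \<in> Arr C" "Cod C f = Dom C g" "Cod C g = Dom C h"
  shows "(h \<cdot> g) \<cdot> f = h \<cdot> g \<cdot> f"
  using category assms by (auto simp: category_def)

lemma tensor_obj [simp]: "x \<in> Obj C \<Longrightarrow> y \<in> Obj C \<Longrightarrow> x \<otimes> y \<in> Obj C"
  and tensor_id [simp]: "x \<in> Obj C \<Longrightarrow> y \<in> Obj C \<Longrightarrow> Id C x \<odot> Id C y = Id C (x \<otimes> y)"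
  using tensor by (auto simp: tensor_bifunctor_def)

lemma tensor_arr [simp]:
  assumes "f \<in> Arr C" "g \<in> Arr C"
  shows "f \<odot> g \<in> Arr C" "Dom C (f \<odot> g) = Dom C f \<otimes> Dom C g"
    "Cod C (f \<odot> g) = Cod C f \<otimes> Cod C g"
  using tensor assms by (auto simp: tensor_bifunctor_def Hom_def)

lemma tensor_comp [simp]:
  assumes "f \<in> Arr C" "f' \<in> Arr C" "g \<in> Arr C" "g' \<in> Arr C"
    "Cod C f = Dom C f'" "Cod C g = Dom C g'"
  shows "(f' \<odot> g') \<cdot> (f \<odot> g) = (f' \<cdot> f) \<odot> (g' \<cdot> g)"
  using tensor assms by (auto simp: tensor_bifunctor_def)

text \<open>
  Composites are kept bracketed to the right, so an equation \<open>g \<cdot> f = h\<close> can only be applied inside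
  a longer composite in this form.
\<close>

lemma comp_reduce:
  assumes "g \<cdot> f = h" "f \<in> Arr C" "g \<in> Arr C" "k \<in> Arr C" "Cod C f = Dom C g" "Cod C k = Dom C f"
  shows "g \<cdot> f \<cdot> k = h \<cdot> k"
  using assms comp_assoc by metis

lemma tensor_comp_reduce [simp]:
  assumes "f \<in> Arr C" "f' \<in> Arr C" "g \<in> Arr C" "g' \<in> Arr C" "k \<in> Arr C"
    "Cod C f = Dom C f'" "Cod C g = Dom C g'" "Cod C k = Dom C f \<otimes> Dom C g"
  shows "(f' \<odot> g') \<cdot> (f \<odot> g) \<cdot> k = ((f' \<cdot> f) \<odot> (g' \<cdot> g)) \<cdot> k"
  using assms by (intro comp_reduce) auto

lemma inverse_pair_sym:
  "inverse_pair C f g \<Longrightarrow> inverse_pair C g f"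
  using dom_obj cod_obj by (auto simp: inverse_pair_def Hom_def)

lemma inverse_pair_unique:
  assumes "inverse_pair C f g" "inverse_pair C f h"
  shows "g = h"
proof -
  have "g = g \<cdot> f \<cdot> h"
    using assms by (auto simp: inverse_pair_def Hom_def)
  also have "\<dots> = h"
    using assms by (subst comp_reduce[where h = "Id C (Dom C f)"])
      (auto simp: inverse_pair_def Hom_def)
  finally show ?thesis .
qed

lemma inv_arr_eqI: "inverse_pair C f g \<Longrightarrow> inv_arr C f = g"
  unfolding inv_arr_def using inverse_pair_unique by blast

lemma inverse_pair_inv_arr: "iso_arr C f \<Longrightarrow> inverse_pair C f (inv_arr C f)"
  using inv_arr_eqI by (auto simp: iso_arr_def)

lemma iso_arr_arr: "iso_arr C f \<Longrightarrow> f \<in> Arr C"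
  by (auto simp: iso_arr_def inverse_pair_def)

lemma inv_arr_arr [simp]:
  assumes "iso_arr C f"
  shows "inv_arr C f \<in> Arr C" "Dom C (inv_arr C f) = Cod C f" "Cod C (inv_arr C f) = Dom C f"
  using inverse_pair_inv_arr[OF assms] by (auto simp: inverse_pair_def Hom_def)

lemma inv_arr_comp [simp]:
  assumes "iso_arr C f"
  shows "inv_arr C f \<cdot> f = Id C (Dom C f)" "f \<cdot> inv_arr C f = Id C (Cod C f)"
  using inverse_pair_inv_arr[OF assms] by (auto simp: inverse_pair_def Hom_def)

lemma inv_arr_reduce [simp]:
  assumes "iso_arr C f" "k \<in> Arr C"
  shows "Cod C k = Dom C f \<Longrightarrow> inv_arr C f \<cdot> f \<cdot> k = k"
    "Cod C k = Cod C f \<Longrightarrow> f \<cdot> inv_arr C f \<cdot> k = k"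
  using assms iso_arr_arr by (subst comp_reduce[OF inv_arr_comp(1)], auto)
    (subst comp_reduce[OF inv_arr_comp(2)], auto)

lemma iso_inv_arr [simp]: "iso_arr C f \<Longrightarrow> iso_arr C (inv_arr C f)"
  using inverse_pair_inv_arr inverse_pair_sym by (auto simp: iso_arr_def)

lemma inverse_pair_id: "x \<in> Obj C \<Longrightarrow> inverse_pair C (Id C x) (Id C x)"
  by (auto simp: inverse_pair_def Hom_def)

lemma inverse_pair_comp:
  assumes "inverse_pair C f f'" "inverse_pair C g g'" "Cod C f = Dom C g"
  shows "inverse_pair C (g \<cdot> f) (f' \<cdot> g')"
  using assms comp_reduce[of f f' "Id C (Dom C g)" g'] comp_reduce[of g' g "Id C (Dom C g)" f]
  by (auto simp: inverse_pair_def Hom_def)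

lemma inverse_pair_tensor:
  assumes "inverse_pair C f f'" "inverse_pair C g g'"
  shows "inverse_pair C (f \<odot> g) (f' \<odot> g')"
  using assms by (auto simp: inverse_pair_def Hom_def)

lemma iso_id [simp]: "x \<in> Obj C \<Longrightarrow> iso_arr C (Id C x)"
  and iso_comp [simp]: "iso_arr C f \<Longrightarrow> iso_arr C g \<Longrightarrow> Cod C f = Dom C g \<Longrightarrow> iso_arr C (g \<cdot> f)"
  and iso_tensor [simp]: "iso_arr C f \<Longrightarrow> iso_arr C g \<Longrightarrow> iso_arr C (f \<odot> g)"
  using inverse_pair_id inverse_pair_comp inverse_pair_tensor by (meson iso_arr_def)+

lemma iso_left_cancel:
  assumes "h \<cdot> f = h \<cdot> g" "iso_arr C h" "f \<in> Arr C" "g \<in> Arr C" "Cod C f = Dom C h" "Cod C g = Dom C h"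
  shows "f = g"
  using assms inv_arr_reduce(1) by metis

lemma iso_right_cancel:
  assumes "f \<cdot> h = g \<cdot> h" "iso_arr C h" "f \<in> Arr C" "g \<in> Arr C" "Dom C f = Cod C h" "Dom C g = Cod C h"
  shows "f = g"
proof -
  have "f = (f \<cdot> h) \<cdot> inv_arr C h" "g = (g \<cdot> h) \<cdot> inv_arr C h"
    using assms(2-) iso_arr_arr[OF assms(2)] by simp_all
  then show ?thesis
    using assms(1) by simp
qed

lemma iso_move_left:
  assumes "h \<cdot> f = g" "iso_arr C h" "f \<in> Arr C" "Cod C f = Dom C h"
  shows "f = inv_arr C h \<cdot> g"
  using assms iso_arr_arr inv_arr_reduce(1) by metis

lemma ass_arr [simp]:
  assumes "x \<in> Obj C" "y \<in> Obj C" "z \<in> Obj C"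
  shows "Ass C x y z \<in> Arr C" "Dom C (Ass C x y z) = x \<otimes> (y \<otimes> z)"
    "Cod C (Ass C x y z) = (x \<otimes> y) \<otimes> z" "iso_arr C (Ass C x y z)"
  using isos assms by (auto simp: structure_isos_def Hom_def)

lemma run_arr [simp]:
  assumes "x \<in> Obj C"
  shows "Run C x \<in> Arr C" "Dom C (Run C x) = x \<otimes> \<one>" "Cod C (Run C x) = x" "iso_arr C (Run C x)"
  using isos assms by (auto simp: structure_isos_def Hom_def)

lemma lun_arr [simp]:
  assumes "x \<in> Obj C"
  shows "Lun C x \<in> Arr C" "Dom C (Lun C x) = \<one> \<otimes> x" "Cod C (Lun C x) = x" "iso_arr C (Lun C x)"
  using isos assms by (auto simp: structure_isos_def Hom_def)

lemma sym_arr [simp]: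
  assumes "x \<in> Obj C" "y \<in> Obj C"
  shows "Sym C x y \<in> Arr C" "Dom C (Sym C x y) = x \<otimes> y" "Cod C (Sym C x y) = y \<otimes> x"
    "iso_arr C (Sym C x y)"
  using isos assms by (auto simp: structure_isos_def Hom_def)

lemma ass_natural:
  assumes "f \<in> Arr C" "g \<in> Arr C" "h \<in> Arr C"
    "Dom C f = x" "Dom C g = y" "Dom C h = z" "Cod C f = x'" "Cod C g = y'" "Cod C h = z'"
  shows "Ass C x' y' z' \<cdot> (f \<odot> (g \<odot> h)) = ((f \<odot> g) \<odot> h) \<cdot> Ass C x y z"
  using isos assms by (auto simp: structure_isos_def)

lemma run_natural: "f \<in> Arr C \<Longrightarrow> Run C (Cod C f) \<cdot> (f \<odot> Id C \<one>) = f \<cdot> Run C (Dom C f)"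
  and lun_natural: "f \<in> Arr C \<Longrightarrow> Lun C (Cod C f) \<cdot> (Id C \<one> \<odot> f) = f \<cdot> Lun C (Dom C f)"
  using isos by (auto simp: structure_isos_def)

lemma sym_natural:
  assumes "f \<in> Arr C" "g \<in> Arr C" "Dom C f = x" "Dom C g = y" "Cod C f = x'" "Cod C g = y'"
  shows "Sym C x' y' \<cdot> (f \<odot> g) = (g \<odot> f) \<cdot> Sym C x y"
  using isos assms by (auto simp: structure_isos_def)

lemma inv_ass_natural:
  assumes "f \<in> Arr C" "g \<in> Arr C" "h \<in> Arr C"
    "Dom C f = x" "Dom C g = y" "Dom C h = z" "Cod C f = x'" "Cod C g = y'" "Cod C h = z'"
  shows "inv_arr C (Ass C x' y' z') \<cdot> ((f \<odot> g) \<odot> h) = (f \<odot> (g \<odot> h)) \<cdot> inv_arr C (Ass C x y z)"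
proof -
  have o: "x \<in> Obj C" "y \<in> Obj C" "z \<in> Obj C" "x' \<in> Obj C" "y' \<in> Obj C" "z' \<in> Obj C"
    using assms by auto
  have "Ass C x' y' z' \<cdot> ((f \<odot> (g \<odot> h)) \<cdot> inv_arr C (Ass C x y z)) = (f \<odot> g) \<odot> h"
    using assms o by (subst comp_reduce[OF ass_natural[of f g h x y z]]) auto
  from iso_move_left[OF this] show ?thesis
    using assms o by simp
qed

lemma pentagon:
  assumes "a \<in> Obj C" "b \<in> Obj C" "c \<in> Obj C" "d \<in> Obj C"
  shows "Ass C (a \<otimes> b) c d \<cdot> Ass C a b (c \<otimes> d) =
    (Ass C a b c \<odot> Id C d) \<cdot> Ass C a (b \<otimes> c) d \<cdot> (Id C a \<odot> Ass C b c d)"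
  using coh assms by (auto simp: coherence_axioms_def)

lemma triangle:
  assumes "a \<in> Obj C" "c \<in> Obj C"
  shows "(Run C a \<odot> Id C c) \<cdot> Ass C a \<one> c = Id C a \<odot> Lun C c"
  using coh assms by (auto simp: coherence_axioms_def)

lemma sym_sym:
  assumes "a \<in> Obj C" "b \<in> Obj C"
  shows "Sym C b a \<cdot> Sym C a b = Id C (a \<otimes> b)"
  using coh assms by (auto simp: coherence_axioms_def)

lemma sym_unit: "a \<in> Obj C \<Longrightarrow> Lun C a \<cdot> Sym C a \<one> = Run C a"
  using coh by (auto simp: coherence_axioms_def)

lemma hexagon:
  assumes "a \<in> Obj C" "b \<in> Obj C" "c \<in> Obj C"
  shows "Ass C c a b \<cdot> Sym C (a \<otimes> b) c \<cdot> Ass C a b c =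
        (Sym C a c \<odot> Id C b) \<cdot> Ass C a c b \<cdot> (Id C a \<odot> Sym C b c)"
  using coh assms by (auto simp: coherence_axioms_def)

text \<open>
  Kelly's lemma: after tensoring on the left with the unit the equation follows from the pentagon and
  the triangle, and tensoring with the unit is faithful because \<open>l\<close> is a natural isomorphism.
\<close>

lemma lun_tensor:
  assumes b: "b \<in> Obj C" and c: "c \<in> Obj C"
  shows "(Lun C b \<odot> Id C c) \<cdot> Ass C \<one> b c = Lun C (b \<otimes> c)"
proof -
  let ?a = "\<one>"
  have "Ass C ?a b c \<cdot> (Id C ?a \<odot> Lun C (b \<otimes> c)) =
    Ass C ?a b c \<cdot> (Run C ?a \<odot> (Id C b \<odot> Id C c)) \<cdot> Ass C ?a \<one> (b \<otimes> c)"
    using assms triangle[of ?a "b \<otimes> c"] by simp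
  also have "\<dots> = ((Run C ?a \<odot> Id C b) \<odot> Id C c) \<cdot> Ass C (?a \<otimes> \<one>) b c \<cdot> Ass C ?a \<one> (b \<otimes> c)"
    using assms by (subst comp_reduce[OF ass_natural]) (auto simp del: tensor_id)
  also have "\<dots> = ((Run C ?a \<odot> Id C b) \<odot> Id C c) \<cdot>
      (Ass C ?a \<one> b \<odot> Id C c) \<cdot> Ass C ?a (\<one> \<otimes> b) c \<cdot> (Id C ?a \<odot> Ass C \<one> b c)"
    using assms by (simp add: pentagon)
  also have "\<dots> = ((Id C ?a \<odot> Lun C b) \<odot> Id C c) \<cdot> Ass C ?a (\<one> \<otimes> b) c \<cdot> (Id C ?a \<odot> Ass C \<one> b c)"
    using assms by (simp add: triangle)
  also have "\<dots> = (((Id C ?a \<odot> Lun C b) \<odot> Id C c) \<cdot> Ass C ?a (\<one> \<otimes> b) c) \<cdot> (Id C ?a \<odot> Ass C \<one> b c)"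
    using assms by simp
  also have "\<dots> = (Ass C ?a b c \<cdot> (Id C ?a \<odot> (Lun C b \<odot> Id C c))) \<cdot> (Id C ?a \<odot> Ass C \<one> b c)"
    using assms ass_natural[of "Id C ?a" "Lun C b" "Id C c" ?a "\<one> \<otimes> b" c ?a b c] by simp
  also have "\<dots> = Ass C ?a b c \<cdot> (Id C ?a \<odot> (Lun C b \<odot> Id C c)) \<cdot> (Id C ?a \<odot> Ass C \<one> b c)"
    using assms by simp
  finally have "Id C ?a \<odot> Lun C (b \<otimes> c) = (Id C ?a \<odot> (Lun C b \<odot> Id C c)) \<cdot> (Id C ?a \<odot> Ass C \<one> b c)"
    by (rule iso_left_cancel) (use assms in auto)
  then have "Lun C (b \<otimes> c) \<cdot> (Id C \<one> \<odot> Lun C (b \<otimes> c)) =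
      Lun C (b \<otimes> c) \<cdot> (Id C \<one> \<odot> ((Lun C b \<odot> Id C c) \<cdot> Ass C \<one> b c))"
    using assms by simp
  then have "Lun C (b \<otimes> c) \<cdot> Lun C (\<one> \<otimes> (b \<otimes> c)) =
      ((Lun C b \<odot> Id C c) \<cdot> Ass C \<one> b c) \<cdot> Lun C (\<one> \<otimes> (b \<otimes> c))"
    using assms lun_natural[of "Lun C (b \<otimes> c)"] lun_natural[of "(Lun C b \<odot> Id C c) \<cdot> Ass C \<one> b c"]
    by simp
  then show ?thesis
    by (rule iso_right_cancel[OF sym]) (use assms in auto)
qed

section \<open>The left-nested transposition\<close>

text \<open>
  Words in the objects are evaluated as \<open>x\<^sub>1 \<otimes> (x\<^sub>2 \<otimes> (\<dots> \<otimes> z))\<close>, ending in an arbitrary tail \<open>z\<close>. In this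
  form the transposition of two neighbours needs no associativity isomorphism of the surrounding
  word, and it is natural in the tail.
\<close>

definition swap :: "'o \<Rightarrow> 'o \<Rightarrow> 'o \<Rightarrow> 'a" where
  "swap x y z = inv_arr C (Ass C y x z) \<cdot> (Sym C x y \<odot> Id C z) \<cdot> Ass C x y z"

lemma swap_arr [simp]:
  assumes "x \<in> Obj C" "y \<in> Obj C" "z \<in> Obj C"
  shows "swap x y z \<in> Arr C" "Dom C (swap x y z) = x \<otimes> (y \<otimes> z)"
    "Cod C (swap x y z) = y \<otimes> (x \<otimes> z)" "iso_arr C (swap x y z)"
  using assms by (auto simp: swap_def)

lemma swap_natural:
  assumes "f \<in> Arr C" "g \<in> Arr C" "h \<in> Arr C"
    "Dom C f = x" "Dom C g = y" "Dom C h = z" "Cod C f = x'" "Cod C g = y'" "Cod C h = z'"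
  shows "swap x' y' z' \<cdot> (f \<odot> (g \<odot> h)) = (g \<odot> (f \<odot> h)) \<cdot> swap x y z"
proof -
  have o: "x \<in> Obj C" "y \<in> Obj C" "z \<in> Obj C" "x' \<in> Obj C" "y' \<in> Obj C" "z' \<in> Obj C"
    using assms by auto
  have "swap x' y' z' \<cdot> (f \<odot> (g \<odot> h)) =
      inv_arr C (Ass C y' x' z') \<cdot> (Sym C x' y' \<odot> Id C z') \<cdot> ((f \<odot> g) \<odot> h) \<cdot> Ass C x y z"
    using assms o by (simp add: swap_def ass_natural[of f g h x y z])
  also have "\<dots> = inv_arr C (Ass C y' x' z') \<cdot> ((g \<odot> f) \<odot> h) \<cdot> (Sym C x y \<odot> Id C z) \<cdot> Ass C x y z"
    using assms o by (simp add: sym_natural[of f g x y])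
  also have "\<dots> = (g \<odot> (f \<odot> h)) \<cdot> swap x y z"
    using assms o by (subst comp_reduce[OF inv_ass_natural[of g f h y x z]]) (auto simp: swap_def)
  finally show ?thesis .
qed

lemma swap_swap:
  assumes "x \<in> Obj C" "y \<in> Obj C" "z \<in> Obj C"
  shows "swap y x z \<cdot> swap x y z = Id C (x \<otimes> (y \<otimes> z))"
  using assms by (simp add: swap_def sym_sym)

text \<open>The hexagon in left-nested form: a product is moved past \<open>w\<close> one factor at a time.\<close>

lemma swap_tensor:
  assumes o: "x \<in> Obj C" "y \<in> Obj C" "w \<in> Obj C" "z \<in> Obj C"
  shows "swap (x \<otimes> y) w z \<cdot> Ass C x y (w \<otimes> z) =
    (Id C w \<odot> Ass C x y z) \<cdot> swap x w (y \<otimes> z) \<cdot> (Id C x \<odot> swap y w z)"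
proof -
  let ?i = "\<lambda>x y z. inv_arr C (Ass C x y z)"
  \<comment> \<open>Both sides are rewritten with one hexagon; the three pentagons move the outer bracket past its arrows.\<close>
  have pent1: "Ass C (x \<otimes> y) w z \<cdot> Ass C x y (w \<otimes> z) =
      (Ass C x y w \<odot> Id C z) \<cdot> Ass C x (y \<otimes> w) z \<cdot> (Id C x \<odot> Ass C y w z)"
    using o by (simp add: pentagon)
  have hex: "(Sym C (x \<otimes> y) w \<odot> Id C z) \<cdot> (Ass C x y w \<odot> Id C z) =
      (?i w x y \<odot> Id C z) \<cdot> ((Sym C x w \<odot> Id C y) \<odot> Id C z) \<cdot> (Ass C x w y \<odot> Id C z) \<cdot>
        ((Id C x \<odot> Sym C y w) \<odot> Id C z)"
    using o iso_move_left[OF hexagon[of x y w]] by simp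
  have nat1: "Ass C x (w \<otimes> y) z \<cdot> (Id C x \<odot> (Sym C y w \<odot> Id C z)) =
      ((Id C x \<odot> Sym C y w) \<odot> Id C z) \<cdot> Ass C x (y \<otimes> w) z"
    using o by (intro ass_natural) auto
  have nat2: "Ass C (w \<otimes> x) y z \<cdot> (Sym C x w \<odot> Id C (y \<otimes> z)) =
      ((Sym C x w \<odot> Id C y) \<odot> Id C z) \<cdot> Ass C (x \<otimes> w) y z"
    using o ass_natural[of "Sym C x w" "Id C y" "Id C z" "x \<otimes> w" y z "w \<otimes> x" y z] by simp
  have pent2: "(Ass C x w y \<odot> Id C z) \<cdot> Ass C x (w \<otimes> y) z =
      Ass C (x \<otimes> w) y z \<cdot> Ass C x w (y \<otimes> z) \<cdot> (Id C x \<odot> ?i w y z)"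
    using o by (subst comp_reduce[OF pentagon]) auto
  have "Ass C w (x \<otimes> y) z \<cdot> ((Id C w \<odot> Ass C x y z) \<cdot> ?i w x (y \<otimes> z)) =
      (?i w x y \<odot> Id C z) \<cdot> Ass C (w \<otimes> x) y z"
  proof -
    have "(?i w x y \<odot> Id C z) \<cdot> Ass C (w \<otimes> x) y z =
       (?i w x y \<odot> Id C z) \<cdot> (Ass C (w \<otimes> x) y z \<cdot> Ass C w x (y \<otimes> z)) \<cdot> ?i w x (y \<otimes> z)"
      using o by simp
    also have "\<dots> = Ass C w (x \<otimes> y) z \<cdot> ((Id C w \<odot> Ass C x y z) \<cdot> ?i w x (y \<otimes> z))"
      using o by (subst pentagon) simp_all
    finally show ?thesis by simp
  qed
  from iso_move_left[OF this]
  have pent3: "?i w (x \<otimes> y) z \<cdot> (?i w x y \<odot> Id C z) \<cdot> Ass C (w \<otimes> x) y z =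
      (Id C w \<odot> Ass C x y z) \<cdot> ?i w x (y \<otimes> z)"
    using o by simp
  have "swap (x \<otimes> y) w z \<cdot> Ass C x y (w \<otimes> z) =
    ?i w (x \<otimes> y) z \<cdot> (Sym C (x \<otimes> y) w \<odot> Id C z) \<cdot> (Ass C x y w \<odot> Id C z) \<cdot>
       Ass C x (y \<otimes> w) z \<cdot> (Id C x \<odot> Ass C y w z)"
    using o pent1 by (simp add: swap_def)
  also have "\<dots> = ?i w (x \<otimes> y) z \<cdot> ((Sym C (x \<otimes> y) w \<odot> Id C z) \<cdot> (Ass C x y w \<odot> Id C z)) \<cdot>
       Ass C x (y \<otimes> w) z \<cdot> (Id C x \<odot> Ass C y w z)"
    using o by (simp del: tensor_comp)
  also have "\<dots> =
     ?i w (x \<otimes> y) z \<cdot> (?i w x y \<odot> Id C z) \<cdot> ((Sym C x w \<odot> Id C y) \<odot> Id C z) \<cdot>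
       ((Ass C x w y \<odot> Id C z) \<cdot> Ass C x (w \<otimes> y) z) \<cdot>
        (Id C x \<odot> (Sym C y w \<odot> Id C z)) \<cdot> (Id C x \<odot> Ass C y w z)"
    unfolding hex using o comp_reduce[OF nat1[symmetric]] by (simp del: tensor_comp tensor_comp_reduce)
  also have "\<dots> = ?i w (x \<otimes> y) z \<cdot> (?i w x y \<odot> Id C z) \<cdot> ((Sym C x w \<odot> Id C y) \<odot> Id C z) \<cdot>
       Ass C (x \<otimes> w) y z \<cdot> Ass C x w (y \<otimes> z) \<cdot> (Id C x \<odot> swap y w z)"
    unfolding pent2 using o by (simp add: swap_def)
  also have "\<dots> = (?i w (x \<otimes> y) z \<cdot> (?i w x y \<odot> Id C z) \<cdot> Ass C (w \<otimes> x) y z) \<cdot>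
     (Sym C x w \<odot> Id C (y \<otimes> z)) \<cdot> Ass C x w (y \<otimes> z) \<cdot> (Id C x \<odot> swap y w z)"
    using o comp_reduce[OF nat2] by (simp del: tensor_comp tensor_comp_reduce)
  also have "\<dots> = (Id C w \<odot> Ass C x y z) \<cdot> swap x w (y \<otimes> z) \<cdot> (Id C x \<odot> swap y w z)"
    unfolding pent3 using o by (simp add: swap_def)
  finally show ?thesis .
qed

text \<open>The Yang--Baxter equation is naturality of \<open>swap (x \<otimes> y) w z\<close> in its first argument.\<close>

lemma swap_yang_baxter:
  assumes o: "x \<in> Obj C" "y \<in> Obj C" "w \<in> Obj C" "z \<in> Obj C"
  shows "swap y w (x \<otimes> z) \<cdot> (Id C y \<odot> swap x w z) \<cdot> swap x y (w \<otimes> z) =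
    (Id C w \<odot> swap x y z) \<cdot> swap x w (y \<otimes> z) \<cdot> (Id C x \<odot> swap y w z)"
proof -
  let ?r = "swap y w (x \<otimes> z) \<cdot> (Id C y \<odot> swap x w z) \<cdot> swap x y (w \<otimes> z)"
  have "(Id C w \<odot> Ass C y x z) \<cdot> ?r =
    ((Id C w \<odot> Ass C y x z) \<cdot> swap y w (x \<otimes> z) \<cdot> (Id C y \<odot> swap x w z)) \<cdot> swap x y (w \<otimes> z)"
    using o by simp
  also have "\<dots> = swap (y \<otimes> x) w z \<cdot> Ass C y x (w \<otimes> z) \<cdot> swap x y (w \<otimes> z)"
    using o by (simp flip: swap_tensor)
  also have "\<dots> = swap (y \<otimes> x) w z \<cdot> (Sym C x y \<odot> (Id C w \<odot> Id C z)) \<cdot> Ass C x y (w \<otimes> z)"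
    using o by (simp add: swap_def)
  also have "\<dots> = (Id C w \<odot> (Sym C x y \<odot> Id C z)) \<cdot> swap (x \<otimes> y) w z \<cdot> Ass C x y (w \<otimes> z)"
    using o comp_reduce[OF swap_natural[of "Sym C x y" "Id C w" "Id C z" "x \<otimes> y" w z "y \<otimes> x" w z]]
    by (simp del: tensor_comp tensor_comp_reduce)
  also have "\<dots> = (Id C w \<odot> Ass C y x z) \<cdot>
      ((Id C w \<odot> swap x y z) \<cdot> swap x w (y \<otimes> z) \<cdot> (Id C x \<odot> swap y w z))"
    using o unfolding swap_tensor[OF o] by (simp add: swap_def[of x y z])
  finally show ?thesis
    by (rule iso_left_cancel) (use o in auto)
qed

end

section \<open>Coherence by sorting\<close>

text \<open>
  To show that two parallel composites of structure isomorphisms agree, the objects are written as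
  trees over numbered leaves. Every tree has a canonical arrow to the word of its leaves in
  increasing order. Structure isomorphisms commute with these arrows, so any two of them between the
  same trees agree, provided that no leaf is repeated. Comparing with a sorted word
  replaces the presentation of the symmetric group by insertion sort.
\<close>

datatype otree = Leaf nat | Nul | Node otree otree

primrec leaves :: "otree \<Rightarrow> nat list" where
  "leaves (Leaf n) = [n]"
| "leaves Nul = []"
| "leaves (Node t u) = leaves t @ leaves u"

locale smc_env = smc C for C :: "('o, 'a) smcat" (structure) +
  fixes e :: "nat \<Rightarrow> 'o"
  assumes env_obj [simp]: "e n \<in> Obj C"
begin

primrec ev :: "otree \<Rightarrow> 'o" where
  "ev (Leaf n) = e n"
| "ev Nul = \<one>"
| "ev (Node t u) = ev t \<otimes> ev u"

primrec word :: "nat list \<Rightarrow> 'o \<Rightarrow> 'o" where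
  "word [] z = z"
| "word (x # xs) z = e x \<otimes> word xs z"

primrec word_arr :: "nat list \<Rightarrow> 'a \<Rightarrow> 'a" where
  "word_arr [] h = h"
| "word_arr (x # xs) h = Id C (e x) \<odot> word_arr xs h"

text \<open>
  The letter \<open>x\<close> moves to the right until the next letter is not smaller, as in the function \<open>insort\<close>.
\<close>

primrec ins :: "nat \<Rightarrow> nat list \<Rightarrow> 'o \<Rightarrow> 'a" where
  "ins x [] z = Id C (e x \<otimes> z)"
| "ins x (y # ws) z = (if x \<le> y then Id C (e x \<otimes> (e y \<otimes> word ws z))
     else (Id C (e y) \<odot> ins x ws z) \<cdot> swap (e x) (e y) (word ws z))"

text \<open>
  The letters of the first word, from the last to the first, are inserted into the second one. With an
  empty second word this is insertion sort; in general the first word need not be sorted.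
\<close>

primrec merge :: "nat list \<Rightarrow> nat list \<Rightarrow> 'o \<Rightarrow> 'a" where
  "merge [] ws z = Id C (word ws z)"
| "merge (x # xs) ws z = ins x (foldr insort xs ws) z \<cdot> (Id C (e x) \<odot> merge xs ws z)"

lemma ev_obj [simp]: "ev t \<in> Obj C"
  by (induction t) auto

lemma word_obj [simp]: "z \<in> Obj C \<Longrightarrow> word xs z \<in> Obj C"
  by (induction xs) auto

lemma word_append [simp]: "word (xs @ ys) z = word xs (word ys z)"
  by (induction xs) auto

lemma word_arr_arr [simp]:
  assumes "h \<in> Arr C"
  shows "word_arr xs h \<in> Arr C" "Dom C (word_arr xs h) = word xs (Dom C h)"
    "Cod C (word_arr xs h) = word xs (Cod C h)"
  using assms by (induction xs) auto

lemma ins_arr [simp]: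
  assumes "z \<in> Obj C"
  shows "ins x ws z \<in> Arr C \<and> Dom C (ins x ws z) = e x \<otimes> word ws z \<and>
    Cod C (ins x ws z) = word (insort x ws) z \<and> iso_arr C (ins x ws z)"
  using assms by (induction ws) auto

lemma merge_arr [simp]:
  assumes "z \<in> Obj C"
  shows "merge xs ws z \<in> Arr C \<and> Dom C (merge xs ws z) = word xs (word ws z) \<and>
    Cod C (merge xs ws z) = word (foldr insort xs ws) z \<and> iso_arr C (merge xs ws z)"
  using assms by (induction xs) auto

text \<open>
  When both letters have to move past the head of the word, this is the Yang--Baxter equation and the
  induction hypothesis; otherwise it is the involutivity of the symmetry. For equal letters the two
  sides would differ by a transposition.
\<close>

lemma ins_less_ins:
  assumes "x < y" "z \<in> Obj C"
  shows "ins x (insort y ws) z \<cdot> (Id C (e x) \<odot> ins y ws z) =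
    ins y (insort x ws) z \<cdot> (Id C (e y) \<odot> ins x ws z) \<cdot> swap (e x) (e y) (word ws z)"
proof (induction ws)
  case Nil
  then show ?case
    using assms by (simp add: swap_swap)
next
  case (Cons w ws)
  show ?case
  proof (cases "x \<le> w")
    case True
    then show ?thesis
      using assms by (auto simp: swap_swap)
  next
    case False
    then have yw: "\<not> y \<le> w" "\<not> x \<le> w" using assms by auto
    let ?z = "word ws z"
    have "ins x (insort y (w # ws)) z \<cdot> (Id C (e x) \<odot> ins y (w # ws) z) =
      (Id C (e w) \<odot> ins x (insort y ws) z) \<cdot>
        (swap (e x) (e w) (word (insort y ws) z) \<cdot> (Id C (e x) \<odot> (Id C (e w) \<odot> ins y ws z))) \<cdot>
        (Id C (e x) \<odot> swap (e y) (e w) ?z)"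
      using yw assms by simp
    also have "\<dots> = (Id C (e w) \<odot> (ins x (insort y ws) z \<cdot> (Id C (e x) \<odot> ins y ws z))) \<cdot>
        swap (e x) (e w) (e y \<otimes> ?z) \<cdot> (Id C (e x) \<odot> swap (e y) (e w) ?z)"
      using assms swap_natural[of "Id C (e x)" "Id C (e w)" "ins y ws z" "e x" "e w" "e y \<otimes> ?z"
          "e x" "e w" "word (insort y ws) z"] by simp
    also have "\<dots> = (Id C (e w) \<odot> (ins y (insort x ws) z \<cdot> (Id C (e y) \<odot> ins x ws z))) \<cdot>
        ((Id C (e w) \<odot> swap (e x) (e y) ?z) \<cdot> swap (e x) (e w) (e y \<otimes> ?z) \<cdot>
          (Id C (e x) \<odot> swap (e y) (e w) ?z))"
      using assms unfolding Cons.IH by simp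
    also have "\<dots> = (Id C (e w) \<odot> ins y (insort x ws) z) \<cdot>
        ((Id C (e w) \<odot> (Id C (e y) \<odot> ins x ws z)) \<cdot> swap (e y) (e w) (e x \<otimes> ?z)) \<cdot>
        (Id C (e y) \<odot> swap (e x) (e w) ?z) \<cdot> swap (e x) (e y) (e w \<otimes> ?z)"
      using assms by (subst swap_yang_baxter[symmetric]) simp_all
    also have "\<dots> = (Id C (e w) \<odot> ins y (insort x ws) z) \<cdot>
        (swap (e y) (e w) (word (insort x ws) z) \<cdot> (Id C (e y) \<odot> (Id C (e w) \<odot> ins x ws z))) \<cdot>
        (Id C (e y) \<odot> swap (e x) (e w) ?z) \<cdot> swap (e x) (e y) (e w \<otimes> ?z)"
      using assms swap_natural[of "Id C (e y)" "Id C (e w)" "ins x ws z" "e y" "e w" "e x \<otimes> ?z"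
          "e y" "e w" "word (insort x ws) z"] by simp
    also have "\<dots> = ins y (insort x (w # ws)) z \<cdot> (Id C (e y) \<odot> ins x (w # ws) z) \<cdot>
        swap (e x) (e y) (word (w # ws) z)"
      using yw assms by simp
    finally show ?thesis .
  qed
qed

text \<open>
  The equation for \<open>y < x\<close> is the one for \<open>x < y\<close> composed with the inverse transposition.
\<close>

lemma ins_ins:
  assumes "x \<noteq> y" "z \<in> Obj C"
  shows "ins x (insort y ws) z \<cdot> (Id C (e x) \<odot> ins y ws z) =
    ins y (insort x ws) z \<cdot> (Id C (e y) \<odot> ins x ws z) \<cdot> swap (e x) (e y) (word ws z)"
proof (cases "x < y")
  case True
  then show ?thesis
    using assms ins_less_ins by blast
next
  case False
  have "ins x (insort y ws) z \<cdot> (Id C (e x) \<odot> ins y ws z) =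
    (ins x (insort y ws) z \<cdot> (Id C (e x) \<odot> ins y ws z) \<cdot> swap (e y) (e x) (word ws z)) \<cdot>
      swap (e x) (e y) (word ws z)"
    using assms by (simp add: swap_swap insort_left_comm)
  also have "\<dots> = ins y (insort x ws) z \<cdot> (Id C (e y) \<odot> ins x ws z) \<cdot> swap (e x) (e y) (word ws z)"
    using False assms by (subst ins_less_ins[symmetric]) (simp_all add: insort_left_comm)
  finally show ?thesis .
qed

lemma foldr_insort_insort [simp]: "foldr insort (insort x ys) ws = insort x (foldr insort ys ws)"
  for x :: nat
  by (induction ys) (auto simp: insort_left_comm)

lemma foldr_insort_sort [simp]: "foldr insort (sort xs) ws = foldr insort xs ws"
  for ws :: "nat list"
  by (induction xs) auto

text \<open>
  Moving \<open>x\<close> to its place among \<open>ys\<close> before merging does not change the result, because \<open>x\<close> may be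
  inserted before or after each of the letters that it passes.
\<close>

lemma merge_insort:
  assumes "x \<notin> set ys" "z \<in> Obj C"
  shows "merge (insort x ys) ws z \<cdot> ins x ys (word ws z) =
    ins x (foldr insort ys ws) z \<cdot> (Id C (e x) \<odot> merge ys ws z)"
  using assms(1)
proof (induction ys)
  case Nil
  then show ?case using assms by simp
next
  case (Cons y ys)
  let ?G = "foldr insort ys ws"
  show ?case
  proof (cases "x \<le> y")
    case True
    then show ?thesis
      using assms by simp
  next
    case False
    have "merge (insort x (y # ys)) ws z \<cdot> ins x (y # ys) (word ws z) =
      ins y (insort x ?G) z \<cdot> (Id C (e y) \<odot> (merge (insort x ys) ws z \<cdot> ins x ys (word ws z))) \<cdot>
        swap (e x) (e y) (word ys (word ws z))"
      using False assms by simp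
    also have "\<dots> = ins y (insort x ?G) z \<cdot> (Id C (e y) \<odot> ins x ?G z) \<cdot>
        ((Id C (e y) \<odot> (Id C (e x) \<odot> merge ys ws z)) \<cdot> swap (e x) (e y) (word ys (word ws z)))"
      using Cons assms by simp
    also have "\<dots> = (ins y (insort x ?G) z \<cdot> (Id C (e y) \<odot> ins x ?G z) \<cdot> swap (e x) (e y) (word ?G z)) \<cdot>
        (Id C (e x) \<odot> (Id C (e y) \<odot> merge ys ws z))"
      using assms swap_natural[of "Id C (e x)" "Id C (e y)" "merge ys ws z" "e x" "e y"
          "word ys (word ws z)" "e x" "e y" "word ?G z"] by simp
    also have "\<dots> = (ins x (insort y ?G) z \<cdot> (Id C (e x) \<odot> ins y ?G z)) \<cdot>
        (Id C (e x) \<odot> (Id C (e y) \<odot> merge ys ws z))"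
      using Cons.prems assms by (subst ins_ins) auto
    also have "\<dots> = ins x (foldr insort (y # ys) ws) z \<cdot> (Id C (e x) \<odot> merge (y # ys) ws z)"
      using assms by simp
    finally show ?thesis .
  qed
qed

text \<open>
  Merging factors through sorting the first word. This separates the normalisation of a product into
  those of its factors, followed by an arrow that depends on the sorted words only.
\<close>

lemma merge_sort:
  assumes "distinct xs" "z \<in> Obj C"
  shows "merge xs ws z = merge (sort xs) ws z \<cdot> merge xs [] (word ws z)"
  using assms(1)
proof (induction xs)
  case Nil
  then show ?case using assms by simp
next
  case (Cons x xs)
  have s: "foldr insort xs [] = sort xs"
    by (simp add: sort_key_def)
  have "merge (x # xs) ws z =
      (ins x (foldr insort (sort xs) ws) z \<cdot> (Id C (e x) \<odot> merge (sort xs) ws z)) \<cdot>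
        (Id C (e x) \<odot> merge xs [] (word ws z))"
    using Cons assms s by simp
  also have "\<dots> = (merge (insort x (sort xs)) ws z \<cdot> ins x (sort xs) (word ws z)) \<cdot>
        (Id C (e x) \<odot> merge xs [] (word ws z))"
    using Cons.prems assms by (subst merge_insort) auto
  also have "\<dots> = merge (sort (x # xs)) ws z \<cdot> merge (x # xs) [] (word ws z)"
    using Cons assms s by simp
  finally show ?case .
qed

lemma merge_append:
  assumes "z \<in> Obj C"
  shows "merge (xs @ ys) ws z = merge xs (foldr insort ys ws) z \<cdot> word_arr xs (merge ys ws z)"
  using assms by (induction xs) auto

text \<open>
  The tail \<open>z\<close> makes the flattening of a product the composite of the flattenings of its factors,
  the first one with the flattened second factor as its tail.
\<close>

primrec flat :: "otree \<Rightarrow> 'o \<Rightarrow> 'a" where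
  "flat (Leaf n) z = Id C (e n \<otimes> z)"
| "flat Nul z = Lun C z"
| "flat (Node t u) z = flat t (word (leaves u) z) \<cdot> (Id C (ev t) \<odot> flat u z) \<cdot>
     inv_arr C (Ass C (ev t) (ev u) z)"

lemma flat_arr [simp]:
  assumes "z \<in> Obj C"
  shows "flat t z \<in> Arr C \<and> Dom C (flat t z) = ev t \<otimes> z \<and>
    Cod C (flat t z) = word (leaves t) z \<and> iso_arr C (flat t z)"
  using assms by (induction t arbitrary: z) auto

lemma flat_natural:
  assumes "h \<in> Arr C"
  shows "flat t (Cod C h) \<cdot> (Id C (ev t) \<odot> h) = word_arr (leaves t) h \<cdot> flat t (Dom C h)"
  using assms
proof (induction t arbitrary: h)
  case (Leaf n)
  then show ?case by simp
next
  case Nul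
  then show ?case by (simp add: lun_natural)
next
  case (Node t u)
  let ?x = "Dom C h" and ?y = "Cod C h" and ?h = "word_arr (leaves u) h"
  have "flat (Node t u) ?y \<cdot> (Id C (ev (Node t u)) \<odot> h) =
     flat t (word (leaves u) ?y) \<cdot> (Id C (ev t) \<odot> flat u ?y) \<cdot>
     (inv_arr C (Ass C (ev t) (ev u) ?y) \<cdot> ((Id C (ev t) \<odot> Id C (ev u)) \<odot> h))"
    using Node.prems by simp
  also have "\<dots> = flat t (word (leaves u) ?y) \<cdot> (Id C (ev t) \<odot> (flat u ?y \<cdot> (Id C (ev u) \<odot> h))) \<cdot>
     inv_arr C (Ass C (ev t) (ev u) ?x)"
    using Node.prems by (subst inv_ass_natural[of _ _ _ "ev t" "ev u" ?x]) auto
  also have "\<dots> = (flat t (word (leaves u) ?y) \<cdot> (Id C (ev t) \<odot> ?h)) \<cdot> (Id C (ev t) \<odot> flat u ?x) \<cdot>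
     inv_arr C (Ass C (ev t) (ev u) ?x)"
    using Node.prems Node.IH(2)[of h] by simp
  also have "\<dots> = word_arr (leaves (Node t u)) h \<cdot> flat (Node t u) ?x"
  proof -
    have "word_arr (xs @ ys) h = word_arr xs (word_arr ys h)" for xs ys
      by (induction xs) auto
    then show ?thesis
      using Node.prems Node.IH(1)[of ?h] by simp
  qed
  finally show ?case .
qed

text \<open>
  The canonical arrow to the sorted word.
\<close>

definition nf :: "otree \<Rightarrow> 'o \<Rightarrow> 'a" where
  "nf t z = merge (leaves t) [] z \<cdot> flat t z"

lemma nf_arr [simp]:
  assumes "z \<in> Obj C"
  shows "nf t z \<in> Arr C" "Dom C (nf t z) = ev t \<otimes> z"
    "Cod C (nf t z) = word (sort (leaves t)) z" "iso_arr C (nf t z)"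
  using assms by (auto simp: nf_def sort_key_def)

lemma nf_tensor:
  assumes "distinct (leaves t)" "z \<in> Obj C"
  shows "nf (Node t u) z = merge (sort (leaves t)) (sort (leaves u)) z \<cdot>
    nf t (word (sort (leaves u)) z) \<cdot> (Id C (ev t) \<odot> nf u z) \<cdot> inv_arr C (Ass C (ev t) (ev u) z)"
proof -
  let ?m = "merge (leaves u) [] z"
  have s: "foldr insort (leaves v) [] = sort (leaves v)" for v
    by (simp add: sort_key_def)
  have "nf (Node t u) z = merge (leaves t) (sort (leaves u)) z \<cdot>
     (word_arr (leaves t) ?m \<cdot> flat t (word (leaves u) z)) \<cdot> (Id C (ev t) \<odot> flat u z) \<cdot>
     inv_arr C (Ass C (ev t) (ev u) z)"
    using assms by (simp add: nf_def merge_append s)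
  also have "word_arr (leaves t) ?m \<cdot> flat t (word (leaves u) z) =
      flat t (word (sort (leaves u)) z) \<cdot> (Id C (ev t) \<odot> ?m)"
    using assms flat_natural[of ?m t] by (simp add: s)
  also have "merge (leaves t) (sort (leaves u)) z = merge (sort (leaves t)) (sort (leaves u)) z \<cdot>
      merge (leaves t) [] (word (sort (leaves u)) z)"
    using assms by (intro merge_sort)
  finally show ?thesis
    using assms by (simp add: nf_def s)
qed

text \<open>
  Arrows that are compatible with the normal forms. Distinctness is a hypothesis inside the definition
  rather than outside, so that the closure properties hold for all trees.
\<close>

definition canonical :: "otree \<Rightarrow> otree \<Rightarrow> 'a \<Rightarrow> bool" where
  "canonical t u f \<longleftrightarrow> f \<in> Arr C \<and> Dom C f = ev t \<and> Cod C f = ev u \<and> mset (leaves t) = mset (leaves u) \<and>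
     (distinct (leaves t) \<longrightarrow> (\<forall>z\<in>Obj C. nf u z \<cdot> (f \<odot> Id C z) = nf t z))"

lemma canonical_arr:
  assumes "canonical t u f"
  shows "f \<in> Arr C" "Dom C f = ev t" "Cod C f = ev u"
  using assms by (auto simp: canonical_def)

lemma canonical_leaves:
  assumes "canonical t u f"
  shows "sort (leaves u) = sort (leaves t)" "distinct (leaves u) \<longleftrightarrow> distinct (leaves t)"
  using assms mset_eq_imp_distinct_iff unfolding canonical_def
  by (metis mset_sort properties_for_sort sorted_sort, metis mset_eq_imp_distinct_iff)

lemma canonicalD:
  assumes "canonical t u f" "distinct (leaves t)" "z \<in> Obj C"
  shows "nf u z \<cdot> (f \<odot> Id C z) = nf t z"
  using assms by (auto simp: canonical_def)

lemma canonical_comp: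
  assumes "canonical t u f" "canonical u v g"
  shows "canonical t v (g \<cdot> f)"
proof -
  note [simp] = canonical_arr[OF assms(1)] canonical_arr[OF assms(2)]
  have "nf v z \<cdot> ((g \<cdot> f) \<odot> Id C z) = nf t z" if "distinct (leaves t)" "z \<in> Obj C" for z
  proof -
    have "nf v z \<cdot> ((g \<cdot> f) \<odot> Id C z) = (nf v z \<cdot> (g \<odot> Id C z)) \<cdot> (f \<odot> Id C z)"
      using assms that by simp
    also have "\<dots> = nf t z"
      using assms that canonical_leaves[OF assms(1)] by (simp add: canonicalD)
    finally show ?thesis .
  qed
  then show ?thesis
    using assms by (auto simp: canonical_def[of t v]) (simp add: canonical_def)
qed

lemma canonical_tensor:
  assumes "canonical t u f" "canonical t' u' f'"
  shows "canonical (Node t t') (Node u u') (f \<odot> f')"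
proof -
  note [simp] = canonical_arr[OF assms(1)] canonical_arr[OF assms(2)]
  have "nf (Node u u') z \<cdot> ((f \<odot> f') \<odot> Id C z) = nf (Node t t') z"
    if d: "distinct (leaves (Node t t'))" and z: "z \<in> Obj C" for z
  proof -
    let ?m = "merge (sort (leaves t)) (sort (leaves t')) z" and ?w = "word (sort (leaves t')) z"
    have d': "distinct (leaves t)" "distinct (leaves t')" "distinct (leaves u)"
      using d canonical_leaves[OF assms(1)] by auto
    have "nf (Node u u') z \<cdot> ((f \<odot> f') \<odot> Id C z) = ?m \<cdot> nf u ?w \<cdot> (Id C (ev u) \<odot> nf u' z) \<cdot>
        (inv_arr C (Ass C (ev u) (ev u') z) \<cdot> ((f \<odot> f') \<odot> Id C z))"
      using assms d' z by (simp add: nf_tensor canonical_leaves(1)[OF assms(1)] canonical_leaves(1)[OF assms(2)])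
    also have "\<dots> = ?m \<cdot> nf u ?w \<cdot> (Id C (ev u) \<odot> nf u' z) \<cdot> (f \<odot> (f' \<odot> Id C z)) \<cdot>
        inv_arr C (Ass C (ev t) (ev t') z)"
      using assms z by (subst inv_ass_natural[of _ _ _ "ev t" "ev t'" z]) auto
    also have "\<dots> = ?m \<cdot> (nf u ?w \<cdot> (f \<odot> Id C ?w)) \<cdot> (Id C (ev t) \<odot> (nf u' z \<cdot> (f' \<odot> Id C z))) \<cdot>
        inv_arr C (Ass C (ev t) (ev t') z)"
      using assms z by (simp add: canonical_leaves(1)[OF assms(2)])
    also have "\<dots> = nf (Node t t') z"
      using assms d' z by (simp add: nf_tensor canonicalD)
    finally show ?thesis .
  qed
  then show ?thesis
    using assms by (auto simp: canonical_def[of "Node t t'"]) (simp_all add: canonical_def)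
qed

lemma canonical_id: "canonical t t (Id C (ev t))"
  by (simp add: canonical_def)

lemma canonical_inv:
  assumes "canonical t u f" "iso_arr C f"
  shows "canonical u t (inv_arr C f)"
proof -
  note [simp] = canonical_arr[OF assms(1)]
  have "nf t z \<cdot> (inv_arr C f \<odot> Id C z) = nf u z" if "distinct (leaves u)" "z \<in> Obj C" for z
  proof -
    have "nf t z \<cdot> (inv_arr C f \<odot> Id C z) = (nf u z \<cdot> (f \<odot> Id C z)) \<cdot> (inv_arr C f \<odot> Id C z)"
      using assms that canonical_leaves[OF assms(1)] by (simp add: canonicalD)
    also have "\<dots> = nf u z"
      using assms that by simp
    finally show ?thesis .
  qed
  then show ?thesis
    using assms by (auto simp: canonical_def[of u t]) (simp add: canonical_def)
qed

text \<open>
  Both trees have the same word of leaves, so it is enough to compare the flattenings, and these differ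
  by a pentagon.
\<close>

lemma canonical_ass: "canonical (Node t (Node u v)) (Node (Node t u) v) (Ass C (ev t) (ev u) (ev v))"
proof -
  let ?i = "\<lambda>x y z. inv_arr C (Ass C x y z)"
  let ?t = "ev t" and ?u = "ev u" and ?v = "ev v"
  have "flat (Node (Node t u) v) z \<cdot> (Ass C ?t ?u ?v \<odot> Id C z) = flat (Node t (Node u v)) z"
    if z: "z \<in> Obj C" for z
  proof -
    let ?w = "word (leaves v) z"
    have "?i ?t ?u (?v \<otimes> z) \<cdot> ?i (?t \<otimes> ?u) ?v z \<cdot> (Ass C ?t ?u ?v \<odot> Id C z) =
        (Id C ?t \<odot> ?i ?u ?v z) \<cdot> ?i ?t (?u \<otimes> ?v) z"
    proof (rule iso_right_cancel)
      show "(?i ?t ?u (?v \<otimes> z) \<cdot> ?i (?t \<otimes> ?u) ?v z \<cdot> (Ass C ?t ?u ?v \<odot> Id C z)) \<cdot>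
          (Ass C ?t (?u \<otimes> ?v) z \<cdot> (Id C ?t \<odot> Ass C ?u ?v z)) =
        ((Id C ?t \<odot> ?i ?u ?v z) \<cdot> ?i ?t (?u \<otimes> ?v) z) \<cdot>
          (Ass C ?t (?u \<otimes> ?v) z \<cdot> (Id C ?t \<odot> Ass C ?u ?v z))"
        using z by (simp flip: pentagon)
    qed (use z in auto)
    note p = this
    have "flat (Node (Node t u) v) z \<cdot> (Ass C ?t ?u ?v \<odot> Id C z) =
      flat t (word (leaves u) ?w) \<cdot> (Id C ?t \<odot> flat u ?w) \<cdot>
        (?i ?t ?u ?w \<cdot> ((Id C ?t \<odot> Id C ?u) \<odot> flat v z)) \<cdot> ?i (?t \<otimes> ?u) ?v z \<cdot> (Ass C ?t ?u ?v \<odot> Id C z)"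
      using z by simp
    also have "\<dots> = flat t (word (leaves u) ?w) \<cdot> (Id C ?t \<odot> flat u ?w) \<cdot>
        (Id C ?t \<odot> (Id C ?u \<odot> flat v z)) \<cdot>
        (?i ?t ?u (?v \<otimes> z) \<cdot> ?i (?t \<otimes> ?u) ?v z \<cdot> (Ass C ?t ?u ?v \<odot> Id C z))"
      using z by (subst inv_ass_natural[of _ _ _ ?t ?u "?v \<otimes> z"]) auto
    also have "\<dots> = flat (Node t (Node u v)) z"
      unfolding p using z by simp
    finally show ?thesis .
  qed
  then show ?thesis
    by (auto simp: canonical_def nf_def)
qed

lemma canonical_lun: "canonical (Node Nul t) t (Lun C (ev t))"
proof -
  have "flat t z \<cdot> (Lun C (ev t) \<odot> Id C z) = flat (Node Nul t) z" if z: "z \<in> Obj C" for z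
  proof -
    have "flat (Node Nul t) z = (Lun C (word (leaves t) z) \<cdot> (Id C \<one> \<odot> flat t z)) \<cdot> inv_arr C (Ass C \<one> (ev t) z)"
      using z by simp
    also have "\<dots> = flat t z \<cdot> Lun C (ev t \<otimes> z) \<cdot> inv_arr C (Ass C \<one> (ev t) z)"
      using z lun_natural[of "flat t z"] by simp
    also have "\<dots> = flat t z \<cdot> (Lun C (ev t) \<odot> Id C z)"
      using z by (simp flip: lun_tensor)
    finally show ?thesis by simp
  qed
  then show ?thesis
    by (auto simp: canonical_def nf_def)
qed

lemma canonical_run: "canonical (Node t Nul) t (Run C (ev t))"
proof -
  have "flat t z \<cdot> (Run C (ev t) \<odot> Id C z) = flat (Node t Nul) z" if z: "z \<in> Obj C" for z
    using z by (simp flip: triangle)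
  then show ?thesis
    by (auto simp: canonical_def nf_def)
qed

lemma canonical_sym_flip:
  assumes "canonical (Node t u) (Node u t) (Sym C (ev t) (ev u))"
  shows "canonical (Node u t) (Node t u) (Sym C (ev u) (ev t))"
proof -
  have "inverse_pair C (Sym C (ev t) (ev u)) (Sym C (ev u) (ev t))"
    by (simp add: inverse_pair_def Hom_def sym_sym)
  then show ?thesis
    using canonical_inv[OF assms] inv_arr_eqI by simp
qed

text \<open>
  The hexagon expresses the symmetry of a product by the symmetries of its factors, so the general
  symmetry reduces to the one between two leaves.
\<close>

lemma canonical_sym_tensor:
  assumes "canonical (Node t v) (Node v t) (Sym C (ev t) (ev v))" "canonical (Node u v) (Node v u) (Sym C (ev u) (ev v))"
  shows "canonical (Node (Node t u) v) (Node v (Node t u)) (Sym C (ev (Node t u)) (ev v))"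
proof -
  let ?t = "ev t" and ?u = "ev u" and ?v = "ev v"
  have "inv_arr C (Ass C ?v ?t ?u) \<cdot> (Ass C ?v ?t ?u \<cdot> Sym C (?t \<otimes> ?u) ?v \<cdot> Ass C ?t ?u ?v) \<cdot>
      inv_arr C (Ass C ?t ?u ?v) = Sym C (?t \<otimes> ?u) ?v"
    by simp
  then have "Sym C (ev (Node t u)) ?v = inv_arr C (Ass C ?v ?t ?u) \<cdot>
      ((Sym C ?t ?v \<odot> Id C ?u) \<cdot> Ass C ?t ?v ?u \<cdot> (Id C ?t \<odot> Sym C ?u ?v)) \<cdot> inv_arr C (Ass C ?t ?u ?v)"
    unfolding hexagon[OF ev_obj ev_obj ev_obj] by simp
  moreover have "canonical (Node (Node t u) v) (Node v (Node t u)) \<dots>"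
    by (rule canonical_comp canonical_tensor canonical_id assms canonical_ass canonical_inv ass_arr ev_obj)+
  ultimately show ?thesis by simp
qed

lemma canonical_sym_unit: "canonical (Node t Nul) (Node Nul t) (Sym C (ev t) (ev Nul))"
proof -
  have "Sym C (ev t) (ev Nul) = inv_arr C (Lun C (ev t)) \<cdot> Run C (ev t)"
    by (simp flip: sym_unit)
  moreover have "canonical (Node t Nul) (Node Nul t) \<dots>"
    by (rule canonical_comp canonical_run canonical_inv canonical_lun lun_arr ev_obj)+
  ultimately show ?thesis by simp
qed

text \<open>
  One of the two orders of the leaves is sorted already; sorting the other one is the symmetry itself.
\<close>

lemma canonical_sym_leaf: "canonical (Node (Leaf m) (Leaf n)) (Node (Leaf n) (Leaf m)) (Sym C (ev (Leaf m)) (ev (Leaf n)))"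
proof -
  have "nf (Node (Leaf n) (Leaf m)) z \<cdot> (Sym C (e m) (e n) \<odot> Id C z) = nf (Node (Leaf m) (Leaf n)) z"
    if "m \<noteq> n" and z: "z \<in> Obj C" for z
  proof -
    have "swap (e m) (e n) z \<cdot> inv_arr C (Ass C (e m) (e n) z) =
        inv_arr C (Ass C (e n) (e m) z) \<cdot> (Sym C (e m) (e n) \<odot> Id C z)"
      using z by (simp add: swap_def)
    moreover have "swap (e n) (e m) z \<cdot> inv_arr C (Ass C (e n) (e m) z) \<cdot> (Sym C (e m) (e n) \<odot> Id C z) =
        inv_arr C (Ass C (e m) (e n) z)"
      using z by (simp add: swap_def sym_sym)
    ultimately show ?thesis
      using that by (cases "m < n") (auto simp: nf_def)
  qed
  then show ?thesis
    by (auto simp: canonical_def)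
qed

lemma canonical_sym: "canonical (Node t u) (Node u t) (Sym C (ev t) (ev u))"
proof -
  have leaf: "canonical (Node (Leaf n) u) (Node u (Leaf n)) (Sym C (ev (Leaf n)) (ev u))" for n u
  proof (induction u)
    case (Node u v)
    show ?case
      by (rule canonical_sym_flip, rule canonical_sym_tensor) (rule canonical_sym_flip, rule Node)+
  qed (rule canonical_sym_leaf canonical_sym_unit)+
  show ?thesis
  proof (induction t)
    case Nul
    then show ?case
      using canonical_sym_flip canonical_sym_unit by blast
  qed (use leaf canonical_sym_tensor in blast)+
qed

text \<open>
  Composition with the normal form of \<open>u\<close> is injective because it is invertible, and tensoring with
  the tail \<open>\<one>\<close> is faithful because of \<open>r\<close>.
\<close>

theorem coherence:
  assumes f: "canonical t u f" and g: "canonical t u g" and d: "distinct (leaves t)"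
  shows "f = g"
proof -
  note [simp] = canonical_arr[OF f] canonical_arr[OF g]
  have "nf u \<one> \<cdot> (f \<odot> Id C \<one>) = nf u \<one> \<cdot> (g \<odot> Id C \<one>)"
    using canonicalD[OF f d] canonicalD[OF g d] by simp
  then have "f \<odot> Id C \<one> = g \<odot> Id C \<one>"
    by (rule iso_left_cancel) auto
  then have "f \<cdot> Run C (ev t) = g \<cdot> Run C (ev t)"
    using f g run_natural[of f] run_natural[of g] by simp
  then show ?thesis
    by (rule iso_right_cancel) simp_all
qed

end

section \<open>The canonical interchange\<close>

text \<open>
  A concrete diagram is an instance of coherence in which the leaves are the positions in the list of
  the objects that occur. The leaves are distinct even if some of these objects coincide.
\<close>

context smc
begin

text \<open>
  The unit is a default value, so that every list gives a total environment of objects.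
\<close>

definition env :: "'o list \<Rightarrow> nat \<Rightarrow> 'o" where
  "env xs n = (if n < length xs \<and> set xs \<subseteq> Obj C then xs ! n else \<one>)"

lemma smc_env: "smc_env C (env xs)"
  by unfold_locales (use nth_mem in \<open>fastforce simp: env_def\<close>)

end

context smc_env
begin

lemma canonical_interchange:
  "canonical (Node (Node t u) (Node v w)) (Node (Node t v) (Node u w)) (interchange C (ev t) (ev u) (ev v) (ev w))"
  unfolding interchange_def ev.simps(3)[symmetric]
  by (rule canonical_comp canonical_tensor canonical_id canonical_ass canonical_inv canonical_sym ass_arr ev_obj)+

lemmas canonical_rules = canonical_comp canonical_interchange canonical_tensor canonical_id canonical_ass canonical_inv[OF canonical_ass ass_arr(4)]
  canonical_inv[OF canonical_run run_arr(4)] canonical_sym canonical_run canonical_lun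

end

context smc
begin

lemma interchange_arr [simp]:
  assumes "a \<in> Obj C" "b \<in> Obj C" "c \<in> Obj C" "d \<in> Obj C"
  shows "interchange C a b c d \<in> Arr C" "Dom C (interchange C a b c d) = (a \<otimes> b) \<otimes> (c \<otimes> d)"
    "Cod C (interchange C a b c d) = (a \<otimes> c) \<otimes> (b \<otimes> d)"
  using assms by (simp_all add: interchange_def)

lemma interchange_swap:
  assumes "a \<in> Obj C" "b \<in> Obj C" "c \<in> Obj C" "d \<in> Obj C"
  shows "interchange C a b c d =
    Ass C a c (b \<otimes> d) \<cdot> (Id C a \<odot> swap b c d) \<cdot> inv_arr C (Ass C a b (c \<otimes> d))"
  using assms by (simp add: interchange_def swap_def)

lemma interchange_natural:
  assumes "f \<in> Arr C" "g \<in> Arr C" "h \<in> Arr C" "k \<in> Arr C"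
    "Dom C f = a" "Dom C g = b" "Dom C h = c" "Dom C k = d"
    "Cod C f = a'" "Cod C g = b'" "Cod C h = c'" "Cod C k = d'"
  shows "interchange C a' b' c' d' \<cdot> ((f \<odot> g) \<odot> (h \<odot> k)) =
    ((f \<odot> h) \<odot> (g \<odot> k)) \<cdot> interchange C a b c d"
proof -
  have o: "a \<in> Obj C" "b \<in> Obj C" "c \<in> Obj C" "d \<in> Obj C"
    "a' \<in> Obj C" "b' \<in> Obj C" "c' \<in> Obj C" "d' \<in> Obj C"
    using assms by auto
  have "interchange C a' b' c' d' \<cdot> ((f \<odot> g) \<odot> (h \<odot> k)) = Ass C a' c' (b' \<otimes> d') \<cdot>
      (Id C a' \<odot> swap b' c' d') \<cdot> (inv_arr C (Ass C a' b' (c' \<otimes> d')) \<cdot> ((f \<odot> g) \<odot> (h \<odot> k)))"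
    using assms o by (simp add: interchange_swap)
  also have "\<dots> = Ass C a' c' (b' \<otimes> d') \<cdot> (f \<odot> (swap b' c' d' \<cdot> (g \<odot> (h \<odot> k)))) \<cdot>
      inv_arr C (Ass C a b (c \<otimes> d))"
    using assms o by (subst inv_ass_natural[of _ _ _ a b "c \<otimes> d"]) auto
  also have "\<dots> = (Ass C a' c' (b' \<otimes> d') \<cdot> (f \<odot> (h \<odot> (g \<odot> k)))) \<cdot>
      (Id C a \<odot> swap b c d) \<cdot> inv_arr C (Ass C a b (c \<otimes> d))"
    using assms o by (subst swap_natural[of _ _ _ b c d]) auto
  also have "\<dots> = ((f \<odot> h) \<odot> (g \<odot> k)) \<cdot> interchange C a b c d"
    using assms o by (subst ass_natural[of _ _ _ a c "b \<otimes> d"]) (auto simp: interchange_swap)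
  finally show ?thesis .
qed

lemma interchange_involutive:
  assumes "a \<in> Obj C" "b \<in> Obj C" "c \<in> Obj C" "d \<in> Obj C"
  shows "interchange C a c b d \<cdot> interchange C a b c d =
    Id C ((a \<otimes> b) \<otimes> (c \<otimes> d))"
proof -
  interpret smc_env C "env [a, b, c, d]" by (rule smc_env)
  let ?a = "Leaf 0" and ?b = "Leaf 1" and ?c = "Leaf 2" and ?d = "Leaf 3"
  have "interchange C (ev ?a) (ev ?c) (ev ?b) (ev ?d) \<cdot> interchange C (ev ?a) (ev ?b) (ev ?c) (ev ?d) =
      Id C (ev (Node (Node ?a ?b) (Node ?c ?d)))"
    by (rule coherence, (rule canonical_rules ev_obj)+) simp
  then show ?thesis
    using assms by (simp add: env_def)
qed

text \<open>
  The next eight equations are the axioms of a symmetric monoidal functor for \<open>\<otimes>\<close> with the interchange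
  as structure arrow (the lemmas named after the interchange first), and the monoidality of
  \<open>ass\<close>, \<open>r\<close>, \<open>l\<close> and \<open>s\<close> with respect to it (the lemmas that name the interchange last). Since the
  interchange is inverse to its own transpose, the two groups mirror each other.
\<close>

lemma interchange_ass:
  assumes "a \<in> Obj C" "a' \<in> Obj C" "b \<in> Obj C" "b' \<in> Obj C" "c \<in> Obj C" "c' \<in> Obj C"
  shows "(Ass C a b c \<odot> Ass C a' b' c') \<cdot> interchange C a a' (b \<otimes> c) (b' \<otimes> c') \<cdot> (Id C (a \<otimes> a') \<odot> interchange C b b' c c') =
    interchange C (a \<otimes> b) (a' \<otimes> b') c c' \<cdot> (interchange C a a' b b' \<odot> Id C (c \<otimes> c')) \<cdot> Ass C (a \<otimes> a') (b \<otimes> b') (c \<otimes> c')"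
proof -
  interpret smc_env C "env [a, a', b, b', c, c']" by (rule smc_env)
  let ?a = "Leaf 0" and ?a' = "Leaf 1" and ?b = "Leaf 2" and ?b' = "Leaf 3" and ?c = "Leaf 4" and ?c' = "Leaf 5"
  have "(Ass C (ev ?a) (ev ?b) (ev ?c) \<odot> Ass C (ev ?a') (ev ?b') (ev ?c')) \<cdot> interchange C (ev ?a) (ev ?a') (ev (Node ?b ?c)) (ev (Node ?b' ?c')) \<cdot> (Id C (ev (Node ?a ?a')) \<odot> interchange C (ev ?b) (ev ?b') (ev ?c) (ev ?c')) =
      interchange C (ev (Node ?a ?b)) (ev (Node ?a' ?b')) (ev ?c) (ev ?c') \<cdot> (interchange C (ev ?a) (ev ?a') (ev ?b) (ev ?b') \<odot> Id C (ev (Node ?c ?c'))) \<cdot> Ass C (ev (Node ?a ?a')) (ev (Node ?b ?b')) (ev (Node ?c ?c'))"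
    by (rule coherence, (rule canonical_rules ev_obj)+) simp
  then show ?thesis
    using assms by (simp add: env_def)
qed

lemma ass_interchange:
  assumes "a \<in> Obj C" "a' \<in> Obj C" "b \<in> Obj C" "b' \<in> Obj C" "c \<in> Obj C" "c' \<in> Obj C"
  shows "Ass C (a \<otimes> a') (b \<otimes> b') (c \<otimes> c') \<cdot> (Id C (a \<otimes> a') \<odot> interchange C b c b' c') \<cdot> interchange C a (b \<otimes> c) a' (b' \<otimes> c') =
    (interchange C a b a' b' \<odot> Id C (c \<otimes> c')) \<cdot> interchange C (a \<otimes> b) c (a' \<otimes> b') c' \<cdot> (Ass C a b c \<odot> Ass C a' b' c')"
proof -
  interpret smc_env C "env [a, a', b, b', c, c']" by (rule smc_env)
  let ?a = "Leaf 0" and ?a' = "Leaf 1" and ?b = "Leaf 2" and ?b' = "Leaf 3" and ?c = "Leaf 4" and ?c' = "Leaf 5"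
  have "Ass C (ev (Node ?a ?a')) (ev (Node ?b ?b')) (ev (Node ?c ?c')) \<cdot> (Id C (ev (Node ?a ?a')) \<odot> interchange C (ev ?b) (ev ?c) (ev ?b') (ev ?c')) \<cdot> interchange C (ev ?a) (ev (Node ?b ?c)) (ev ?a') (ev (Node ?b' ?c')) =
      (interchange C (ev ?a) (ev ?b) (ev ?a') (ev ?b') \<odot> Id C (ev (Node ?c ?c'))) \<cdot> interchange C (ev (Node ?a ?b)) (ev ?c) (ev (Node ?a' ?b')) (ev ?c') \<cdot> (Ass C (ev ?a) (ev ?b) (ev ?c) \<odot> Ass C (ev ?a') (ev ?b') (ev ?c'))"
    by (rule coherence, (rule canonical_rules ev_obj)+) simp
  then show ?thesis
    using assms by (simp add: env_def)
qed

lemma interchange_run: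
  assumes "a \<in> Obj C" "b \<in> Obj C"
  shows "(Run C a \<odot> Run C b) \<cdot> interchange C a b \<one> \<one> \<cdot> (Id C (a \<otimes> b) \<odot> inv_arr C (Run C \<one>)) =
    Run C (a \<otimes> b)"
proof -
  interpret smc_env C "env [a, b]" by (rule smc_env)
  let ?a = "Leaf 0" and ?b = "Leaf 1"
  have "(Run C (ev ?a) \<odot> Run C (ev ?b)) \<cdot> interchange C (ev ?a) (ev ?b) (ev Nul) (ev Nul) \<cdot> (Id C (ev (Node ?a ?b)) \<odot> inv_arr C (Run C (ev Nul))) =
      Run C (ev (Node ?a ?b))"
    by (rule coherence, (rule canonical_rules ev_obj)+) simp
  then show ?thesis
    using assms by (simp add: env_def)
qed

lemma run_interchange:
  assumes "a \<in> Obj C" "b \<in> Obj C"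
  shows "Run C (a \<otimes> b) \<cdot> (Id C (a \<otimes> b) \<odot> Run C \<one>) \<cdot> interchange C a \<one> b \<one> =
    (Run C a \<odot> Run C b)"
proof -
  interpret smc_env C "env [a, b]" by (rule smc_env)
  let ?a = "Leaf 0" and ?b = "Leaf 1"
  have "Run C (ev (Node ?a ?b)) \<cdot> (Id C (ev (Node ?a ?b)) \<odot> Run C (ev Nul)) \<cdot> interchange C (ev ?a) (ev Nul) (ev ?b) (ev Nul) =
      (Run C (ev ?a) \<odot> Run C (ev ?b))"
    by (rule coherence, (rule canonical_rules ev_obj)+) simp
  then show ?thesis
    using assms by (simp add: env_def)
qed

lemma interchange_lun:
  assumes "a \<in> Obj C" "b \<in> Obj C"
  shows "(Lun C a \<odot> Lun C b) \<cdot> interchange C \<one> \<one> a b \<cdot> (inv_arr C (Run C \<one>) \<odot> Id C (a \<otimes> b)) =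
    Lun C (a \<otimes> b)"
proof -
  interpret smc_env C "env [a, b]" by (rule smc_env)
  let ?a = "Leaf 0" and ?b = "Leaf 1"
  have "(Lun C (ev ?a) \<odot> Lun C (ev ?b)) \<cdot> interchange C (ev Nul) (ev Nul) (ev ?a) (ev ?b) \<cdot> (inv_arr C (Run C (ev Nul)) \<odot> Id C (ev (Node ?a ?b))) =
      Lun C (ev (Node ?a ?b))"
    by (rule coherence, (rule canonical_rules ev_obj)+) simp
  then show ?thesis
    using assms by (simp add: env_def)
qed

lemma lun_interchange:
  assumes "a \<in> Obj C" "b \<in> Obj C"
  shows "Lun C (a \<otimes> b) \<cdot> (Run C \<one> \<odot> Id C (a \<otimes> b)) \<cdot> interchange C \<one> a \<one> b =
    (Lun C a \<odot> Lun C b)"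
proof -
  interpret smc_env C "env [a, b]" by (rule smc_env)
  let ?a = "Leaf 0" and ?b = "Leaf 1"
  have "Lun C (ev (Node ?a ?b)) \<cdot> (Run C (ev Nul) \<odot> Id C (ev (Node ?a ?b))) \<cdot> interchange C (ev Nul) (ev ?a) (ev Nul) (ev ?b) =
      (Lun C (ev ?a) \<odot> Lun C (ev ?b))"
    by (rule coherence, (rule canonical_rules ev_obj)+) simp
  then show ?thesis
    using assms by (simp add: env_def)
qed

lemma interchange_sym:
  assumes "a \<in> Obj C" "b \<in> Obj C" "c \<in> Obj C" "d \<in> Obj C"
  shows "interchange C c d a b \<cdot> Sym C (a \<otimes> b) (c \<otimes> d) =
    (Sym C a c \<odot> Sym C b d) \<cdot> interchange C a b c d"
proof -
  interpret smc_env C "env [a, b, c, d]" by (rule smc_env)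
  let ?a = "Leaf 0" and ?b = "Leaf 1" and ?c = "Leaf 2" and ?d = "Leaf 3"
  have "interchange C (ev ?c) (ev ?d) (ev ?a) (ev ?b) \<cdot> Sym C (ev (Node ?a ?b)) (ev (Node ?c ?d)) =
      (Sym C (ev ?a) (ev ?c) \<odot> Sym C (ev ?b) (ev ?d)) \<cdot> interchange C (ev ?a) (ev ?b) (ev ?c) (ev ?d)"
    by (rule coherence, (rule canonical_rules ev_obj)+) simp
  then show ?thesis
    using assms by (simp add: env_def)
qed

lemma sym_interchange:
  assumes "a \<in> Obj C" "b \<in> Obj C" "c \<in> Obj C" "d \<in> Obj C"
  shows "Sym C (a \<otimes> c) (b \<otimes> d) \<cdot> interchange C a b c d =
    interchange C b a d c \<cdot> (Sym C a b \<odot> Sym C c d)"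
proof -
  interpret smc_env C "env [a, b, c, d]" by (rule smc_env)
  let ?a = "Leaf 0" and ?b = "Leaf 1" and ?c = "Leaf 2" and ?d = "Leaf 3"
  have "Sym C (ev (Node ?a ?c)) (ev (Node ?b ?d)) \<cdot> interchange C (ev ?a) (ev ?b) (ev ?c) (ev ?d) =
      interchange C (ev ?b) (ev ?a) (ev ?d) (ev ?c) \<cdot> (Sym C (ev ?a) (ev ?b) \<odot> Sym C (ev ?c) (ev ?d))"
    by (rule coherence, (rule canonical_rules ev_obj)+) simp
  then show ?thesis
    using assms by (simp add: env_def)
qed

lemma lun_unit:
  "Lun C \<one> = Run C \<one>"
proof -
  interpret smc_env C "env []" by (rule smc_env)
  have "Lun C (ev Nul) =
      Run C (ev Nul)"
    by (rule coherence, (rule canonical_rules ev_obj)+) simp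
  then show ?thesis by simp
qed

lemma run_unit_ass:
  "Run C \<one> \<cdot> (Id C \<one> \<odot> Run C \<one>) = Run C \<one> \<cdot> (Run C \<one> \<odot> Id C \<one>) \<cdot> Ass C \<one> \<one> \<one>"
proof -
  interpret smc_env C "env []" by (rule smc_env)
  have "Run C (ev Nul) \<cdot> (Id C (ev Nul) \<odot> Run C (ev Nul)) =
      Run C (ev Nul) \<cdot> (Run C (ev Nul) \<odot> Id C (ev Nul)) \<cdot> Ass C (ev Nul) (ev Nul) (ev Nul)"
    by (rule coherence, (rule canonical_rules ev_obj)+) simp
  then show ?thesis by simp
qed

lemma run_unit_sym:
  "Run C \<one> \<cdot> Sym C \<one> \<one> = Run C \<one>"
proof -
  interpret smc_env C "env []" by (rule smc_env)
  have "Run C (ev Nul) \<cdot> Sym C (ev Nul) (ev Nul) =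
      Run C (ev Nul)"
    by (rule coherence, (rule canonical_rules ev_obj)+) simp
  then show ?thesis by simp
qed

lemma inv_run_unit_ass:
  "Ass C \<one> \<one> \<one> \<cdot> (Id C \<one> \<odot> inv_arr C (Run C \<one>)) \<cdot> inv_arr C (Run C \<one>) = (inv_arr C (Run C \<one>) \<odot> Id C \<one>) \<cdot> inv_arr C (Run C \<one>)"
proof -
  interpret smc_env C "env []" by (rule smc_env)
  have "Ass C (ev Nul) (ev Nul) (ev Nul) \<cdot> (Id C (ev Nul) \<odot> inv_arr C (Run C (ev Nul))) \<cdot> inv_arr C (Run C (ev Nul)) =
      (inv_arr C (Run C (ev Nul)) \<odot> Id C (ev Nul)) \<cdot> inv_arr C (Run C (ev Nul))"
    by (rule coherence, (rule canonical_rules ev_obj)+) simp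
  then show ?thesis by simp
qed

lemma inv_run_unit_sym:
  "Sym C \<one> \<one> \<cdot> inv_arr C (Run C \<one>) = inv_arr C (Run C \<one>)"
proof -
  interpret smc_env C "env []" by (rule smc_env)
  have "Sym C (ev Nul) (ev Nul) \<cdot> inv_arr C (Run C (ev Nul)) =
      inv_arr C (Run C (ev Nul))"
    by (rule coherence, (rule canonical_rules ev_obj)+) simp
  then show ?thesis by simp
qed

end

section \<open>Symmetric monoidal functors and transformations\<close>

lemma sm_functorI:
  assumes "FO F \<in> extensional (Obj A)" "FA F \<in> extensional (Arr A)"
    "F2 F \<in> extensional (Obj A \<times> Obj A)"
    and "\<And>x. x \<in> Obj A \<Longrightarrow> FO F x \<in> Obj B"
    and "\<And>x. x \<in> Obj A \<Longrightarrow> FA F (Id A x) = Id B (FO F x)"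
    and "\<And>f. f \<in> Arr A \<Longrightarrow> FA F f \<in> Hom B (FO F (Dom A f)) (FO F (Cod A f))"
    and "\<And>f g. \<lbrakk>f \<in> Arr A; g \<in> Arr A; Cod A f = Dom A g\<rbrakk> \<Longrightarrow> FA F (g \<cdot>\<^bsub>A\<^esub> f) = FA F g \<cdot>\<^bsub>B\<^esub> FA F f"
    and "F0 F \<in> Hom B \<one>\<^bsub>B\<^esub> (FO F \<one>\<^bsub>A\<^esub>)"
    and "\<And>x y. \<lbrakk>x \<in> Obj A; y \<in> Obj A\<rbrakk> \<Longrightarrow> F2 F (x, y) \<in> Hom B (FO F x \<otimes>\<^bsub>B\<^esub> FO F y) (FO F (x \<otimes>\<^bsub>A\<^esub> y))"
    and "\<And>f g. \<lbrakk>f \<in> Arr A; g \<in> Arr A\<rbrakk> \<Longrightarrow>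
        F2 F (Cod A f, Cod A g) \<cdot>\<^bsub>B\<^esub> (FA F f \<odot>\<^bsub>B\<^esub> FA F g) =
        FA F (f \<odot>\<^bsub>A\<^esub> g) \<cdot>\<^bsub>B\<^esub> F2 F (Dom A f, Dom A g)"
    and "\<And>x y z. \<lbrakk>x \<in> Obj A; y \<in> Obj A; z \<in> Obj A\<rbrakk> \<Longrightarrow>
        FA F (Ass A x y z) \<cdot>\<^bsub>B\<^esub> F2 F (x, y \<otimes>\<^bsub>A\<^esub> z) \<cdot>\<^bsub>B\<^esub> (Id B (FO F x) \<odot>\<^bsub>B\<^esub> F2 F (y, z)) =
        F2 F (x \<otimes>\<^bsub>A\<^esub> y, z) \<cdot>\<^bsub>B\<^esub> (F2 F (x, y) \<odot>\<^bsub>B\<^esub> Id B (FO F z)) \<cdot>\<^bsub>B\<^esub>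
          Ass B (FO F x) (FO F y) (FO F z)"
    and "\<And>x. x \<in> Obj A \<Longrightarrow>
        FA F (Run A x) \<cdot>\<^bsub>B\<^esub> F2 F (x, \<one>\<^bsub>A\<^esub>) \<cdot>\<^bsub>B\<^esub> (Id B (FO F x) \<odot>\<^bsub>B\<^esub> F0 F) = Run B (FO F x)"
    and "\<And>x. x \<in> Obj A \<Longrightarrow>
        FA F (Lun A x) \<cdot>\<^bsub>B\<^esub> F2 F (\<one>\<^bsub>A\<^esub>, x) \<cdot>\<^bsub>B\<^esub> (F0 F \<odot>\<^bsub>B\<^esub> Id B (FO F x)) = Lun B (FO F x)"
    and "\<And>x y. \<lbrakk>x \<in> Obj A; y \<in> Obj A\<rbrakk> \<Longrightarrow>
        FA F (Sym A x y) \<cdot>\<^bsub>B\<^esub> F2 F (x, y) = F2 F (y, x) \<cdot>\<^bsub>B\<^esub> Sym B (FO F x) (FO F y)"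
  shows "sm_functor A B F"
  unfolding sm_functor_def using assms by (intro conjI ballI impI) simp_all

lemma sm_transI:
  assumes "sm_functor A B (Src \<sigma>)" "sm_functor A B (Trg \<sigma>)" "Cmp \<sigma> \<in> extensional (Obj A)"
    and "\<And>x. x \<in> Obj A \<Longrightarrow> Cmp \<sigma> x \<in> Hom B (FO (Src \<sigma>) x) (FO (Trg \<sigma>) x)"
    and "\<And>f. f \<in> Arr A \<Longrightarrow> Cmp \<sigma> (Cod A f) \<cdot>\<^bsub>B\<^esub> FA (Src \<sigma>) f = FA (Trg \<sigma>) f \<cdot>\<^bsub>B\<^esub> Cmp \<sigma> (Dom A f)"
    and "Cmp \<sigma> \<one>\<^bsub>A\<^esub> \<cdot>\<^bsub>B\<^esub> F0 (Src \<sigma>) = F0 (Trg \<sigma>)"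
    and "\<And>x y. \<lbrakk>x \<in> Obj A; y \<in> Obj A\<rbrakk> \<Longrightarrow>
        Cmp \<sigma> (x \<otimes>\<^bsub>A\<^esub> y) \<cdot>\<^bsub>B\<^esub> F2 (Src \<sigma>) (x, y) =
        F2 (Trg \<sigma>) (x, y) \<cdot>\<^bsub>B\<^esub> (Cmp \<sigma> x \<odot>\<^bsub>B\<^esub> Cmp \<sigma> y)"
  shows "sm_trans A B \<sigma>"
  unfolding sm_trans_def using assms by (intro conjI ballI impI) simp_all

lemma smfun_eqI:
  fixes F G :: "('oa, 'aa, 'ob, 'ab) smfun"
  assumes "FO F \<in> extensional X" "FO G \<in> extensional X" "\<And>x. x \<in> X \<Longrightarrow> FO F x = FO G x"
    and "FA F \<in> extensional Y" "FA G \<in> extensional Y" "\<And>f. f \<in> Y \<Longrightarrow> FA F f = FA G f"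
    and "F0 F = F0 G"
    and "F2 F \<in> extensional (X \<times> X)" "F2 G \<in> extensional (X \<times> X)"
      "\<And>x y. \<lbrakk>x \<in> X; y \<in> X\<rbrakk> \<Longrightarrow> F2 F (x, y) = F2 G (x, y)"
  shows "F = G"
proof -
  have "FO F = FO G" "FA F = FA G" "F2 F = F2 G"
    using assms by (auto intro: extensionalityI)
  then show ?thesis
    using assms(7) by (intro smfun.equality) auto
qed

lemma smtrans_eqI:
  fixes \<sigma> \<tau> :: "('oa, 'aa, 'ob, 'ab) smtrans"
  assumes "Src \<sigma> = Src \<tau>" "Trg \<sigma> = Trg \<tau>" "Cmp \<sigma> \<in> extensional X" "Cmp \<tau> \<in> extensional X"
    and "\<And>x. x \<in> X \<Longrightarrow> Cmp \<sigma> x = Cmp \<tau> x"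
  shows "\<sigma> = \<tau>"
  using assms extensionalityI[of "Cmp \<sigma>" X "Cmp \<tau>"] by (intro smtrans.equality) auto

text \<open>
  The operations of the internal hom act on components, and an equation between transformations is
  reduced by these rules to an equation between the components.
\<close>

lemma ihom_simps [simp]:
  "Obj (ihom A B) = {F. sm_functor A B F}"
  "Arr (ihom A B) = {\<sigma>. sm_trans A B \<sigma>}"
  "Dom (ihom A B) = Src"
  "Cod (ihom A B) = Trg"
  "Id (ihom A B) F = \<lparr> Src = F, Trg = F, Cmp = (\<lambda>x\<in>Obj A. Id B (FO F x)) \<rparr>"
  "\<tau> \<cdot>\<^bsub>ihom A B\<^esub> \<sigma> = \<lparr> Src = Src \<sigma>, Trg = Trg \<tau>, Cmp = (\<lambda>x\<in>Obj A. Cmp \<tau> x \<cdot>\<^bsub>B\<^esub> Cmp \<sigma> x) \<rparr>"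
  "F \<otimes>\<^bsub>ihom A B\<^esub> G = box_fun A B F G"
  "\<sigma> \<odot>\<^bsub>ihom A B\<^esub> \<tau> = box_trans A B \<sigma> \<tau>"
  "\<one>\<^bsub>ihom A B\<^esub> = unit_fun A B"
  "Ass (ihom A B) F G H = \<lparr> Src = box_fun A B F (box_fun A B G H),
     Trg = box_fun A B (box_fun A B F G) H, Cmp = (\<lambda>x\<in>Obj A. Ass B (FO F x) (FO G x) (FO H x)) \<rparr>"
  "Run (ihom A B) F = \<lparr> Src = box_fun A B F (unit_fun A B), Trg = F,
     Cmp = (\<lambda>x\<in>Obj A. Run B (FO F x)) \<rparr>"
  "Lun (ihom A B) F = \<lparr> Src = box_fun A B (unit_fun A B) F, Trg = F,
     Cmp = (\<lambda>x\<in>Obj A. Lun B (FO F x)) \<rparr>"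
  "Sym (ihom A B) F G = \<lparr> Src = box_fun A B F G, Trg = box_fun A B G F,
     Cmp = (\<lambda>x\<in>Obj A. Sym B (FO F x) (FO G x)) \<rparr>"
  by (simp_all add: ihom_def)

locale smc_pair = A: smc A + B: smc B
  for A :: "('oa, 'aa) smcat" and B :: "('ob, 'ab) smcat" (structure)

locale sm_fun = smc_pair A B
  for A :: "('oa, 'aa) smcat" and B :: "('ob, 'ab) smcat" (structure) +
  fixes F :: "('oa, 'aa, 'ob, 'ab) smfun"
  assumes sm_functor: "sm_functor A B F"
begin

lemma ext [simp]: "FO F \<in> extensional (Obj A)" "FA F \<in> extensional (Arr A)"
    "F2 F \<in> extensional (Obj A \<times> Obj A)"
  using sm_functor by (auto simp: sm_functor_def)

lemma FO_obj [simp]: "x \<in> Obj A \<Longrightarrow> FO F x \<in> Obj B"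
  and FA_id [simp]: "x \<in> Obj A \<Longrightarrow> FA F (Id A x) = Id B (FO F x)"
  using sm_functor by (auto simp: sm_functor_def)

lemma FA_arr [simp]:
  assumes "f \<in> Arr A"
  shows "FA F f \<in> Arr B" "Dom B (FA F f) = FO F (Dom A f)" "Cod B (FA F f) = FO F (Cod A f)"
  using sm_functor assms by (auto simp: sm_functor_def Hom_def)

lemma FA_comp [simp]:
  assumes "f \<in> Arr A" "g \<in> Arr A" "Cod A f = Dom A g"
  shows "FA F (g \<cdot>\<^bsub>A\<^esub> f) = FA F g \<cdot> FA F f"
  using sm_functor assms by (auto simp: sm_functor_def)

lemma F0_arr [simp]: "F0 F \<in> Arr B" "Dom B (F0 F) = \<one>" "Cod B (F0 F) = FO F \<one>\<^bsub>A\<^esub>"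
  using sm_functor by (auto simp: sm_functor_def Hom_def)

lemma F2_arr [simp]:
  assumes "x \<in> Obj A" "y \<in> Obj A"
  shows "F2 F (x, y) \<in> Arr B" "Dom B (F2 F (x, y)) = FO F x \<otimes> FO F y"
    "Cod B (F2 F (x, y)) = FO F (x \<otimes>\<^bsub>A\<^esub> y)"
  using sm_functor assms by (auto simp: sm_functor_def Hom_def)

lemma F2_natural:
  assumes "f \<in> Arr A" "g \<in> Arr A"
  shows "F2 F (Cod A f, Cod A g) \<cdot> (FA F f \<odot> FA F g) =
        FA F (f \<odot>\<^bsub>A\<^esub> g) \<cdot> F2 F (Dom A f, Dom A g)"
  using sm_functor assms by (auto simp: sm_functor_def)

lemma F_ass:
  assumes "x \<in> Obj A" "y \<in> Obj A" "z \<in> Obj A"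
  shows "FA F (Ass A x y z) \<cdot> F2 F (x, y \<otimes>\<^bsub>A\<^esub> z) \<cdot> (Id B (FO F x) \<odot> F2 F (y, z)) =
        F2 F (x \<otimes>\<^bsub>A\<^esub> y, z) \<cdot> (F2 F (x, y) \<odot> Id B (FO F z)) \<cdot>
          Ass B (FO F x) (FO F y) (FO F z)"
  using sm_functor assms by (auto simp: sm_functor_def)

lemma F_run: "x \<in> Obj A \<Longrightarrow>
        FA F (Run A x) \<cdot> F2 F (x, \<one>\<^bsub>A\<^esub>) \<cdot> (Id B (FO F x) \<odot> F0 F) = Run B (FO F x)"
  and F_lun: "x \<in> Obj A \<Longrightarrow>
        FA F (Lun A x) \<cdot> F2 F (\<one>\<^bsub>A\<^esub>, x) \<cdot> (F0 F \<odot> Id B (FO F x)) = Lun B (FO F x)"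
  using sm_functor by (auto simp: sm_functor_def)

lemma F_sym:
  assumes "x \<in> Obj A" "y \<in> Obj A"
  shows "FA F (Sym A x y) \<cdot> F2 F (x, y) = F2 F (y, x) \<cdot> Sym B (FO F x) (FO F y)"
  using sm_functor assms by (auto simp: sm_functor_def)

lemma FA_iso:
  assumes "iso_arr A f"
  shows "iso_arr B (FA F f)" "inv_arr B (FA F f) = FA F (inv_arr A f)"
proof -
  have "inverse_pair B (FA F f) (FA F (inv_arr A f))"
    using A.inverse_pair_inv_arr[OF assms] A.iso_arr_arr[OF assms] assms
    by (auto simp: inverse_pair_def Hom_def simp flip: FA_comp)
  then show "iso_arr B (FA F f)" "inv_arr B (FA F f) = FA F (inv_arr A f)"
    using B.inv_arr_eqI by (auto simp: iso_arr_def)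
qed

text \<open>
  \<open>f'\<close> in \<open>B\<close> lies over \<open>f\<close> in \<open>A\<close> if the two are intertwined by arrows \<open>p\<close> and \<open>q\<close> into the image of
  \<open>F\<close>. This is stable under composition, inverses and (with \<open>F\<^sup>2\<close>) tensor products, so every arrow of
  \<open>B\<close> built from associativities and symmetries lies over its counterpart in \<open>A\<close>. Going through general
  \<open>p\<close> and \<open>q\<close> avoids inverting \<open>F\<^sup>2\<close>, which a lax functor does not allow.
\<close>

definition over :: "'ab \<Rightarrow> 'ab \<Rightarrow> 'aa \<Rightarrow> 'ab \<Rightarrow> bool" where
  "over p q f f' \<longleftrightarrow> f \<in> Arr A \<and> f' \<in> Arr B \<and> p \<in> Hom B (Dom B f') (FO F (Dom A f)) \<and>
     q \<in> Hom B (Cod B f') (FO F (Cod A f)) \<and> FA F f \<cdot> p = q \<cdot> f'"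

definition pairing :: "'oa \<Rightarrow> 'oa \<Rightarrow> 'ab \<Rightarrow> 'ab \<Rightarrow> 'ab" where
  "pairing x y p q = F2 F (x, y) \<cdot> (p \<odot> q)"

lemma over_comp:
  assumes "over p q f f'" "over q r g g'"
    and [simp]: "Cod A f = Dom A g" "Cod B f' = Dom B g'"
  shows "over p r (g \<cdot>\<^bsub>A\<^esub> f) (g' \<cdot> f')"
proof -
  have [simp]: "f \<in> Arr A" "g \<in> Arr A" "f' \<in> Arr B" "g' \<in> Arr B"
    "p \<in> Arr B" "q \<in> Arr B" "r \<in> Arr B"
    "Dom B p = Dom B f'" "Cod B p = FO F (Dom A f)"
    "Dom B q = Dom B g'" "Cod B q = FO F (Dom A g)"
    "Dom B r = Cod B g'" "Cod B r = FO F (Cod A g)"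
    using assms by (auto simp: over_def Hom_def)
  have "FA F (g \<cdot>\<^bsub>A\<^esub> f) \<cdot> p = FA F g \<cdot> (FA F f \<cdot> p)"
    by simp
  also have "\<dots> = FA F g \<cdot> (q \<cdot> f')"
    using assms(1) unfolding over_def by presburger
  also have "\<dots> = (FA F g \<cdot> q) \<cdot> f'"
    by simp
  also have "\<dots> = (r \<cdot> g') \<cdot> f'"
    using assms(2) unfolding over_def by presburger
  finally show ?thesis
    by (simp add: over_def Hom_def)
qed

lemma over_id: "x \<in> Obj A \<Longrightarrow> p \<in> Hom B (Dom B p) (FO F x) \<Longrightarrow> over p p (Id A x) (Id B (Dom B p))"
  by (auto simp: over_def Hom_def)

lemma over_inv:
  assumes "over p q f f'" and f: "iso_arr A f" and f': "iso_arr B f'"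
  shows "over q p (inv_arr A f) (inv_arr B f')"
proof -
  have [simp]: "f \<in> Arr A" "f' \<in> Arr B" "p \<in> Arr B" "q \<in> Arr B"
    "Dom B p = Dom B f'" "Cod B p = FO F (Dom A f)" "Dom B q = Cod B f'" "Cod B q = FO F (Cod A f)"
    using assms by (auto simp: over_def Hom_def)
  have "FA F f \<cdot> (p \<cdot> inv_arr B f') = q"
    using assms B.comp_reduce[of "FA F f" p "q \<cdot> f'" "inv_arr B f'"] by (simp add: over_def)
  from B.iso_move_left[OF this] show ?thesis
    using FA_iso[OF f] f f' by (simp add: over_def Hom_def)
qed

lemma over_tensor:
  assumes "over p q f f'" "over r s g g'"
    and x: "Dom A f = x" "Cod A f = x'" "Dom A g = y" "Cod A g = y'"
  shows "over (pairing x y p r) (pairing x' y' q s) (f \<odot>\<^bsub>A\<^esub> g) (f' \<odot> g')"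
proof -
  have [simp]: "f \<in> Arr A" "f' \<in> Arr B" "p \<in> Arr B" "q \<in> Arr B"
    "g \<in> Arr A" "g' \<in> Arr B" "r \<in> Arr B" "s \<in> Arr B"
    "Dom B p = Dom B f'" "Cod B p = FO F (Dom A f)" "Dom B q = Cod B f'" "Cod B q = FO F (Cod A f)"
    "Dom B r = Dom B g'" "Cod B r = FO F (Dom A g)" "Dom B s = Cod B g'" "Cod B s = FO F (Cod A g)"
    using assms by (auto simp: over_def Hom_def)
  have "FA F (f \<odot>\<^bsub>A\<^esub> g) \<cdot> pairing (Dom A f) (Dom A g) p r =
      (FA F (f \<odot>\<^bsub>A\<^esub> g) \<cdot> F2 F (Dom A f, Dom A g)) \<cdot> (p \<odot> r)"
    by (simp add: pairing_def)
  also have "\<dots> = F2 F (Cod A f, Cod A g) \<cdot> ((FA F f \<cdot> p) \<odot> (FA F g \<cdot> r))"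
    by (simp flip: F2_natural)
  also have "\<dots> = F2 F (Cod A f, Cod A g) \<cdot> ((q \<cdot> f') \<odot> (s \<cdot> g'))"
    using assms(1,2) unfolding over_def by presburger
  also have "\<dots> = pairing (Cod A f) (Cod A g) q s \<cdot> (f' \<odot> g')"
    by (simp add: pairing_def)
  finally show ?thesis
    by (simp add: over_def Hom_def pairing_def flip: x)
qed

lemma over_ass:
  assumes [simp]: "x \<in> Obj A" "y \<in> Obj A" "z \<in> Obj A" "p \<in> Arr B" "q \<in> Arr B" "r \<in> Arr B"
    "Cod B p = FO F x" "Cod B q = FO F y" "Cod B r = FO F z"
    and d: "Dom B p = x'" "Dom B q = y'" "Dom B r = z'"
  shows "over (pairing x (y \<otimes>\<^bsub>A\<^esub> z) p (pairing y z q r)) (pairing (x \<otimes>\<^bsub>A\<^esub> y) z (pairing x y p q) r)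
    (Ass A x y z) (Ass B x' y' z')"
proof -
  have "FA F (Ass A x y z) \<cdot> pairing x (y \<otimes>\<^bsub>A\<^esub> z) p (pairing y z q r) =
    (FA F (Ass A x y z) \<cdot> F2 F (x, y \<otimes>\<^bsub>A\<^esub> z) \<cdot> (Id B (FO F x) \<odot> F2 F (y, z))) \<cdot>
      (p \<odot> (q \<odot> r))"
    by (simp add: pairing_def)
  also have "\<dots> = F2 F (x \<otimes>\<^bsub>A\<^esub> y, z) \<cdot> (F2 F (x, y) \<odot> Id B (FO F z)) \<cdot>
      (Ass B (FO F x) (FO F y) (FO F z) \<cdot> (p \<odot> (q \<odot> r)))"
    by (subst F_ass) simp_all
  also have "\<dots> = pairing (x \<otimes>\<^bsub>A\<^esub> y) z (pairing x y p q) r \<cdot> Ass B (Dom B p) (Dom B q) (Dom B r)"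
    by (subst B.ass_natural[of _ _ _ "Dom B p" "Dom B q" "Dom B r"]) (simp_all add: pairing_def)
  finally show ?thesis
    by (simp add: over_def Hom_def pairing_def flip: d)
qed

lemma over_sym:
  assumes [simp]: "x \<in> Obj A" "y \<in> Obj A" "p \<in> Arr B" "q \<in> Arr B"
    "Cod B p = FO F x" "Cod B q = FO F y"
    and d: "Dom B p = x'" "Dom B q = y'"
  shows "over (pairing x y p q) (pairing y x q p) (Sym A x y) (Sym B x' y')"
proof -
  have "FA F (Sym A x y) \<cdot> pairing x y p q =
      (FA F (Sym A x y) \<cdot> F2 F (x, y)) \<cdot> (p \<odot> q)"
    by (simp add: pairing_def)
  also have "\<dots> = F2 F (y, x) \<cdot> (Sym B (FO F x) (FO F y) \<cdot> (p \<odot> q))"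
    by (simp add: F_sym)
  also have "\<dots> = pairing y x q p \<cdot> Sym B (Dom B p) (Dom B q)"
    by (subst B.sym_natural[of _ _ "Dom B p" "Dom B q"]) (simp_all add: pairing_def)
  finally show ?thesis
    by (simp add: over_def Hom_def pairing_def flip: d)
qed

text \<open>
  The interchange is built from associativities, a symmetry and their inverses, so it lies over its
  counterpart along the iterates of \<open>F\<^sup>2\<close> that start from identities.
\<close>

lemma F_interchange:
  assumes [simp]: "a \<in> Obj A" "b \<in> Obj A" "c \<in> Obj A" "d \<in> Obj A"
  shows "FA F (interchange A a b c d) \<cdot> F2 F (a \<otimes>\<^bsub>A\<^esub> b, c \<otimes>\<^bsub>A\<^esub> d) \<cdot> (F2 F (a, b) \<odot> F2 F (c, d)) =
    F2 F (a \<otimes>\<^bsub>A\<^esub> c, b \<otimes>\<^bsub>A\<^esub> d) \<cdot> (F2 F (a, c) \<odot> F2 F (b, d)) \<cdot>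
      interchange B (FO F a) (FO F b) (FO F c) (FO F d)"
proof -
  let ?i = "\<lambda>x. Id B (FO F x)"
  have id: "over (?i x) (?i x) (Id A x) (?i x)" if "x \<in> Obj A" for x
    using that over_id[of x "?i x"] by (simp add: Hom_def)
  have "over (pairing (a \<otimes>\<^bsub>A\<^esub> b) (c \<otimes>\<^bsub>A\<^esub> d) (pairing a b (?i a) (?i b)) (pairing c d (?i c) (?i d)))
     (pairing (a \<otimes>\<^bsub>A\<^esub> c) (b \<otimes>\<^bsub>A\<^esub> d) (pairing a c (?i a) (?i c)) (pairing b d (?i b) (?i d)))
     (interchange A a b c d) (interchange B (FO F a) (FO F b) (FO F c) (FO F d))"
    unfolding interchange_def
    by (rule over_comp over_inv over_ass over_tensor over_sym id over_inv[OF over_ass] | simp add: pairing_def; fail)+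
  then show ?thesis
    by (simp add: over_def pairing_def)
qed

end

locale sm_nt = smc_pair A B
  for A :: "('oa, 'aa) smcat" and B :: "('ob, 'ab) smcat" (structure) +
  fixes \<sigma> :: "('oa, 'aa, 'ob, 'ab) smtrans"
  assumes sm_trans: "sm_trans A B \<sigma>"
begin

sublocale S: sm_fun A B "Src \<sigma>"
  using sm_trans by unfold_locales (simp add: sm_trans_def)

sublocale T: sm_fun A B "Trg \<sigma>"
  using sm_trans by unfold_locales (simp add: sm_trans_def)

lemma ext [simp]: "Cmp \<sigma> \<in> extensional (Obj A)"
  using sm_trans by (simp add: sm_trans_def)

lemma Cmp_arr [simp]:
  assumes "x \<in> Obj A"
  shows "Cmp \<sigma> x \<in> Arr B" "Dom B (Cmp \<sigma> x) = FO (Src \<sigma>) x" "Cod B (Cmp \<sigma> x) = FO (Trg \<sigma>) x"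
  using assms sm_trans by (auto simp: sm_trans_def Hom_def)

lemma Cmp_natural:
  "f \<in> Arr A \<Longrightarrow> Cmp \<sigma> (Cod A f) \<cdot> FA (Src \<sigma>) f = FA (Trg \<sigma>) f \<cdot> Cmp \<sigma> (Dom A f)"
  using sm_trans by (simp add: sm_trans_def)

lemma Cmp_unit: "Cmp \<sigma> \<one>\<^bsub>A\<^esub> \<cdot> F0 (Src \<sigma>) = F0 (Trg \<sigma>)"
  using sm_trans by (simp add: sm_trans_def)

lemma Cmp_tensor:
  assumes "x \<in> Obj A" "y \<in> Obj A"
  shows "Cmp \<sigma> (x \<otimes>\<^bsub>A\<^esub> y) \<cdot> F2 (Src \<sigma>) (x, y) =
     F2 (Trg \<sigma>) (x, y) \<cdot> (Cmp \<sigma> x \<odot> Cmp \<sigma> y)"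
  using assms sm_trans by (simp add: sm_trans_def)

end

section \<open>The internal hom is symmetric monoidal\<close>

lemma box_fun_simps [simp]:
  "x \<in> Obj A \<Longrightarrow> FO (box_fun A B F G) x = FO F x \<otimes>\<^bsub>B\<^esub> FO G x"
  "f \<in> Arr A \<Longrightarrow> FA (box_fun A B F G) f = FA F f \<odot>\<^bsub>B\<^esub> FA G f"
  "F0 (box_fun A B F G) = (F0 F \<odot>\<^bsub>B\<^esub> F0 G) \<cdot>\<^bsub>B\<^esub> inv_arr B (Run B \<one>\<^bsub>B\<^esub>)"
  "x \<in> Obj A \<Longrightarrow> y \<in> Obj A \<Longrightarrow> F2 (box_fun A B F G) (x, y) =
     (F2 F (x, y) \<odot>\<^bsub>B\<^esub> F2 G (x, y)) \<cdot>\<^bsub>B\<^esub> interchange B (FO F x) (FO G x) (FO F y) (FO G y)"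
  "FO (box_fun A B F G) \<in> extensional (Obj A)"
  "FA (box_fun A B F G) \<in> extensional (Arr A)"
  "F2 (box_fun A B F G) \<in> extensional (Obj A \<times> Obj A)"
  by (auto simp: box_fun_def)

lemma box_trans_simps [simp]:
  "Src (box_trans A B \<sigma> \<tau>) = box_fun A B (Src \<sigma>) (Src \<tau>)"
  "Trg (box_trans A B \<sigma> \<tau>) = box_fun A B (Trg \<sigma>) (Trg \<tau>)"
  "Cmp (box_trans A B \<sigma> \<tau>) = (\<lambda>x\<in>Obj A. Cmp \<sigma> x \<odot>\<^bsub>B\<^esub> Cmp \<tau> x)"
  by (auto simp: box_trans_def)

lemma unit_fun_simps [simp]:
  "x \<in> Obj A \<Longrightarrow> FO (unit_fun A B) x = \<one>\<^bsub>B\<^esub>"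
  "f \<in> Arr A \<Longrightarrow> FA (unit_fun A B) f = Id B \<one>\<^bsub>B\<^esub>"
  "F0 (unit_fun A B) = Id B \<one>\<^bsub>B\<^esub>"
  "x \<in> Obj A \<Longrightarrow> y \<in> Obj A \<Longrightarrow> F2 (unit_fun A B) (x, y) = Run B \<one>\<^bsub>B\<^esub>"
  "FO (unit_fun A B) \<in> extensional (Obj A)"
  "FA (unit_fun A B) \<in> extensional (Arr A)"
  "F2 (unit_fun A B) \<in> extensional (Obj A \<times> Obj A)"
  by (auto simp: unit_fun_def)

context smc_pair
begin

lemma sm_fun_iff: "sm_fun A B F \<longleftrightarrow> sm_functor A B F"
  by (simp add: sm_fun_def sm_fun_axioms_def smc_pair_axioms)

lemma sm_nt_iff: "sm_nt A B \<sigma> \<longleftrightarrow> sm_trans A B \<sigma>"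
  by (simp add: sm_nt_def sm_nt_axioms_def smc_pair_axioms)

lemma sm_functor_unit_fun: "sm_functor A B (unit_fun A B)"
  by (rule sm_functorI)
    (simp_all add: Hom_def B.lun_unit B.run_unit_sym B.run_unit_ass)

text \<open>
  The tensor product of \<open>B\<close> is itself a symmetric monoidal functor with the interchange as structure
  arrow. Each axiom for \<open>F \<otimes> G\<close> splits, by naturality of the interchange, into the same axiom for \<open>F\<close> and
  for \<open>G\<close> and the corresponding axiom for the tensor product.
\<close>

lemma sm_functor_box_fun:
  assumes "sm_functor A B F" "sm_functor A B G"
  shows "sm_functor A B (box_fun A B F G)"
proof -
  let ?P = "box_fun A B F G"
  interpret F: sm_fun A B F using assms by (simp add: sm_fun_iff)
  interpret G: sm_fun A B G using assms by (simp add: sm_fun_iff)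
  let ?i = "interchange B"
  show ?thesis
  proof (rule sm_functorI)
    fix f g
    assume [simp]: "f \<in> Arr A" "g \<in> Arr A"
    let ?x = "Dom A f" and ?y = "Dom A g" and ?x' = "Cod A f" and ?y' = "Cod A g"
    have "F2 ?P (?x', ?y') \<cdot> (FA ?P f \<odot> FA ?P g) =
      (F2 F (?x', ?y') \<odot> F2 G (?x', ?y')) \<cdot> (?i (FO F ?x') (FO G ?x') (FO F ?y') (FO G ?y') \<cdot>
        ((FA F f \<odot> FA G f) \<odot> (FA F g \<odot> FA G g)))"
      by simp
    also have "\<dots> = ((F2 F (?x', ?y') \<cdot> (FA F f \<odot> FA F g)) \<odot> (F2 G (?x', ?y') \<cdot> (FA G f \<odot> FA G g))) \<cdot>
        ?i (FO F ?x) (FO G ?x) (FO F ?y) (FO G ?y)"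
      by (subst B.interchange_natural[of _ _ _ _ "FO F ?x" "FO G ?x" "FO F ?y" "FO G ?y"]) simp_all
    also have "\<dots> = FA ?P (f \<odot>\<^bsub>A\<^esub> g) \<cdot> F2 ?P (?x, ?y)"
      by (simp add: F.F2_natural G.F2_natural)
    finally show "F2 ?P (?x', ?y') \<cdot> (FA ?P f \<odot> FA ?P g) =
      FA ?P (f \<odot>\<^bsub>A\<^esub> g) \<cdot> F2 ?P (?x, ?y)" .
  next
    fix x y z
    assume [simp]: "x \<in> Obj A" "y \<in> Obj A" "z \<in> Obj A"
    let ?w = "y \<otimes>\<^bsub>A\<^esub> z" and ?v = "x \<otimes>\<^bsub>A\<^esub> y"
    let ?l = "\<lambda>F. FA F (Ass A x y z) \<cdot> F2 F (x, ?w) \<cdot> (Id B (FO F x) \<odot> F2 F (y, z))"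
    let ?r = "\<lambda>F. F2 F (?v, z) \<cdot> (F2 F (x, y) \<odot> Id B (FO F z)) \<cdot> Ass B (FO F x) (FO F y) (FO F z)"
    have "?l ?P = (FA F (Ass A x y z) \<odot> FA G (Ass A x y z)) \<cdot> (F2 F (x, ?w) \<odot> F2 G (x, ?w)) \<cdot>
        (?i (FO F x) (FO G x) (FO F ?w) (FO G ?w) \<cdot>
          ((Id B (FO F x) \<odot> Id B (FO G x)) \<odot> (F2 F (y, z) \<odot> F2 G (y, z)))) \<cdot>
        (Id B (FO F x \<otimes> FO G x) \<odot> ?i (FO F y) (FO G y) (FO F z) (FO G z))"
      by simp
    also have "\<dots> = (?l F \<odot> ?l G) \<cdot> ?i (FO F x) (FO G x) (FO F y \<otimes> FO F z) (FO G y \<otimes> FO G z) \<cdot>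
        (Id B (FO F x \<otimes> FO G x) \<odot> ?i (FO F y) (FO G y) (FO F z) (FO G z))"
      by (subst B.interchange_natural[of _ _ _ _ "FO F x" "FO G x" "FO F y \<otimes> FO F z" "FO G y \<otimes> FO G z"])
        simp_all
    also have "\<dots> = ((F2 F (?v, z) \<cdot> (F2 F (x, y) \<odot> Id B (FO F z))) \<odot>
          (F2 G (?v, z) \<cdot> (F2 G (x, y) \<odot> Id B (FO G z)))) \<cdot>
        ((Ass B (FO F x) (FO F y) (FO F z) \<odot> Ass B (FO G x) (FO G y) (FO G z)) \<cdot>
        ?i (FO F x) (FO G x) (FO F y \<otimes> FO F z) (FO G y \<otimes> FO G z) \<cdot>
        (Id B (FO F x \<otimes> FO G x) \<odot> ?i (FO F y) (FO G y) (FO F z) (FO G z)))"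
      by (simp add: F.F_ass G.F_ass)
    also have "\<dots> = (F2 F (?v, z) \<odot> F2 G (?v, z)) \<cdot>
        (((F2 F (x, y) \<odot> Id B (FO F z)) \<odot> (F2 G (x, y) \<odot> Id B (FO G z))) \<cdot>
          ?i (FO F x \<otimes> FO F y) (FO G x \<otimes> FO G y) (FO F z) (FO G z)) \<cdot>
        (?i (FO F x) (FO G x) (FO F y) (FO G y) \<odot> Id B (FO F z \<otimes> FO G z)) \<cdot>
        Ass B (FO F x \<otimes> FO G x) (FO F y \<otimes> FO G y) (FO F z \<otimes> FO G z)"
      by (simp add: B.interchange_ass)
    also have "\<dots> = ?r ?P"
      by (subst B.interchange_natural[symmetric, where a' = "FO F ?v" and b' = "FO G ?v"
          and c' = "FO F z" and d' = "FO G z"]) simp_all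
    finally show "?l ?P = ?r ?P" .
  next
    fix x
    assume [simp]: "x \<in> Obj A"
    let ?l = "\<lambda>F. FA F (Run A x) \<cdot> F2 F (x, \<one>\<^bsub>A\<^esub>) \<cdot> (Id B (FO F x) \<odot> F0 F)"
    have "?l ?P = (FA F (Run A x) \<odot> FA G (Run A x)) \<cdot> (F2 F (x, \<one>\<^bsub>A\<^esub>) \<odot> F2 G (x, \<one>\<^bsub>A\<^esub>)) \<cdot>
        (?i (FO F x) (FO G x) (FO F \<one>\<^bsub>A\<^esub>) (FO G \<one>\<^bsub>A\<^esub>) \<cdot>
          ((Id B (FO F x) \<odot> Id B (FO G x)) \<odot> (F0 F \<odot> F0 G))) \<cdot>
        (Id B (FO F x \<otimes> FO G x) \<odot> inv_arr B (Run B \<one>))"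
      by simp
    also have "\<dots> = (?l F \<odot> ?l G) \<cdot> ?i (FO F x) (FO G x) \<one> \<one> \<cdot>
        (Id B (FO F x \<otimes> FO G x) \<odot> inv_arr B (Run B \<one>))"
      by (subst B.interchange_natural[of _ _ _ _ "FO F x" "FO G x" "\<one>" "\<one>"]) simp_all
    also have "\<dots> = Run B (FO ?P x)"
      by (simp add: F.F_run G.F_run B.interchange_run)
    finally show "?l ?P = Run B (FO ?P x)" .
  next
    fix x
    assume [simp]: "x \<in> Obj A"
    let ?l = "\<lambda>F. FA F (Lun A x) \<cdot> F2 F (\<one>\<^bsub>A\<^esub>, x) \<cdot> (F0 F \<odot> Id B (FO F x))"
    have "?l ?P = (FA F (Lun A x) \<odot> FA G (Lun A x)) \<cdot> (F2 F (\<one>\<^bsub>A\<^esub>, x) \<odot> F2 G (\<one>\<^bsub>A\<^esub>, x)) \<cdot>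
        (?i (FO F \<one>\<^bsub>A\<^esub>) (FO G \<one>\<^bsub>A\<^esub>) (FO F x) (FO G x) \<cdot>
          ((F0 F \<odot> F0 G) \<odot> (Id B (FO F x) \<odot> Id B (FO G x)))) \<cdot>
        (inv_arr B (Run B \<one>) \<odot> Id B (FO F x \<otimes> FO G x))"
      by simp
    also have "\<dots> = (?l F \<odot> ?l G) \<cdot> ?i \<one> \<one> (FO F x) (FO G x) \<cdot>
        (inv_arr B (Run B \<one>) \<odot> Id B (FO F x \<otimes> FO G x))"
      by (subst B.interchange_natural[of _ _ _ _ "\<one>" "\<one>" "FO F x" "FO G x"]) simp_all
    also have "\<dots> = Lun B (FO ?P x)"
      by (simp add: F.F_lun G.F_lun B.interchange_lun)
    finally show "?l ?P = Lun B (FO ?P x)" .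
  next
    fix x y
    assume [simp]: "x \<in> Obj A" "y \<in> Obj A"
    have "FA ?P (Sym A x y) \<cdot> F2 ?P (x, y) =
      ((FA F (Sym A x y) \<cdot> F2 F (x, y)) \<odot> (FA G (Sym A x y) \<cdot> F2 G (x, y))) \<cdot>
        ?i (FO F x) (FO G x) (FO F y) (FO G y)"
      by simp
    also have "\<dots> = (F2 F (y, x) \<odot> F2 G (y, x)) \<cdot>
       ((Sym B (FO F x) (FO F y) \<odot> Sym B (FO G x) (FO G y)) \<cdot> ?i (FO F x) (FO G x) (FO F y) (FO G y))"
      by (simp add: F.F_sym G.F_sym)
    also have "\<dots> = F2 ?P (y, x) \<cdot> Sym B (FO ?P x) (FO ?P y)"
      by (simp flip: B.interchange_sym)
    finally show "FA ?P (Sym A x y) \<cdot> F2 ?P (x, y) =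
       F2 ?P (y, x) \<cdot> Sym B (FO ?P x) (FO ?P y)" .
  qed (simp_all add: Hom_def)
qed

lemma sm_trans_id:
  assumes "sm_functor A B F"
  shows "sm_trans A B \<lparr> Src = F, Trg = F, Cmp = (\<lambda>x\<in>Obj A. Id B (FO F x)) \<rparr>"
proof -
  interpret F: sm_fun A B F using assms by (simp add: sm_fun_iff)
  show ?thesis
    by (rule sm_transI) (simp_all add: assms Hom_def)
qed

lemma sm_trans_comp:
  assumes "sm_trans A B \<sigma>" "sm_trans A B \<tau>" and e: "Trg \<sigma> = Src \<tau>"
  shows "sm_trans A B \<lparr> Src = Src \<sigma>, Trg = Trg \<tau>, Cmp = (\<lambda>x\<in>Obj A. Cmp \<tau> x \<cdot> Cmp \<sigma> x) \<rparr>"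
proof -
  interpret \<sigma>: sm_nt A B \<sigma> using assms by (simp add: sm_nt_iff)
  interpret \<tau>: sm_nt A B \<tau> using assms by (simp add: sm_nt_iff)
  note [simp] = e
  let ?\<rho> = "\<lparr> Src = Src \<sigma>, Trg = Trg \<tau>, Cmp = (\<lambda>x\<in>Obj A. Cmp \<tau> x \<cdot> Cmp \<sigma> x) \<rparr>"
  show ?thesis
  proof (rule sm_transI)
    fix f assume [simp]: "f \<in> Arr A"
    have "(Cmp \<tau> (Cod A f) \<cdot> Cmp \<sigma> (Cod A f)) \<cdot> FA (Src \<sigma>) f =
       (Cmp \<tau> (Cod A f) \<cdot> FA (Src \<tau>) f) \<cdot> Cmp \<sigma> (Dom A f)"
      by (simp add: \<sigma>.Cmp_natural)
    also have "\<dots> = FA (Trg \<tau>) f \<cdot> Cmp \<tau> (Dom A f) \<cdot> Cmp \<sigma> (Dom A f)"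
      by (simp add: \<tau>.Cmp_natural)
    finally show "Cmp ?\<rho> (Cod A f) \<cdot>
        FA (Src ?\<rho>) f =
        FA (Trg ?\<rho>) f \<cdot>
        Cmp ?\<rho> (Dom A f)"
      by simp
  next
    fix x y assume [simp]: "x \<in> Obj A" "y \<in> Obj A"
    have "(Cmp \<tau> (x \<otimes>\<^bsub>A\<^esub> y) \<cdot> Cmp \<sigma> (x \<otimes>\<^bsub>A\<^esub> y)) \<cdot> F2 (Src \<sigma>) (x, y) =
       (Cmp \<tau> (x \<otimes>\<^bsub>A\<^esub> y) \<cdot> F2 (Src \<tau>) (x, y)) \<cdot> (Cmp \<sigma> x \<odot> Cmp \<sigma> y)"
      by (simp add: \<sigma>.Cmp_tensor)
    also have "\<dots> = F2 (Trg \<tau>) (x, y) \<cdot> ((Cmp \<tau> x \<cdot> Cmp \<sigma> x) \<odot> (Cmp \<tau> y \<cdot> Cmp \<sigma> y))"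
      by (simp add: \<tau>.Cmp_tensor)
    finally show "Cmp ?\<rho> (x \<otimes>\<^bsub>A\<^esub> y) \<cdot>
        F2 (Src ?\<rho>) (x, y) =
        F2 (Trg ?\<rho>) (x, y) \<cdot>
        (Cmp ?\<rho> x \<odot>
         Cmp ?\<rho> y)"
      by simp
  qed (use assms \<sigma>.S.sm_functor \<tau>.T.sm_functor in \<open>simp_all add: Hom_def \<sigma>.Cmp_unit \<tau>.Cmp_unit\<close>)
qed

lemma sm_trans_box:
  assumes "sm_trans A B \<sigma>" "sm_trans A B \<tau>"
  shows "sm_trans A B (box_trans A B \<sigma> \<tau>)"
proof -
  let ?\<rho> = "box_trans A B \<sigma> \<tau>"
  interpret \<sigma>: sm_nt A B \<sigma> using assms by (simp add: sm_nt_iff)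
  interpret \<tau>: sm_nt A B \<tau> using assms by (simp add: sm_nt_iff)
  show ?thesis
  proof (rule sm_transI)
    show "Cmp ?\<rho> \<one>\<^bsub>A\<^esub> \<cdot> F0 (Src ?\<rho>) = F0 (Trg ?\<rho>)"
      by (simp add: \<sigma>.Cmp_unit \<tau>.Cmp_unit)
  next
    fix x y assume [simp]: "x \<in> Obj A" "y \<in> Obj A"
    let ?i = "\<lambda>F G. interchange B (FO F x) (FO G x) (FO F y) (FO G y)"
    have "Cmp ?\<rho> (x \<otimes>\<^bsub>A\<^esub> y) \<cdot> F2 (Src ?\<rho>) (x, y) =
      (F2 (Trg \<sigma>) (x, y) \<odot> F2 (Trg \<tau>) (x, y)) \<cdot>
      (((Cmp \<sigma> x \<odot> Cmp \<sigma> y) \<odot> (Cmp \<tau> x \<odot> Cmp \<tau> y)) \<cdot> ?i (Src \<sigma>) (Src \<tau>))"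
      by (simp add: \<sigma>.Cmp_tensor \<tau>.Cmp_tensor)
    also have "\<dots> = F2 (Trg ?\<rho>) (x, y) \<cdot>
        (Cmp ?\<rho> x \<odot> Cmp ?\<rho> y)"
      by (subst B.interchange_natural[symmetric, where a' = "FO (Trg \<sigma>) x" and b' = "FO (Trg \<tau>) x"
            and c' = "FO (Trg \<sigma>) y" and d' = "FO (Trg \<tau>) y"]) simp_all
    finally show "Cmp ?\<rho> (x \<otimes>\<^bsub>A\<^esub> y) \<cdot> F2 (Src ?\<rho>) (x, y) =
       F2 (Trg ?\<rho>) (x, y) \<cdot>
        (Cmp ?\<rho> x \<odot> Cmp ?\<rho> y)" .
  qed (use \<sigma>.S.sm_functor \<tau>.S.sm_functor \<sigma>.T.sm_functor \<tau>.T.sm_functor in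
     \<open>simp_all add: sm_functor_box_fun Hom_def \<sigma>.Cmp_natural \<tau>.Cmp_natural\<close>)
qed

lemma sm_trans_ass:
  assumes "sm_functor A B F" "sm_functor A B G" "sm_functor A B H"
  shows "sm_trans A B (Ass (ihom A B) F G H)"
proof -
  interpret F: sm_fun A B F using assms by (simp add: sm_fun_iff)
  interpret G: sm_fun A B G using assms by (simp add: sm_fun_iff)
  interpret H: sm_fun A B H using assms by (simp add: sm_fun_iff)
  let ?\<alpha> = "Ass (ihom A B) F G H"
  show ?thesis
  proof (rule sm_transI)
    fix f assume [simp]: "f \<in> Arr A"
    show "Cmp ?\<alpha> (Cod A f) \<cdot> FA (Src ?\<alpha>) f = FA (Trg ?\<alpha>) f \<cdot> Cmp ?\<alpha> (Dom A f)"
      using B.ass_natural[of "FA F f" "FA G f" "FA H f"] by simp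
  next
    have n: "Ass B (FO F \<one>\<^bsub>A\<^esub>) (FO G \<one>\<^bsub>A\<^esub>) (FO H \<one>\<^bsub>A\<^esub>) \<cdot> (F0 F \<odot> (F0 G \<odot> F0 H)) =
        ((F0 F \<odot> F0 G) \<odot> F0 H) \<cdot> Ass B \<one> \<one> \<one>"
      by (intro B.ass_natural) simp_all
    let ?j = "inv_arr B (Run B \<one>)" and ?I = "Id B \<one>"
    have "Cmp ?\<alpha> \<one>\<^bsub>A\<^esub> \<cdot> F0 (Src ?\<alpha>) =
      (Ass B (FO F \<one>\<^bsub>A\<^esub>) (FO G \<one>\<^bsub>A\<^esub>) (FO H \<one>\<^bsub>A\<^esub>) \<cdot> (F0 F \<odot> (F0 G \<odot> F0 H))) \<cdot>
       (?I \<odot> ?j) \<cdot> ?j"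
      by simp
    also have "\<dots> = ((F0 F \<odot> F0 G) \<odot> F0 H) \<cdot> (Ass B \<one> \<one> \<one> \<cdot> (?I \<odot> ?j) \<cdot> ?j)"
      unfolding n by simp
    also have "\<dots> = F0 (Trg ?\<alpha>)"
      by (simp add: B.inv_run_unit_ass)
    finally show "Cmp ?\<alpha> \<one>\<^bsub>A\<^esub> \<cdot> F0 (Src ?\<alpha>) = F0 (Trg ?\<alpha>)" .
  next
    fix x y assume [simp]: "x \<in> Obj A" "y \<in> Obj A"
    let ?i = "interchange B"
    let ?F = "F2 F (x, y)" and ?G = "F2 G (x, y)" and ?H = "F2 H (x, y)"
    let ?k = "?i (FO F x) (FO G x \<otimes> FO H x) (FO F y) (FO G y \<otimes> FO H y)"
    let ?l = "?i (FO F x \<otimes> FO G x) (FO H x) (FO F y \<otimes> FO G y) (FO H y)"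
    have "Cmp ?\<alpha> (x \<otimes>\<^bsub>A\<^esub> y) \<cdot> F2 (Src ?\<alpha>) (x, y) =
      (Ass B (FO F (x \<otimes>\<^bsub>A\<^esub> y)) (FO G (x \<otimes>\<^bsub>A\<^esub> y)) (FO H (x \<otimes>\<^bsub>A\<^esub> y)) \<cdot> (?F \<odot> (?G \<odot> ?H))) \<cdot>
        (Id B (FO F x \<otimes> FO F y) \<odot> ?i (FO G x) (FO H x) (FO G y) (FO H y)) \<cdot> ?k"
      by simp
    also have "\<dots> = ((?F \<odot> ?G) \<odot> ?H) \<cdot>
        (Ass B (FO F x \<otimes> FO F y) (FO G x \<otimes> FO G y) (FO H x \<otimes> FO H y) \<cdot>
        (Id B (FO F x \<otimes> FO F y) \<odot> ?i (FO G x) (FO H x) (FO G y) (FO H y)) \<cdot> ?k)"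
      by (subst B.ass_natural[of _ _ _ "FO F x \<otimes> FO F y" "FO G x \<otimes> FO G y" "FO H x \<otimes> FO H y"]) simp_all
    also have "\<dots> = ((?F \<odot> ?G) \<odot> ?H) \<cdot>
        (?i (FO F x) (FO G x) (FO F y) (FO G y) \<odot> Id B (FO H x \<otimes> FO H y)) \<cdot> ?l \<cdot>
        (Ass B (FO F x) (FO G x) (FO H x) \<odot> Ass B (FO F y) (FO G y) (FO H y))"
      by (subst B.ass_interchange) simp_all
    also have "\<dots> = F2 (Trg ?\<alpha>) (x, y) \<cdot> (Cmp ?\<alpha> x \<odot> Cmp ?\<alpha> y)"
      by simp
    finally show "Cmp ?\<alpha> (x \<otimes>\<^bsub>A\<^esub> y) \<cdot> F2 (Src ?\<alpha>) (x, y) =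
      F2 (Trg ?\<alpha>) (x, y) \<cdot> (Cmp ?\<alpha> x \<odot> Cmp ?\<alpha> y)" .
  qed (simp_all add: Hom_def assms sm_functor_box_fun)
qed

lemma sm_trans_run:
  assumes "sm_functor A B F"
  shows "sm_trans A B (Run (ihom A B) F)"
proof -
  interpret F: sm_fun A B F using assms by (simp add: sm_fun_iff)
  let ?\<rho> = "Run (ihom A B) F"
  show ?thesis
  proof (rule sm_transI)
    fix f assume [simp]: "f \<in> Arr A"
    show "Cmp ?\<rho> (Cod A f) \<cdot> FA (Src ?\<rho>) f = FA (Trg ?\<rho>) f \<cdot> Cmp ?\<rho> (Dom A f)"
      using B.run_natural[of "FA F f"] by simp
  next
    have "Cmp ?\<rho> \<one>\<^bsub>A\<^esub> \<cdot> F0 (Src ?\<rho>) =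
        (Run B (FO F \<one>\<^bsub>A\<^esub>) \<cdot> (F0 F \<odot> Id B \<one>)) \<cdot> inv_arr B (Run B \<one>)"
      by simp
    also have "\<dots> = F0 (Trg ?\<rho>)"
      using B.run_natural[of "F0 F"] by simp
    finally show "Cmp ?\<rho> \<one>\<^bsub>A\<^esub> \<cdot> F0 (Src ?\<rho>) = F0 (Trg ?\<rho>)" .
  next
    fix x y assume [simp]: "x \<in> Obj A" "y \<in> Obj A"
    let ?k = "interchange B (FO F x) \<one> (FO F y) \<one>"
    have "Cmp ?\<rho> (x \<otimes>\<^bsub>A\<^esub> y) \<cdot> F2 (Src ?\<rho>) (x, y) =
      (Run B (FO F (x \<otimes>\<^bsub>A\<^esub> y)) \<cdot> (F2 F (x, y) \<odot> Id B \<one>)) \<cdot>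
        (Id B (FO F x \<otimes> FO F y) \<odot> Run B \<one>) \<cdot> ?k"
      by simp
    also have "\<dots> = F2 F (x, y) \<cdot> (Run B (FO F x \<otimes> FO F y) \<cdot>
        (Id B (FO F x \<otimes> FO F y) \<odot> Run B \<one>) \<cdot> ?k)"
      using B.run_natural[of "F2 F (x, y)"] by simp
    also have "\<dots> = F2 (Trg ?\<rho>) (x, y) \<cdot> (Cmp ?\<rho> x \<odot> Cmp ?\<rho> y)"
      by (subst B.run_interchange) simp_all
    finally show "Cmp ?\<rho> (x \<otimes>\<^bsub>A\<^esub> y) \<cdot> F2 (Src ?\<rho>) (x, y) =
      F2 (Trg ?\<rho>) (x, y) \<cdot> (Cmp ?\<rho> x \<odot> Cmp ?\<rho> y)" .
  qed (simp_all add: Hom_def assms sm_functor_box_fun sm_functor_unit_fun)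
qed

lemma sm_trans_lun:
  assumes "sm_functor A B F"
  shows "sm_trans A B (Lun (ihom A B) F)"
proof -
  interpret F: sm_fun A B F using assms by (simp add: sm_fun_iff)
  let ?\<rho> = "Lun (ihom A B) F"
  show ?thesis
  proof (rule sm_transI)
    fix f assume [simp]: "f \<in> Arr A"
    show "Cmp ?\<rho> (Cod A f) \<cdot> FA (Src ?\<rho>) f = FA (Trg ?\<rho>) f \<cdot> Cmp ?\<rho> (Dom A f)"
      using B.lun_natural[of "FA F f"] by simp
  next
    have "Cmp ?\<rho> \<one>\<^bsub>A\<^esub> \<cdot> F0 (Src ?\<rho>) =
        (Lun B (FO F \<one>\<^bsub>A\<^esub>) \<cdot> (Id B \<one> \<odot> F0 F)) \<cdot> inv_arr B (Run B \<one>)"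
      by simp
    also have "\<dots> = F0 (Trg ?\<rho>)"
      using B.lun_natural[of "F0 F"] by (simp add: B.lun_unit)
    finally show "Cmp ?\<rho> \<one>\<^bsub>A\<^esub> \<cdot> F0 (Src ?\<rho>) = F0 (Trg ?\<rho>)" .
  next
    fix x y assume [simp]: "x \<in> Obj A" "y \<in> Obj A"
    let ?k = "interchange B \<one> (FO F x) \<one> (FO F y)"
    have "Cmp ?\<rho> (x \<otimes>\<^bsub>A\<^esub> y) \<cdot> F2 (Src ?\<rho>) (x, y) =
      (Lun B (FO F (x \<otimes>\<^bsub>A\<^esub> y)) \<cdot> (Id B \<one> \<odot> F2 F (x, y))) \<cdot>
        (Run B \<one> \<odot> Id B (FO F x \<otimes> FO F y)) \<cdot> ?k"
      by simp
    also have "\<dots> = F2 F (x, y) \<cdot> (Lun B (FO F x \<otimes> FO F y) \<cdot>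
        (Run B \<one> \<odot> Id B (FO F x \<otimes> FO F y)) \<cdot> ?k)"
      using B.lun_natural[of "F2 F (x, y)"] by simp
    also have "\<dots> = F2 (Trg ?\<rho>) (x, y) \<cdot> (Cmp ?\<rho> x \<odot> Cmp ?\<rho> y)"
      by (subst B.lun_interchange) simp_all
    finally show "Cmp ?\<rho> (x \<otimes>\<^bsub>A\<^esub> y) \<cdot> F2 (Src ?\<rho>) (x, y) =
      F2 (Trg ?\<rho>) (x, y) \<cdot> (Cmp ?\<rho> x \<odot> Cmp ?\<rho> y)" .
  qed (simp_all add: Hom_def assms sm_functor_box_fun sm_functor_unit_fun)
qed

lemma sm_trans_sym:
  assumes "sm_functor A B F" "sm_functor A B G"
  shows "sm_trans A B (Sym (ihom A B) F G)"
proof -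
  interpret F: sm_fun A B F using assms by (simp add: sm_fun_iff)
  interpret G: sm_fun A B G using assms by (simp add: sm_fun_iff)
  let ?\<rho> = "Sym (ihom A B) F G"
  show ?thesis
  proof (rule sm_transI)
    fix f assume [simp]: "f \<in> Arr A"
    show "Cmp ?\<rho> (Cod A f) \<cdot> FA (Src ?\<rho>) f = FA (Trg ?\<rho>) f \<cdot> Cmp ?\<rho> (Dom A f)"
      using B.sym_natural[of "FA F f" "FA G f"] by simp
  next
    let ?j = "inv_arr B (Run B \<one>)"
    have "Cmp ?\<rho> \<one>\<^bsub>A\<^esub> \<cdot> F0 (Src ?\<rho>) =
        (Sym B (FO F \<one>\<^bsub>A\<^esub>) (FO G \<one>\<^bsub>A\<^esub>) \<cdot> (F0 F \<odot> F0 G)) \<cdot> ?j"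
      by simp
    also have "\<dots> = F0 (Trg ?\<rho>)"
      by (subst B.sym_natural[of _ _ "\<one>" "\<one>"]) (simp_all add: B.inv_run_unit_sym)
    finally show "Cmp ?\<rho> \<one>\<^bsub>A\<^esub> \<cdot> F0 (Src ?\<rho>) = F0 (Trg ?\<rho>)" .
  next
    fix x y assume [simp]: "x \<in> Obj A" "y \<in> Obj A"
    let ?k = "interchange B (FO F x) (FO G x) (FO F y) (FO G y)"
    have "Cmp ?\<rho> (x \<otimes>\<^bsub>A\<^esub> y) \<cdot> F2 (Src ?\<rho>) (x, y) =
      (Sym B (FO F (x \<otimes>\<^bsub>A\<^esub> y)) (FO G (x \<otimes>\<^bsub>A\<^esub> y)) \<cdot> (F2 F (x, y) \<odot> F2 G (x, y))) \<cdot> ?k"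
      by simp
    also have "\<dots> = (F2 G (x, y) \<odot> F2 F (x, y)) \<cdot>
        (Sym B (FO F x \<otimes> FO F y) (FO G x \<otimes> FO G y) \<cdot> ?k)"
      by (subst B.sym_natural[of _ _ "FO F x \<otimes> FO F y" "FO G x \<otimes> FO G y"]) simp_all
    also have "\<dots> = F2 (Trg ?\<rho>) (x, y) \<cdot> (Cmp ?\<rho> x \<odot> Cmp ?\<rho> y)"
      by (subst B.sym_interchange) simp_all
    finally show "Cmp ?\<rho> (x \<otimes>\<^bsub>A\<^esub> y) \<cdot> F2 (Src ?\<rho>) (x, y) =
      F2 (Trg ?\<rho>) (x, y) \<cdot> (Cmp ?\<rho> x \<odot> Cmp ?\<rho> y)" .
  qed (simp_all add: Hom_def assms sm_functor_box_fun)
qed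

text \<open>
  The inverses of the components of a monoidal transformation are again natural and monoidal.
\<close>

lemma inverse_pair_ihom:
  assumes "sm_trans A B \<sigma>" and iso: "\<And>x. x \<in> Obj A \<Longrightarrow> iso_arr B (Cmp \<sigma> x)"
  shows "inverse_pair (ihom A B) \<sigma> \<lparr> Src = Trg \<sigma>, Trg = Src \<sigma>, Cmp = (\<lambda>x\<in>Obj A. inv_arr B (Cmp \<sigma> x)) \<rparr>"
    (is "inverse_pair _ _ ?\<tau>")
proof -
  interpret \<sigma>: sm_nt A B \<sigma> using assms by (simp add: sm_nt_iff)
  note [simp] = iso
  let ?i = "\<lambda>x. inv_arr B (Cmp \<sigma> x)"
  have "sm_trans A B ?\<tau>"
  proof (rule sm_transI)
    fix f assume [simp]: "f \<in> Arr A"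
    have "Cmp \<sigma> (Cod A f) \<cdot> (FA (Src \<sigma>) f \<cdot> ?i (Dom A f)) = FA (Trg \<sigma>) f"
      by (subst B.comp_reduce[OF \<sigma>.Cmp_natural]) simp_all
    from B.iso_move_left[OF this]
    show "Cmp ?\<tau> (Cod A f) \<cdot> FA (Src ?\<tau>) f = FA (Trg ?\<tau>) f \<cdot> Cmp ?\<tau> (Dom A f)"
      by simp
  next
    show "Cmp ?\<tau> \<one>\<^bsub>A\<^esub> \<cdot> F0 (Src ?\<tau>) = F0 (Trg ?\<tau>)"
      by (simp flip: \<sigma>.Cmp_unit)
  next
    fix x y assume [simp]: "x \<in> Obj A" "y \<in> Obj A"
    have "Cmp \<sigma> (x \<otimes>\<^bsub>A\<^esub> y) \<cdot> (F2 (Src \<sigma>) (x, y) \<cdot> (?i x \<odot> ?i y)) = F2 (Trg \<sigma>) (x, y)"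
      by (subst B.comp_reduce[OF \<sigma>.Cmp_tensor]) simp_all
    from B.iso_move_left[OF this]
    show "Cmp ?\<tau> (x \<otimes>\<^bsub>A\<^esub> y) \<cdot> F2 (Src ?\<tau>) (x, y) =
      F2 (Trg ?\<tau>) (x, y) \<cdot> (Cmp ?\<tau> x \<odot> Cmp ?\<tau> y)"
      by simp
  qed (use \<sigma>.S.sm_functor \<sigma>.T.sm_functor in \<open>simp_all add: Hom_def\<close>)
  then show ?thesis
    using assms(1) by (auto simp: inverse_pair_def Hom_def intro!: restrict_ext)
qed

lemma iso_arr_ihom:
  assumes "sm_trans A B \<sigma>" "\<And>x. x \<in> Obj A \<Longrightarrow> iso_arr B (Cmp \<sigma> x)"
  shows "iso_arr (ihom A B) \<sigma>"
  using inverse_pair_ihom assms unfolding iso_arr_def by blast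

text \<open>
  All axioms hold because they hold at each object of \<open>A\<close>; what has to be shown in addition is that
  the structure isomorphisms are monoidal.
\<close>

theorem sm_category_ihom: "sm_category (ihom A B)"
proof -
  let ?H = "ihom A B"
  have cat: "category ?H"
    unfolding category_def
  proof (intro conjI ballI impI)
    fix \<sigma> assume "\<sigma> \<in> Arr ?H"
    then interpret \<sigma>: sm_nt A B \<sigma> by (simp add: sm_nt_iff)
    show "Dom ?H \<sigma> \<in> Obj ?H" "Cod ?H \<sigma> \<in> Obj ?H"
      by (simp_all add: \<sigma>.S.sm_functor \<sigma>.T.sm_functor)
    show "\<sigma> \<cdot>\<^bsub>?H\<^esub> Id ?H (Dom ?H \<sigma>) = \<sigma>" "Id ?H (Cod ?H \<sigma>) \<cdot>\<^bsub>?H\<^esub> \<sigma> = \<sigma>"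
      by (auto intro!: smtrans_eqI[where X = "Obj A"])
    fix \<tau> assume "\<tau> \<in> Arr ?H"
    then interpret \<tau>: sm_nt A B \<tau> by (simp add: sm_nt_iff)
    assume 1: "Cod ?H \<sigma> = Dom ?H \<tau>"
    then show "\<tau> \<cdot>\<^bsub>?H\<^esub> \<sigma> \<in> Hom ?H (Dom ?H \<sigma>) (Cod ?H \<tau>)"
      using sm_trans_comp[OF \<sigma>.sm_trans \<tau>.sm_trans] by (simp add: Hom_def)
    fix \<rho> assume "\<rho> \<in> Arr ?H"
    then interpret \<rho>: sm_nt A B \<rho> by (simp add: sm_nt_iff)
    assume 2: "Cod ?H \<tau> = Dom ?H \<rho>"
    show "(\<rho> \<cdot>\<^bsub>?H\<^esub> \<tau>) \<cdot>\<^bsub>?H\<^esub> \<sigma> = \<rho> \<cdot>\<^bsub>?H\<^esub> \<tau> \<cdot>\<^bsub>?H\<^esub> \<sigma>"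
      using 1 2 by (auto intro!: restrict_ext)
  qed (use sm_trans_id in \<open>simp_all add: Hom_def\<close>)
  have ten: "tensor_bifunctor ?H"
    unfolding tensor_bifunctor_def
  proof (intro conjI ballI impI)
    fix F G assume "F \<in> Obj ?H" "G \<in> Obj ?H"
    then interpret F: sm_fun A B F + G: sm_fun A B G by (simp_all add: sm_fun_iff)
    show "F \<otimes>\<^bsub>?H\<^esub> G \<in> Obj ?H"
      by (simp add: sm_functor_box_fun F.sm_functor G.sm_functor)
    show "Id ?H F \<odot>\<^bsub>?H\<^esub> Id ?H G = Id ?H (F \<otimes>\<^bsub>?H\<^esub> G)"
      by (auto intro!: smtrans_eqI[where X = "Obj A"])
  next
    fix \<sigma> \<tau> assume "\<sigma> \<in> Arr ?H" "\<tau> \<in> Arr ?H"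
    then show "\<sigma> \<odot>\<^bsub>?H\<^esub> \<tau> \<in> Hom ?H (Dom ?H \<sigma> \<otimes>\<^bsub>?H\<^esub> Dom ?H \<tau>)
        (Cod ?H \<sigma> \<otimes>\<^bsub>?H\<^esub> Cod ?H \<tau>)"
      by (simp add: Hom_def sm_trans_box)
  next
    fix \<sigma> \<sigma>' \<tau> \<tau>'
    assume "\<sigma> \<in> Arr ?H" "\<sigma>' \<in> Arr ?H" "\<tau> \<in> Arr ?H" "\<tau>' \<in> Arr ?H"
    then interpret \<sigma>: sm_nt A B \<sigma> + \<sigma>': sm_nt A B \<sigma>' + \<tau>: sm_nt A B \<tau> + \<tau>': sm_nt A B \<tau>'
      by (simp_all add: sm_nt_iff)
    assume "Cod ?H \<sigma> = Dom ?H \<sigma>'" "Cod ?H \<tau> = Dom ?H \<tau>'"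
    then show "(\<sigma>' \<cdot>\<^bsub>?H\<^esub> \<sigma>) \<odot>\<^bsub>?H\<^esub> (\<tau>' \<cdot>\<^bsub>?H\<^esub> \<tau>) =
        (\<sigma>' \<odot>\<^bsub>?H\<^esub> \<tau>') \<cdot>\<^bsub>?H\<^esub> (\<sigma> \<odot>\<^bsub>?H\<^esub> \<tau>)"
      by (auto intro!: smtrans_eqI[where X = "Obj A"])
  qed
  have iso: "structure_isos ?H"
    unfolding structure_isos_def
  proof (intro conjI ballI impI)
    fix F assume "F \<in> Obj ?H"
    then interpret F: sm_fun A B F by (simp_all add: sm_fun_iff)
    note r = sm_trans_run[OF F.sm_functor] and l = sm_trans_lun[OF F.sm_functor]
    show "iso_arr ?H (Run ?H F)" "iso_arr ?H (Lun ?H F)"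
      using iso_arr_ihom[OF r] iso_arr_ihom[OF l] by simp_all
    show "Run ?H F \<in> Hom ?H (F \<otimes>\<^bsub>?H\<^esub> \<one>\<^bsub>?H\<^esub>) F"
      "Lun ?H F \<in> Hom ?H (\<one>\<^bsub>?H\<^esub> \<otimes>\<^bsub>?H\<^esub> F) F"
      using r l by (simp_all add: Hom_def)
    fix G assume "G \<in> Obj ?H"
    then interpret G: sm_fun A B G by (simp_all add: sm_fun_iff)
    note s = sm_trans_sym[OF F.sm_functor G.sm_functor]
    show "iso_arr ?H (Sym ?H F G)"
      using iso_arr_ihom[OF s] by simp
    show "Sym ?H F G \<in> Hom ?H (F \<otimes>\<^bsub>?H\<^esub> G) (G \<otimes>\<^bsub>?H\<^esub> F)"
      using s by (simp add: Hom_def)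
    fix H assume "H \<in> Obj ?H"
    then interpret H: sm_fun A B H by (simp_all add: sm_fun_iff)
    note a = sm_trans_ass[OF F.sm_functor G.sm_functor H.sm_functor]
    show "iso_arr ?H (Ass ?H F G H)"
      using iso_arr_ihom[OF a] by simp
    show "Ass ?H F G H \<in> Hom ?H (F \<otimes>\<^bsub>?H\<^esub> (G \<otimes>\<^bsub>?H\<^esub> H)) ((F \<otimes>\<^bsub>?H\<^esub> G) \<otimes>\<^bsub>?H\<^esub> H)"
      using a by (simp add: Hom_def)
  next
    fix \<sigma> assume "\<sigma> \<in> Arr ?H"
    then interpret \<sigma>: sm_nt A B \<sigma> by (simp add: sm_nt_iff)
    show "Run ?H (Cod ?H \<sigma>) \<cdot>\<^bsub>?H\<^esub> (\<sigma> \<odot>\<^bsub>?H\<^esub> Id ?H \<one>\<^bsub>?H\<^esub>) =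
        \<sigma> \<cdot>\<^bsub>?H\<^esub> Run ?H (Dom ?H \<sigma>)"
      using B.run_natural[OF \<sigma>.Cmp_arr(1)] by (auto intro!: smtrans_eqI[where X = "Obj A"])
    show "Lun ?H (Cod ?H \<sigma>) \<cdot>\<^bsub>?H\<^esub> (Id ?H \<one>\<^bsub>?H\<^esub> \<odot>\<^bsub>?H\<^esub> \<sigma>) =
        \<sigma> \<cdot>\<^bsub>?H\<^esub> Lun ?H (Dom ?H \<sigma>)"
      using B.lun_natural[OF \<sigma>.Cmp_arr(1)] by (auto intro!: smtrans_eqI[where X = "Obj A"])
    fix \<tau> assume "\<tau> \<in> Arr ?H"
    then interpret \<tau>: sm_nt A B \<tau> by (simp add: sm_nt_iff)
    show "Sym ?H (Cod ?H \<sigma>) (Cod ?H \<tau>) \<cdot>\<^bsub>?H\<^esub> (\<sigma> \<odot>\<^bsub>?H\<^esub> \<tau>) =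
        (\<tau> \<odot>\<^bsub>?H\<^esub> \<sigma>) \<cdot>\<^bsub>?H\<^esub> Sym ?H (Dom ?H \<sigma>) (Dom ?H \<tau>)"
      using B.sym_natural[OF \<sigma>.Cmp_arr(1) \<tau>.Cmp_arr(1)] by (auto intro!: smtrans_eqI[where X = "Obj A"])
    fix \<rho> assume "\<rho> \<in> Arr ?H"
    then interpret \<rho>: sm_nt A B \<rho> by (simp add: sm_nt_iff)
    show "Ass ?H (Cod ?H \<sigma>) (Cod ?H \<tau>) (Cod ?H \<rho>) \<cdot>\<^bsub>?H\<^esub> (\<sigma> \<odot>\<^bsub>?H\<^esub> (\<tau> \<odot>\<^bsub>?H\<^esub> \<rho>)) =
        ((\<sigma> \<odot>\<^bsub>?H\<^esub> \<tau>) \<odot>\<^bsub>?H\<^esub> \<rho>) \<cdot>\<^bsub>?H\<^esub>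
          Ass ?H (Dom ?H \<sigma>) (Dom ?H \<tau>) (Dom ?H \<rho>)"
      using B.ass_natural[OF \<sigma>.Cmp_arr(1) \<tau>.Cmp_arr(1) \<rho>.Cmp_arr(1)]
      by (auto intro!: smtrans_eqI[where X = "Obj A"])
  qed
  have coh: "coherence_axioms ?H"
    unfolding coherence_axioms_def
  proof (intro conjI ballI impI)
    fix F assume "F \<in> Obj ?H"
    then interpret F: sm_fun A B F by (simp_all add: sm_fun_iff)
    show "Lun ?H F \<cdot>\<^bsub>?H\<^esub> Sym ?H F \<one>\<^bsub>?H\<^esub> = Run ?H F"
      by (auto intro!: smtrans_eqI[where X = "Obj A"] simp: B.sym_unit)
    fix G assume "G \<in> Obj ?H"
    then interpret G: sm_fun A B G by (simp_all add: sm_fun_iff)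
    show "(Run ?H F \<odot>\<^bsub>?H\<^esub> Id ?H G) \<cdot>\<^bsub>?H\<^esub> Ass ?H F \<one>\<^bsub>?H\<^esub> G =
        Id ?H F \<odot>\<^bsub>?H\<^esub> Lun ?H G"
      by (auto intro!: smtrans_eqI[where X = "Obj A"] simp: B.triangle)
    show "Sym ?H G F \<cdot>\<^bsub>?H\<^esub> Sym ?H F G = Id ?H (F \<otimes>\<^bsub>?H\<^esub> G)"
      by (auto intro!: smtrans_eqI[where X = "Obj A"] simp: B.sym_sym)
    fix H assume "H \<in> Obj ?H"
    then interpret H: sm_fun A B H by (simp_all add: sm_fun_iff)
    show "Ass ?H H F G \<cdot>\<^bsub>?H\<^esub> Sym ?H (F \<otimes>\<^bsub>?H\<^esub> G) H \<cdot>\<^bsub>?H\<^esub> Ass ?H F G H =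
        (Sym ?H F H \<odot>\<^bsub>?H\<^esub> Id ?H G) \<cdot>\<^bsub>?H\<^esub>
          Ass ?H F H G \<cdot>\<^bsub>?H\<^esub> (Id ?H F \<odot>\<^bsub>?H\<^esub> Sym ?H G H)"
      by (auto intro!: smtrans_eqI[where X = "Obj A"] simp: B.hexagon)
    fix K assume "K \<in> Obj ?H"
    then interpret K: sm_fun A B K by (simp_all add: sm_fun_iff)
    show "Ass ?H (F \<otimes>\<^bsub>?H\<^esub> G) H K \<cdot>\<^bsub>?H\<^esub> Ass ?H F G (H \<otimes>\<^bsub>?H\<^esub> K) =
        (Ass ?H F G H \<odot>\<^bsub>?H\<^esub> Id ?H K) \<cdot>\<^bsub>?H\<^esub>
          Ass ?H F (G \<otimes>\<^bsub>?H\<^esub> H) K \<cdot>\<^bsub>?H\<^esub> (Id ?H F \<odot>\<^bsub>?H\<^esub> Ass ?H G H K)"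
      by (auto intro!: smtrans_eqI[where X = "Obj A"] simp: B.pentagon)
  qed
  show ?thesis
    using cat ten iso coh by (simp add: sm_category_def sm_functor_unit_fun)
qed

end

section \<open>Composition and whiskering\<close>

lemma sm_funI: "sm_category A \<Longrightarrow> sm_category B \<Longrightarrow> sm_functor A B F \<Longrightarrow> sm_fun A B F"
  by (simp add: sm_fun_def sm_fun_axioms_def smc_pair_def smc_def)

lemma sm_ntI: "sm_category A \<Longrightarrow> sm_category B \<Longrightarrow> sm_trans A B \<sigma> \<Longrightarrow> sm_nt A B \<sigma>"
  by (simp add: sm_nt_def sm_nt_axioms_def smc_pair_def smc_def)

context sm_fun
begin

lemma F2_natural':
  assumes "f \<in> Arr A" "g \<in> Arr A" "Dom A f = x" "Cod A f = x'" "Dom A g = y" "Cod A g = y'"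
  shows "F2 F (x', y') \<cdot> (FA F f \<odot> FA F g) = FA F (f \<odot>\<^bsub>A\<^esub> g) \<cdot> F2 F (x, y)"
  using F2_natural[of f g] assms by simp

lemma F2_natural_id:
  assumes "f \<in> Arr A" "Dom A f = x" "Cod A f = x'" "y \<in> Obj A"
  shows "F2 F (x', y) \<cdot> (FA F f \<odot> Id B (FO F y)) = FA F (f \<odot>\<^bsub>A\<^esub> Id A y) \<cdot> F2 F (x, y)"
    "F2 F (y, x') \<cdot> (Id B (FO F y) \<odot> FA F f) = FA F (Id A y \<odot>\<^bsub>A\<^esub> f) \<cdot> F2 F (y, x)"
  using F2_natural'[of f "Id A y" x x' y y] F2_natural'[of "Id A y" f y y x x'] assms by auto

text \<open>
  The unit axiom at the unit object, with \<open>F\<^sup>0\<close> in both arguments; this form relates \<open>F\<^sup>2\<close> to the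
  isomorphism \<open>I \<cong> I \<otimes> I\<close> in the structure of a tensor product of functors.
\<close>

lemma F_run_unit:
  "FA F (Run A \<one>\<^bsub>A\<^esub>) \<cdot> F2 F (\<one>\<^bsub>A\<^esub>, \<one>\<^bsub>A\<^esub>) \<cdot> (F0 F \<odot> F0 F) = F0 F \<cdot> Run B \<one>"
proof -
  have "FA F (Run A \<one>\<^bsub>A\<^esub>) \<cdot> F2 F (\<one>\<^bsub>A\<^esub>, \<one>\<^bsub>A\<^esub>) \<cdot> (F0 F \<odot> F0 F) =
    (FA F (Run A \<one>\<^bsub>A\<^esub>) \<cdot> F2 F (\<one>\<^bsub>A\<^esub>, \<one>\<^bsub>A\<^esub>) \<cdot> (Id B (FO F \<one>\<^bsub>A\<^esub>) \<odot> F0 F)) \<cdot>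
      (F0 F \<odot> Id B \<one>)"
    by simp
  also have "\<dots> = F0 F \<cdot> Run B \<one>"
    using B.run_natural[of "F0 F"] by (simp add: F_run)
  finally show ?thesis .
qed

lemma F_unit_unit: "F2 F (\<one>\<^bsub>A\<^esub>, \<one>\<^bsub>A\<^esub>) \<cdot> (F0 F \<odot> F0 F) =
    FA F (inv_arr A (Run A \<one>\<^bsub>A\<^esub>)) \<cdot> F0 F \<cdot> Run B \<one>"
  using B.iso_move_left[OF F_run_unit] by (simp add: FA_iso)

end

lemma comp_fun_simps [simp]:
  "x \<in> Obj A \<Longrightarrow> FO (comp_fun A C G F) x = FO G (FO F x)"
  "f \<in> Arr A \<Longrightarrow> FA (comp_fun A C G F) f = FA G (FA F f)"
  "F0 (comp_fun A C G F) = FA G (F0 F) \<cdot>\<^bsub>C\<^esub> F0 G"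
  "x \<in> Obj A \<Longrightarrow> y \<in> Obj A \<Longrightarrow>
     F2 (comp_fun A C G F) (x, y) = FA G (F2 F (x, y)) \<cdot>\<^bsub>C\<^esub> F2 G (FO F x, FO F y)"
  "FO (comp_fun A C G F) \<in> extensional (Obj A)"
  "FA (comp_fun A C G F) \<in> extensional (Arr A)"
  "F2 (comp_fun A C G F) \<in> extensional (Obj A \<times> Obj A)"
  by (auto simp: comp_fun_def)

lemma whisker_l_simps [simp]:
  "Src (whisker_l A C F \<theta>) = comp_fun A C F (Src \<theta>)"
  "Trg (whisker_l A C F \<theta>) = comp_fun A C F (Trg \<theta>)"
  "Cmp (whisker_l A C F \<theta>) = (\<lambda>x\<in>Obj A. FA F (Cmp \<theta> x))"
  by (simp_all add: whisker_l_def)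

lemma whisker_r_simps [simp]:
  "Src (whisker_r A C \<theta> G) = comp_fun A C (Src \<theta>) G"
  "Trg (whisker_r A C \<theta> G) = comp_fun A C (Trg \<theta>) G"
  "Cmp (whisker_r A C \<theta> G) = (\<lambda>x\<in>Obj A. Cmp \<theta> (FO G x))"
  by (simp_all add: whisker_r_def)

lemma sm_functor_comp_fun:
  assumes "sm_category A" "sm_category B" "sm_category C" "sm_functor A B F" "sm_functor B C G"
  shows "sm_functor A C (comp_fun A C G F)"
proof -
  interpret F: sm_fun A B F using assms by (intro sm_funI)
  interpret G: sm_fun B C G using assms by (intro sm_funI)
  let ?H = "comp_fun A C G F"
  show ?thesis
  proof (rule sm_functorI)
    fix f g assume [simp]: "f \<in> Arr A" "g \<in> Arr A"
    have "F2 ?H (Cod A f, Cod A g) \<cdot>\<^bsub>C\<^esub> (FA ?H f \<odot>\<^bsub>C\<^esub> FA ?H g) = FA G (F2 F (Cod A f, Cod A g)) \<cdot>\<^bsub>C\<^esub>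
        (F2 G (FO F (Cod A f), FO F (Cod A g)) \<cdot>\<^bsub>C\<^esub> (FA G (FA F f) \<odot>\<^bsub>C\<^esub> FA G (FA F g)))"
      by simp
    also have "\<dots> = FA G (F2 F (Cod A f, Cod A g) \<cdot>\<^bsub>B\<^esub> (FA F f \<odot>\<^bsub>B\<^esub> FA F g)) \<cdot>\<^bsub>C\<^esub>
        F2 G (FO F (Dom A f), FO F (Dom A g))"
      by (subst G.F2_natural'[of _ _ "FO F (Dom A f)" _ "FO F (Dom A g)"]) simp_all
    also have "\<dots> = FA ?H (f \<odot>\<^bsub>A\<^esub> g) \<cdot>\<^bsub>C\<^esub> F2 ?H (Dom A f, Dom A g)"
      by (simp add: F.F2_natural)
    finally show "F2 ?H (Cod A f, Cod A g) \<cdot>\<^bsub>C\<^esub> (FA ?H f \<odot>\<^bsub>C\<^esub> FA ?H g) =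
      FA ?H (f \<odot>\<^bsub>A\<^esub> g) \<cdot>\<^bsub>C\<^esub> F2 ?H (Dom A f, Dom A g)" .
  next
    fix x y z assume [simp]: "x \<in> Obj A" "y \<in> Obj A" "z \<in> Obj A"
    let ?w = "y \<otimes>\<^bsub>A\<^esub> z" and ?v = "x \<otimes>\<^bsub>A\<^esub> y"
    let ?x = "FO F x" and ?y = "FO F y" and ?z = "FO F z"
    have "FA ?H (Ass A x y z) \<cdot>\<^bsub>C\<^esub> F2 ?H (x, ?w) \<cdot>\<^bsub>C\<^esub> (Id C (FO ?H x) \<odot>\<^bsub>C\<^esub> F2 ?H (y, z)) =
      FA G (FA F (Ass A x y z)) \<cdot>\<^bsub>C\<^esub> FA G (F2 F (x, ?w)) \<cdot>\<^bsub>C\<^esub>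
        (F2 G (?x, FO F ?w) \<cdot>\<^bsub>C\<^esub> (Id C (FO G ?x) \<odot>\<^bsub>C\<^esub> FA G (F2 F (y, z)))) \<cdot>\<^bsub>C\<^esub>
        (Id C (FO G ?x) \<odot>\<^bsub>C\<^esub> F2 G (?y, ?z))"
      by simp
    also have "\<dots> = FA G (FA F (Ass A x y z) \<cdot>\<^bsub>B\<^esub> F2 F (x, ?w) \<cdot>\<^bsub>B\<^esub> (Id B ?x \<odot>\<^bsub>B\<^esub> F2 F (y, z))) \<cdot>\<^bsub>C\<^esub>
        F2 G (?x, ?y \<otimes>\<^bsub>B\<^esub> ?z) \<cdot>\<^bsub>C\<^esub> (Id C (FO G ?x) \<odot>\<^bsub>C\<^esub> F2 G (?y, ?z))"
      by (subst G.F2_natural_id(2)[of _ "?y \<otimes>\<^bsub>B\<^esub> ?z"]) simp_all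
    also have "\<dots> = FA G (F2 F (?v, z)) \<cdot>\<^bsub>C\<^esub> FA G (F2 F (x, y) \<odot>\<^bsub>B\<^esub> Id B ?z) \<cdot>\<^bsub>C\<^esub>
        (FA G (Ass B ?x ?y ?z) \<cdot>\<^bsub>C\<^esub> F2 G (?x, ?y \<otimes>\<^bsub>B\<^esub> ?z) \<cdot>\<^bsub>C\<^esub> (Id C (FO G ?x) \<odot>\<^bsub>C\<^esub> F2 G (?y, ?z)))"
      by (simp add: F.F_ass)
    also have "\<dots> = FA G (F2 F (?v, z)) \<cdot>\<^bsub>C\<^esub> (FA G (F2 F (x, y) \<odot>\<^bsub>B\<^esub> Id B ?z) \<cdot>\<^bsub>C\<^esub>
        F2 G (?x \<otimes>\<^bsub>B\<^esub> ?y, ?z)) \<cdot>\<^bsub>C\<^esub> (F2 G (?x, ?y) \<odot>\<^bsub>C\<^esub> Id C (FO G ?z)) \<cdot>\<^bsub>C\<^esub>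
        Ass C (FO G ?x) (FO G ?y) (FO G ?z)"
      by (simp add: G.F_ass)
    also have "\<dots> = F2 ?H (?v, z) \<cdot>\<^bsub>C\<^esub> (F2 ?H (x, y) \<odot>\<^bsub>C\<^esub> Id C (FO ?H z)) \<cdot>\<^bsub>C\<^esub>
        Ass C (FO ?H x) (FO ?H y) (FO ?H z)"
      by (subst G.F2_natural_id(1)[symmetric, where x' = "FO F ?v"]) simp_all
    finally show "FA ?H (Ass A x y z) \<cdot>\<^bsub>C\<^esub> F2 ?H (x, ?w) \<cdot>\<^bsub>C\<^esub> (Id C (FO ?H x) \<odot>\<^bsub>C\<^esub> F2 ?H (y, z)) =
        F2 ?H (?v, z) \<cdot>\<^bsub>C\<^esub> (F2 ?H (x, y) \<odot>\<^bsub>C\<^esub> Id C (FO ?H z)) \<cdot>\<^bsub>C\<^esub>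
        Ass C (FO ?H x) (FO ?H y) (FO ?H z)" .
  next
    fix x assume [simp]: "x \<in> Obj A"
    let ?x = "FO F x" and ?I = "FO F \<one>\<^bsub>A\<^esub>"
    have "FA ?H (Run A x) \<cdot>\<^bsub>C\<^esub> F2 ?H (x, \<one>\<^bsub>A\<^esub>) \<cdot>\<^bsub>C\<^esub> (Id C (FO ?H x) \<odot>\<^bsub>C\<^esub> F0 ?H) =
        FA G (FA F (Run A x)) \<cdot>\<^bsub>C\<^esub> FA G (F2 F (x, \<one>\<^bsub>A\<^esub>)) \<cdot>\<^bsub>C\<^esub>
        (F2 G (?x, ?I) \<cdot>\<^bsub>C\<^esub> (Id C (FO G ?x) \<odot>\<^bsub>C\<^esub> FA G (F0 F))) \<cdot>\<^bsub>C\<^esub> (Id C (FO G ?x) \<odot>\<^bsub>C\<^esub> F0 G)"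
      by simp
    also have "\<dots> = FA G (FA F (Run A x) \<cdot>\<^bsub>B\<^esub> F2 F (x, \<one>\<^bsub>A\<^esub>) \<cdot>\<^bsub>B\<^esub> (Id B ?x \<odot>\<^bsub>B\<^esub> F0 F)) \<cdot>\<^bsub>C\<^esub>
        F2 G (?x, \<one>\<^bsub>B\<^esub>) \<cdot>\<^bsub>C\<^esub> (Id C (FO G ?x) \<odot>\<^bsub>C\<^esub> F0 G)"
      by (subst G.F2_natural_id(2)[of _ "\<one>\<^bsub>B\<^esub>"]) simp_all
    also have "\<dots> = Run C (FO ?H x)"
      by (simp add: F.F_run G.F_run)
    finally show "FA ?H (Run A x) \<cdot>\<^bsub>C\<^esub> F2 ?H (x, \<one>\<^bsub>A\<^esub>) \<cdot>\<^bsub>C\<^esub> (Id C (FO ?H x) \<odot>\<^bsub>C\<^esub> F0 ?H) = Run C (FO ?H x)" .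
    have "FA ?H (Lun A x) \<cdot>\<^bsub>C\<^esub> F2 ?H (\<one>\<^bsub>A\<^esub>, x) \<cdot>\<^bsub>C\<^esub> (F0 ?H \<odot>\<^bsub>C\<^esub> Id C (FO ?H x)) =
        FA G (FA F (Lun A x)) \<cdot>\<^bsub>C\<^esub> FA G (F2 F (\<one>\<^bsub>A\<^esub>, x)) \<cdot>\<^bsub>C\<^esub>
        (F2 G (?I, ?x) \<cdot>\<^bsub>C\<^esub> (FA G (F0 F) \<odot>\<^bsub>C\<^esub> Id C (FO G ?x))) \<cdot>\<^bsub>C\<^esub> (F0 G \<odot>\<^bsub>C\<^esub> Id C (FO G ?x))"
      by simp
    also have "\<dots> = FA G (FA F (Lun A x) \<cdot>\<^bsub>B\<^esub> F2 F (\<one>\<^bsub>A\<^esub>, x) \<cdot>\<^bsub>B\<^esub> (F0 F \<odot>\<^bsub>B\<^esub> Id B ?x)) \<cdot>\<^bsub>C\<^esub>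
        F2 G (\<one>\<^bsub>B\<^esub>, ?x) \<cdot>\<^bsub>C\<^esub> (F0 G \<odot>\<^bsub>C\<^esub> Id C (FO G ?x))"
      by (subst G.F2_natural_id(1)[of _ "\<one>\<^bsub>B\<^esub>"]) simp_all
    also have "\<dots> = Lun C (FO ?H x)"
      by (simp add: F.F_lun G.F_lun)
    finally show "FA ?H (Lun A x) \<cdot>\<^bsub>C\<^esub> F2 ?H (\<one>\<^bsub>A\<^esub>, x) \<cdot>\<^bsub>C\<^esub> (F0 ?H \<odot>\<^bsub>C\<^esub> Id C (FO ?H x)) = Lun C (FO ?H x)" .
  next
    fix x y assume [simp]: "x \<in> Obj A" "y \<in> Obj A"
    let ?x = "FO F x" and ?y = "FO F y"
    have "FA ?H (Sym A x y) \<cdot>\<^bsub>C\<^esub> F2 ?H (x, y) = FA G (FA F (Sym A x y) \<cdot>\<^bsub>B\<^esub> F2 F (x, y)) \<cdot>\<^bsub>C\<^esub> F2 G (?x, ?y)"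
      by simp
    also have "\<dots> = FA G (F2 F (y, x)) \<cdot>\<^bsub>C\<^esub> (FA G (Sym B ?x ?y) \<cdot>\<^bsub>C\<^esub> F2 G (?x, ?y))"
      by (simp add: F.F_sym)
    also have "\<dots> = F2 ?H (y, x) \<cdot>\<^bsub>C\<^esub> Sym C (FO ?H x) (FO ?H y)"
      by (simp add: G.F_sym)
    finally show "FA ?H (Sym A x y) \<cdot>\<^bsub>C\<^esub> F2 ?H (x, y) = F2 ?H (y, x) \<cdot>\<^bsub>C\<^esub> Sym C (FO ?H x) (FO ?H y)" .
  qed (simp_all add: Hom_def)
qed

lemma sm_trans_whisker_l:
  assumes "sm_category A" "sm_category B" "sm_category C" "sm_trans A B \<theta>" "sm_functor B C F"
  shows "sm_trans A C (whisker_l A C F \<theta>)"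
proof -
  let ?\<rho> = "whisker_l A C F \<theta>"
  interpret \<theta>: sm_nt A B \<theta> using assms by (intro sm_ntI)
  interpret F: sm_fun B C F using assms by (intro sm_funI)
  show ?thesis
  proof (rule sm_transI)
    show "sm_functor A C (Src ?\<rho>)" "sm_functor A C (Trg ?\<rho>)"
      using assms \<theta>.S.sm_functor \<theta>.T.sm_functor by (simp_all add: sm_functor_comp_fun[of A B C])
    have "Cmp ?\<rho> \<one>\<^bsub>A\<^esub> \<cdot>\<^bsub>C\<^esub> F0 (Src ?\<rho>) =
        FA F (Cmp \<theta> \<one>\<^bsub>A\<^esub> \<cdot>\<^bsub>B\<^esub> F0 (Src \<theta>)) \<cdot>\<^bsub>C\<^esub> F0 F"
      by simp
    then show "Cmp ?\<rho> \<one>\<^bsub>A\<^esub> \<cdot>\<^bsub>C\<^esub> F0 (Src ?\<rho>) = F0 (Trg ?\<rho>)"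
      by (simp only: \<theta>.Cmp_unit) simp
  next
    fix f assume [simp]: "f \<in> Arr A"
    show "Cmp ?\<rho> (Cod A f) \<cdot>\<^bsub>C\<^esub> FA (Src ?\<rho>) f =
        FA (Trg ?\<rho>) f \<cdot>\<^bsub>C\<^esub> Cmp ?\<rho> (Dom A f)"
      by (simp add: \<theta>.Cmp_natural flip: F.FA_comp)
  next
    fix x y assume [simp]: "x \<in> Obj A" "y \<in> Obj A"
    have "Cmp ?\<rho> (x \<otimes>\<^bsub>A\<^esub> y) \<cdot>\<^bsub>C\<^esub> F2 (Src ?\<rho>) (x, y) =
      FA F (Cmp \<theta> (x \<otimes>\<^bsub>A\<^esub> y) \<cdot>\<^bsub>B\<^esub> F2 (Src \<theta>) (x, y)) \<cdot>\<^bsub>C\<^esub> F2 F (FO (Src \<theta>) x, FO (Src \<theta>) y)"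
      by simp
    also have "\<dots> = FA F (F2 (Trg \<theta>) (x, y)) \<cdot>\<^bsub>C\<^esub>
        (FA F (Cmp \<theta> x \<odot>\<^bsub>B\<^esub> Cmp \<theta> y) \<cdot>\<^bsub>C\<^esub> F2 F (FO (Src \<theta>) x, FO (Src \<theta>) y))"
      by (simp add: \<theta>.Cmp_tensor)
    also have "\<dots> = F2 (Trg ?\<rho>) (x, y) \<cdot>\<^bsub>C\<^esub>
        (Cmp ?\<rho> x \<odot>\<^bsub>C\<^esub> Cmp ?\<rho> y)"
      by (subst F.F2_natural'[symmetric, where x' = "FO (Trg \<theta>) x" and y' = "FO (Trg \<theta>) y"]) simp_all
    finally show "Cmp ?\<rho> (x \<otimes>\<^bsub>A\<^esub> y) \<cdot>\<^bsub>C\<^esub> F2 (Src ?\<rho>) (x, y) =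
      F2 (Trg ?\<rho>) (x, y) \<cdot>\<^bsub>C\<^esub>
        (Cmp ?\<rho> x \<odot>\<^bsub>C\<^esub> Cmp ?\<rho> y)" .
  qed (simp_all add: Hom_def)
qed

lemma sm_trans_whisker_r:
  assumes "sm_category A" "sm_category B" "sm_category C" "sm_functor A B G" "sm_trans B C \<theta>"
  shows "sm_trans A C (whisker_r A C \<theta> G)"
proof -
  interpret \<theta>: sm_nt B C \<theta> using assms by (intro sm_ntI)
  interpret G: sm_fun A B G using assms by (intro sm_funI)
  let ?\<rho> = "whisker_r A C \<theta> G"
  show ?thesis
  proof (rule sm_transI)
    show "sm_functor A C (Src ?\<rho>)" "sm_functor A C (Trg ?\<rho>)"
      using assms \<theta>.S.sm_functor \<theta>.T.sm_functor by (simp_all add: sm_functor_comp_fun[of A B C])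
    have "Cmp ?\<rho> \<one>\<^bsub>A\<^esub> \<cdot>\<^bsub>C\<^esub> F0 (Src ?\<rho>) = (Cmp \<theta> (FO G \<one>\<^bsub>A\<^esub>) \<cdot>\<^bsub>C\<^esub> FA (Src \<theta>) (F0 G)) \<cdot>\<^bsub>C\<^esub> F0 (Src \<theta>)"
      by simp
    also have "\<dots> = F0 (Trg ?\<rho>)"
      using \<theta>.Cmp_natural[of "F0 G"] by (simp add: \<theta>.Cmp_unit)
    finally show "Cmp ?\<rho> \<one>\<^bsub>A\<^esub> \<cdot>\<^bsub>C\<^esub> F0 (Src ?\<rho>) = F0 (Trg ?\<rho>)" .
  next
    fix f assume [simp]: "f \<in> Arr A"
    show "Cmp ?\<rho> (Cod A f) \<cdot>\<^bsub>C\<^esub> FA (Src ?\<rho>) f = FA (Trg ?\<rho>) f \<cdot>\<^bsub>C\<^esub> Cmp ?\<rho> (Dom A f)"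
      using \<theta>.Cmp_natural[of "FA G f"] by simp
  next
    fix x y assume [simp]: "x \<in> Obj A" "y \<in> Obj A"
    have "Cmp ?\<rho> (x \<otimes>\<^bsub>A\<^esub> y) \<cdot>\<^bsub>C\<^esub> F2 (Src ?\<rho>) (x, y) =
      (Cmp \<theta> (FO G (x \<otimes>\<^bsub>A\<^esub> y)) \<cdot>\<^bsub>C\<^esub> FA (Src \<theta>) (F2 G (x, y))) \<cdot>\<^bsub>C\<^esub> F2 (Src \<theta>) (FO G x, FO G y)"
      by simp
    also have "\<dots> = F2 (Trg ?\<rho>) (x, y) \<cdot>\<^bsub>C\<^esub> (Cmp ?\<rho> x \<odot>\<^bsub>C\<^esub> Cmp ?\<rho> y)"
      using \<theta>.Cmp_natural[of "F2 G (x, y)"] by (simp add: \<theta>.Cmp_tensor)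
    finally show "Cmp ?\<rho> (x \<otimes>\<^bsub>A\<^esub> y) \<cdot>\<^bsub>C\<^esub> F2 (Src ?\<rho>) (x, y) =
      F2 (Trg ?\<rho>) (x, y) \<cdot>\<^bsub>C\<^esub> (Cmp ?\<rho> x \<odot>\<^bsub>C\<^esub> Cmp ?\<rho> y)" .
  qed (simp_all add: Hom_def)
qed

section \<open>Pre- and postcomposition\<close>

lemma sm_functor_strict_fun:
  assumes X: "sm_category X" and Y: "sm_category Y"
    and fo: "\<And>x. x \<in> Obj X \<Longrightarrow> fo x \<in> Obj Y"
    and fa: "\<And>f. f \<in> Arr X \<Longrightarrow> fa f \<in> Hom Y (fo (Dom X f)) (fo (Cod X f))"
    and id: "\<And>x. x \<in> Obj X \<Longrightarrow> fa (Id X x) = Id Y (fo x)"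
    and comp: "\<And>f g. \<lbrakk>f \<in> Arr X; g \<in> Arr X; Cod X f = Dom X g\<rbrakk> \<Longrightarrow> fa (g \<cdot>\<^bsub>X\<^esub> f) = fa g \<cdot>\<^bsub>Y\<^esub> fa f"
    and unit: "fo \<one>\<^bsub>X\<^esub> = \<one>\<^bsub>Y\<^esub>"
    and tob: "\<And>x y. \<lbrakk>x \<in> Obj X; y \<in> Obj X\<rbrakk> \<Longrightarrow> fo (x \<otimes>\<^bsub>X\<^esub> y) = fo x \<otimes>\<^bsub>Y\<^esub> fo y"
    and tarr: "\<And>f g. \<lbrakk>f \<in> Arr X; g \<in> Arr X\<rbrakk> \<Longrightarrow> fa (f \<odot>\<^bsub>X\<^esub> g) = fa f \<odot>\<^bsub>Y\<^esub> fa g"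
    and ass: "\<And>x y z. \<lbrakk>x \<in> Obj X; y \<in> Obj X; z \<in> Obj X\<rbrakk> \<Longrightarrow> fa (Ass X x y z) = Ass Y (fo x) (fo y) (fo z)"
    and run: "\<And>x. x \<in> Obj X \<Longrightarrow> fa (Run X x) = Run Y (fo x)"
    and lun: "\<And>x. x \<in> Obj X \<Longrightarrow> fa (Lun X x) = Lun Y (fo x)"
    and sym: "\<And>x y. \<lbrakk>x \<in> Obj X; y \<in> Obj X\<rbrakk> \<Longrightarrow> fa (Sym X x y) = Sym Y (fo x) (fo y)"
  shows "sm_functor X Y (strict_fun X Y fo fa)"
proof -
  interpret X: smc X using X by unfold_locales
  interpret Y: smc Y using Y by unfold_locales
  have [simp]: "fa f \<in> Arr Y" "Dom Y (fa f) = fo (Dom X f)" "Cod Y (fa f) = fo (Cod X f)" if "f \<in> Arr X" for f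
    using fa[OF that] by (auto simp: Hom_def)
  show ?thesis
    by (rule sm_functorI) (simp_all add: strict_fun_def Hom_def fo id comp unit tob tarr ass run lun sym)
qed

lemma comp_box_fun:
  assumes "sm_category C" "sm_category A" "sm_category B"
    and "sm_functor C A F" "sm_functor A B H" "sm_functor A B K"
  shows "comp_fun C B (box_fun A B H K) F = box_fun C B (comp_fun C B H F) (comp_fun C B K F)"
proof -
  interpret F: sm_fun C A F using assms by (intro sm_funI)
  interpret H: sm_fun A B H using assms by (intro sm_funI)
  interpret K: sm_fun A B K using assms by (intro sm_funI)
  show ?thesis
    by (rule smfun_eqI[where X = "Obj C" and Y = "Arr C"]) simp_all
qed

lemma comp_unit_fun:
  assumes "sm_category C" "sm_category A" "sm_category B" and "sm_functor C A F"
  shows "comp_fun C B (unit_fun A B) F = unit_fun C B"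
proof -
  interpret F: sm_fun C A F using assms by (intro sm_funI)
  interpret B: smc B using assms by unfold_locales
  show ?thesis
    by (rule smfun_eqI[where X = "Obj C" and Y = "Arr C"]) simp_all
qed

lemma ihom_sm_category: "sm_category A \<Longrightarrow> sm_category B \<Longrightarrow> sm_category (ihom A B)"
  by (rule smc_pair.sm_category_ihom) (simp add: smc_pair_def smc_def)

lemma sm_functor_precomp:
  assumes "sm_category C" "sm_category A" "sm_category B" "sm_functor C A F"
  shows "sm_functor (ihom A B) (ihom C B) (precomp C A B F)"
proof -
  let ?X = "ihom A B" and ?Y = "ihom C B"
  show ?thesis
    unfolding precomp_def
  proof (rule sm_functor_strict_fun)
    interpret F: sm_fun C A F using assms by (intro sm_funI)
    note [simp] = assms comp_box_fun[of C A B] comp_unit_fun[of C A B]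
      sm_functor_comp_fun[of C A B] sm_trans_whisker_r[of C A B]
    fix \<sigma> assume "\<sigma> \<in> Arr ?X"
    then interpret \<sigma>: sm_nt A B \<sigma> using assms by (intro sm_ntI) auto
    show "whisker_r C B \<sigma> F \<in> Hom ?Y (comp_fun C B (Dom ?X \<sigma>) F) (comp_fun C B (Cod ?X \<sigma>) F)"
      using \<sigma>.sm_trans by (simp add: Hom_def)
    fix \<tau> assume "\<tau> \<in> Arr ?X"
    then interpret \<tau>: sm_nt A B \<tau> using assms by (intro sm_ntI) auto
    show "whisker_r C B (\<tau> \<cdot>\<^bsub>?X\<^esub> \<sigma>) F = whisker_r C B \<tau> F \<cdot>\<^bsub>?Y\<^esub> whisker_r C B \<sigma> F"
      by (rule smtrans_eqI[where X = "Obj C"]) simp_all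
    show "whisker_r C B (\<sigma> \<odot>\<^bsub>?X\<^esub> \<tau>) F = whisker_r C B \<sigma> F \<odot>\<^bsub>?Y\<^esub> whisker_r C B \<tau> F"
      using \<sigma>.S.sm_functor \<sigma>.T.sm_functor \<tau>.S.sm_functor \<tau>.T.sm_functor
      by (intro smtrans_eqI[where X = "Obj C"]) simp_all
  next
    interpret F: sm_fun C A F using assms by (intro sm_funI)
    interpret AB: smc_pair A B using assms by unfold_locales
    note [simp] = assms comp_box_fun[of C A B] comp_unit_fun[of C A B]
      sm_functor_comp_fun[of C A B] AB.sm_functor_unit_fun AB.sm_functor_box_fun
    show "comp_fun C B \<one>\<^bsub>?X\<^esub> F = \<one>\<^bsub>?Y\<^esub>" by simp
    fix G H K assume [simp]: "G \<in> Obj ?X" "H \<in> Obj ?X" "K \<in> Obj ?X"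
    then have [simp]: "sm_functor A B G" "sm_functor A B H" "sm_functor A B K" by auto
    show "comp_fun C B G F \<in> Obj ?Y" by simp
    show "whisker_r C B (Id ?X G) F = Id ?Y (comp_fun C B G F)"
      by (rule smtrans_eqI[where X = "Obj C"]) simp_all
    show "comp_fun C B (G \<otimes>\<^bsub>?X\<^esub> H) F = comp_fun C B G F \<otimes>\<^bsub>?Y\<^esub> comp_fun C B H F" by simp
    show "whisker_r C B (Ass ?X G H K) F = Ass ?Y (comp_fun C B G F) (comp_fun C B H F) (comp_fun C B K F)"
      by (rule smtrans_eqI[where X = "Obj C"]) simp_all
    show "whisker_r C B (Run ?X G) F = Run ?Y (comp_fun C B G F)"
      "whisker_r C B (Lun ?X G) F = Lun ?Y (comp_fun C B G F)"
      "whisker_r C B (Sym ?X G H) F = Sym ?Y (comp_fun C B G F) (comp_fun C B H F)"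
      by (auto intro!: smtrans_eqI[where X = "Obj C"])
  qed (use assms ihom_sm_category in auto)
qed

lemma postcomp_simps [simp]:
  "H \<in> Obj (ihom A B) \<Longrightarrow> FO (postcomp A B C F) H = comp_fun A C F H"
  "\<theta> \<in> Arr (ihom A B) \<Longrightarrow> FA (postcomp A B C F) \<theta> = whisker_l A C F \<theta>"
  "F0 (postcomp A B C F) =
     \<lparr> Src = unit_fun A C, Trg = comp_fun A C F (unit_fun A B), Cmp = (\<lambda>a\<in>Obj A. F0 F) \<rparr>"
  "H \<in> Obj (ihom A B) \<Longrightarrow> K \<in> Obj (ihom A B) \<Longrightarrow> F2 (postcomp A B C F) (H, K) =
     \<lparr> Src = box_fun A C (comp_fun A C F H) (comp_fun A C F K),
       Trg = comp_fun A C F (box_fun A B H K), Cmp = (\<lambda>a\<in>Obj A. F2 F (FO H a, FO K a)) \<rparr>"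
  "FO (postcomp A B C F) \<in> extensional (Obj (ihom A B))"
  "FA (postcomp A B C F) \<in> extensional (Arr (ihom A B))"
  "F2 (postcomp A B C F) \<in> extensional (Obj (ihom A B) \<times> Obj (ihom A B))"
  by (auto simp: postcomp_def)

lemma sm_trans_postcomp_F0:
  assumes "sm_category A" "sm_category B" "sm_category C" and "sm_functor B C F"
  shows "sm_trans A C (F0 (postcomp A B C F))"
proof -
  interpret F: sm_fun B C F using assms by (intro sm_funI)
  interpret AB: smc_pair A B using assms by unfold_locales
  interpret AC: smc_pair A C using assms by unfold_locales
  show ?thesis
  proof (rule sm_transI)
    show "Cmp (F0 (postcomp A B C F)) \<one>\<^bsub>A\<^esub> \<cdot>\<^bsub>C\<^esub> F0 (Src (F0 (postcomp A B C F))) = F0 (Trg (F0 (postcomp A B C F)))"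
      by simp
  next
    fix x y assume [simp]: "x \<in> Obj A" "y \<in> Obj A"
    show "Cmp (F0 (postcomp A B C F)) (x \<otimes>\<^bsub>A\<^esub> y) \<cdot>\<^bsub>C\<^esub> F2 (Src (F0 (postcomp A B C F))) (x, y) =
       F2 (Trg (F0 (postcomp A B C F))) (x, y) \<cdot>\<^bsub>C\<^esub>
         (Cmp (F0 (postcomp A B C F)) x \<odot>\<^bsub>C\<^esub> Cmp (F0 (postcomp A B C F)) y)"
      by (simp add: F.F_run_unit)
  qed (use assms AB.sm_functor_unit_fun AC.sm_functor_unit_fun in
      \<open>simp_all add: Hom_def sm_functor_comp_fun[of A B C]\<close>)
qed

text \<open>
  Monoidality of \<open>[A, F]\<^sup>2\<close> at two objects of \<open>A\<close> is the compatibility of \<open>F\<close> with the interchange.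
\<close>

lemma sm_trans_postcomp_F2:
  assumes "sm_category A" "sm_category B" "sm_category C" and F: "sm_functor B C F"
    and H: "sm_functor A B H" and K: "sm_functor A B K"
  shows "sm_trans A C (F2 (postcomp A B C F) (H, K))"
proof -
  interpret F: sm_fun B C F using assms by (intro sm_funI)
  interpret H: sm_fun A B H using assms by (intro sm_funI)
  interpret K: sm_fun A B K using assms by (intro sm_funI)
  interpret AC: smc_pair A C using assms by unfold_locales
  let ?\<rho> = "F2 (postcomp A B C F) (H, K)"
  note [simp] = H K
  show ?thesis
  proof (rule sm_transI)
    show "sm_functor A C (Src ?\<rho>)" "sm_functor A C (Trg ?\<rho>)"
      using assms by (simp_all add: sm_functor_comp_fun[of A B C] H.sm_functor_box_fun AC.sm_functor_box_fun)
  next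
    have "Cmp ?\<rho> \<one>\<^bsub>A\<^esub> \<cdot>\<^bsub>C\<^esub> F0 (Src ?\<rho>) = (F2 F (FO H \<one>\<^bsub>A\<^esub>, FO K \<one>\<^bsub>A\<^esub>) \<cdot>\<^bsub>C\<^esub>
        (FA F (F0 H) \<odot>\<^bsub>C\<^esub> FA F (F0 K))) \<cdot>\<^bsub>C\<^esub> (F0 F \<odot>\<^bsub>C\<^esub> F0 F) \<cdot>\<^bsub>C\<^esub> inv_arr C (Run C \<one>\<^bsub>C\<^esub>)"
      by simp
    also have "\<dots> = FA F (F0 H \<odot>\<^bsub>B\<^esub> F0 K) \<cdot>\<^bsub>C\<^esub> (F2 F (\<one>\<^bsub>B\<^esub>, \<one>\<^bsub>B\<^esub>) \<cdot>\<^bsub>C\<^esub> (F0 F \<odot>\<^bsub>C\<^esub> F0 F)) \<cdot>\<^bsub>C\<^esub> inv_arr C (Run C \<one>\<^bsub>C\<^esub>)"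
      by (subst F.F2_natural'[of _ _ "\<one>\<^bsub>B\<^esub>" _ "\<one>\<^bsub>B\<^esub>"]) simp_all
    also have "\<dots> = F0 (Trg ?\<rho>)"
      unfolding F.F_unit_unit by simp
    finally show "Cmp ?\<rho> \<one>\<^bsub>A\<^esub> \<cdot>\<^bsub>C\<^esub> F0 (Src ?\<rho>) = F0 (Trg ?\<rho>)" .
  next
    fix f assume [simp]: "f \<in> Arr A"
    show "Cmp ?\<rho> (Cod A f) \<cdot>\<^bsub>C\<^esub> FA (Src ?\<rho>) f = FA (Trg ?\<rho>) f \<cdot>\<^bsub>C\<^esub> Cmp ?\<rho> (Dom A f)"
      using F.F2_natural[of "FA H f" "FA K f"] by simp
  next
    fix x y assume [simp]: "x \<in> Obj A" "y \<in> Obj A"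
    let ?a = "FO H x" and ?b = "FO K x" and ?c = "FO H y" and ?d = "FO K y"
    let ?h = "FO H (x \<otimes>\<^bsub>A\<^esub> y)" and ?k = "FO K (x \<otimes>\<^bsub>A\<^esub> y)"
    have "Cmp ?\<rho> (x \<otimes>\<^bsub>A\<^esub> y) \<cdot>\<^bsub>C\<^esub> F2 (Src ?\<rho>) (x, y) =
       (F2 F (?h, ?k) \<cdot>\<^bsub>C\<^esub> (FA F (F2 H (x, y)) \<odot>\<^bsub>C\<^esub> FA F (F2 K (x, y)))) \<cdot>\<^bsub>C\<^esub>
       (F2 F (?a, ?c) \<odot>\<^bsub>C\<^esub> F2 F (?b, ?d)) \<cdot>\<^bsub>C\<^esub> interchange C (FO F ?a) (FO F ?b) (FO F ?c) (FO F ?d)"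
      by simp
    also have "\<dots> = FA F (F2 H (x, y) \<odot>\<^bsub>B\<^esub> F2 K (x, y)) \<cdot>\<^bsub>C\<^esub>
       (F2 F (?a \<otimes>\<^bsub>B\<^esub> ?c, ?b \<otimes>\<^bsub>B\<^esub> ?d) \<cdot>\<^bsub>C\<^esub> (F2 F (?a, ?c) \<odot>\<^bsub>C\<^esub> F2 F (?b, ?d)) \<cdot>\<^bsub>C\<^esub>
         interchange C (FO F ?a) (FO F ?b) (FO F ?c) (FO F ?d))"
      by (subst F.F2_natural'[of _ _ "?a \<otimes>\<^bsub>B\<^esub> ?c" _ "?b \<otimes>\<^bsub>B\<^esub> ?d"]) simp_all
    also have "\<dots> = F2 (Trg ?\<rho>) (x, y) \<cdot>\<^bsub>C\<^esub> (Cmp ?\<rho> x \<odot>\<^bsub>C\<^esub> Cmp ?\<rho> y)"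
      by (simp flip: F.F_interchange)
    finally show "Cmp ?\<rho> (x \<otimes>\<^bsub>A\<^esub> y) \<cdot>\<^bsub>C\<^esub> F2 (Src ?\<rho>) (x, y) =
       F2 (Trg ?\<rho>) (x, y) \<cdot>\<^bsub>C\<^esub> (Cmp ?\<rho> x \<odot>\<^bsub>C\<^esub> Cmp ?\<rho> y)" .
  qed (simp_all add: Hom_def)
qed

lemma sm_functor_postcomp:
  assumes "sm_category A" "sm_category B" "sm_category C" and F: "sm_functor B C F"
  shows "sm_functor (ihom A B) (ihom A C) (postcomp A B C F)"
proof -
  let ?X = "ihom A B" and ?Y = "ihom A C"
  interpret F: sm_fun B C F using assms by (intro sm_funI)
  interpret AB: smc_pair A B using assms by unfold_locales
  interpret AC: smc_pair A C using assms by unfold_locales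
  note [simp] = assms sm_functor_comp_fun[of A B C] sm_trans_whisker_l[of A B C]
    AB.sm_functor_box_fun AC.sm_functor_box_fun AB.sm_functor_unit_fun AC.sm_functor_unit_fun
    AB.sm_trans_box AC.sm_trans_box
  let ?P = "postcomp A B C F"
  have id: "sm_trans A B (Id ?X H)" if "sm_functor A B H" for H
    using AB.sm_trans_id[OF that] by simp
  show ?thesis
  proof (rule sm_functorI)
    show "F0 ?P \<in> Hom ?Y \<one>\<^bsub>?Y\<^esub> (FO ?P \<one>\<^bsub>?X\<^esub>)"
      using sm_trans_postcomp_F0[OF assms] by (simp add: Hom_def)
  next
    fix H K assume "H \<in> Obj ?X" "K \<in> Obj ?X"
    then show "F2 ?P (H, K) \<in> Hom ?Y (FO ?P H \<otimes>\<^bsub>?Y\<^esub> FO ?P K) (FO ?P (H \<otimes>\<^bsub>?X\<^esub> K))"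
      using sm_trans_postcomp_F2[OF assms, of H K] by (simp add: Hom_def)
  next
    fix H assume H: "H \<in> Obj ?X"
    then interpret H: sm_fun A B H by (simp add: AB.sm_fun_iff)
    note [simp] = H.sm_functor
    show "FA ?P (Id ?X H) = Id ?Y (FO ?P H)"
      using id[OF H.sm_functor] by (auto intro!: smtrans_eqI[where X = "Obj A"])
    show "FA ?P (Run ?X H) \<cdot>\<^bsub>?Y\<^esub> F2 ?P (H, \<one>\<^bsub>?X\<^esub>) \<cdot>\<^bsub>?Y\<^esub> (Id ?Y (FO ?P H) \<odot>\<^bsub>?Y\<^esub> F0 ?P) =
        Run ?Y (FO ?P H)"
      using AB.sm_trans_run[OF H.sm_functor] by (auto intro!: smtrans_eqI[where X = "Obj A"] simp: F.F_run)
    show "FA ?P (Lun ?X H) \<cdot>\<^bsub>?Y\<^esub> F2 ?P (\<one>\<^bsub>?X\<^esub>, H) \<cdot>\<^bsub>?Y\<^esub> (F0 ?P \<odot>\<^bsub>?Y\<^esub> Id ?Y (FO ?P H)) =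
        Lun ?Y (FO ?P H)"
      using AB.sm_trans_lun[OF H.sm_functor] by (auto intro!: smtrans_eqI[where X = "Obj A"] simp: F.F_lun)
    fix K assume K: "K \<in> Obj ?X"
    then interpret K: sm_fun A B K by (simp add: AB.sm_fun_iff)
    note [simp] = K.sm_functor
    show "FA ?P (Sym ?X H K) \<cdot>\<^bsub>?Y\<^esub> F2 ?P (H, K) = F2 ?P (K, H) \<cdot>\<^bsub>?Y\<^esub> Sym ?Y (FO ?P H) (FO ?P K)"
      using AB.sm_trans_sym[OF H.sm_functor K.sm_functor] by (auto intro!: smtrans_eqI[where X = "Obj A"] simp: F.F_sym)
    fix L assume L: "L \<in> Obj ?X"
    then interpret L: sm_fun A B L by (simp add: AB.sm_fun_iff)
    note [simp] = L.sm_functor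
    show "FA ?P (Ass ?X H K L) \<cdot>\<^bsub>?Y\<^esub> F2 ?P (H, K \<otimes>\<^bsub>?X\<^esub> L) \<cdot>\<^bsub>?Y\<^esub> (Id ?Y (FO ?P H) \<odot>\<^bsub>?Y\<^esub> F2 ?P (K, L)) =
        F2 ?P (H \<otimes>\<^bsub>?X\<^esub> K, L) \<cdot>\<^bsub>?Y\<^esub> (F2 ?P (H, K) \<odot>\<^bsub>?Y\<^esub> Id ?Y (FO ?P L)) \<cdot>\<^bsub>?Y\<^esub>
          Ass ?Y (FO ?P H) (FO ?P K) (FO ?P L)"
      using AB.sm_trans_ass[OF H.sm_functor K.sm_functor L.sm_functor]
      by (auto intro!: smtrans_eqI[where X = "Obj A"] simp: F.F_ass)
  next
    fix \<sigma> assume s: "\<sigma> \<in> Arr ?X"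
    then interpret \<sigma>: sm_nt A B \<sigma> by (simp add: AB.sm_nt_iff)
    note [simp] = \<sigma>.sm_trans \<sigma>.S.sm_functor \<sigma>.T.sm_functor
    show "FA ?P \<sigma> \<in> Hom ?Y (FO ?P (Dom ?X \<sigma>)) (FO ?P (Cod ?X \<sigma>))"
      by (simp add: Hom_def)
    fix \<tau> assume t: "\<tau> \<in> Arr ?X"
    then interpret \<tau>: sm_nt A B \<tau> by (simp add: AB.sm_nt_iff)
    note [simp] = \<tau>.sm_trans \<tau>.S.sm_functor \<tau>.T.sm_functor
    show "F2 ?P (Cod ?X \<sigma>, Cod ?X \<tau>) \<cdot>\<^bsub>?Y\<^esub> (FA ?P \<sigma> \<odot>\<^bsub>?Y\<^esub> FA ?P \<tau>) =
        FA ?P (\<sigma> \<odot>\<^bsub>?X\<^esub> \<tau>) \<cdot>\<^bsub>?Y\<^esub> F2 ?P (Dom ?X \<sigma>, Dom ?X \<tau>)"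
      using F.F2_natural[OF \<sigma>.Cmp_arr(1) \<tau>.Cmp_arr(1)] by (auto intro!: smtrans_eqI[where X = "Obj A"])
    assume e: "Cod ?X \<sigma> = Dom ?X \<tau>"
    then show "FA ?P (\<tau> \<cdot>\<^bsub>?X\<^esub> \<sigma>) = FA ?P \<tau> \<cdot>\<^bsub>?Y\<^esub> FA ?P \<sigma>"
      using AB.sm_trans_comp[OF \<sigma>.sm_trans \<tau>.sm_trans] by (auto intro!: smtrans_eqI[where X = "Obj A"])
  qed (use postcomp_simps(5-7)[of A B C F] in simp_all)
qed

section \<open>Duality\<close>

text \<open>
  \<open>F : A \<rightarrow> [B, C]\<close> is regarded as a functor of two variables that is symmetric monoidal in each of them.
  The axioms for a fixed object of \<open>A\<close> come from the objects of \<open>[B, C]\<close>, the axioms for a fixed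
  object of \<open>B\<close> from \<open>F\<close>, and the compatibilities between the two variables from the arrows of
  \<open>[B, C]\<close>. The dual exchanges the two variables.
\<close>

locale bifunctor = A: smc A + BC: smc_pair B C
  for A :: "('oa, 'aa) smcat" and B :: "('ob, 'ab) smcat" and C :: "('oc, 'ac) smcat" (structure) +
  fixes F :: "('oa, 'aa, ('ob, 'ab, 'oc, 'ac) smfun, ('ob, 'ab, 'oc, 'ac) smtrans) smfun"
  assumes bifunctor: "sm_functor A (ihom B C) F"
begin

sublocale F: sm_fun A "ihom B C" F
  using bifunctor BC.sm_category_ihom A.sm_category by (intro sm_funI)

lemma at: "a \<in> Obj A \<Longrightarrow> sm_fun B C (FO F a)"
  using F.FO_obj by (simp add: BC.sm_fun_iff)

lemma at_arr: "f \<in> Arr A \<Longrightarrow> sm_nt B C (FA F f)"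
  using F.FA_arr(1) by (simp add: BC.sm_nt_iff)

lemma at_F0: "sm_nt B C (F0 F)"
  using F.F0_arr(1) by (simp add: BC.sm_nt_iff)

lemma at_F2: "a \<in> Obj A \<Longrightarrow> a' \<in> Obj A \<Longrightarrow> sm_nt B C (F2 F (a, a'))"
  using F.F2_arr(1) by (simp add: BC.sm_nt_iff)

lemma ends [simp]:
  "f \<in> Arr A \<Longrightarrow> Src (FA F f) = FO F (Dom A f)" "f \<in> Arr A \<Longrightarrow> Trg (FA F f) = FO F (Cod A f)"
  "Src (F0 F) = unit_fun B C" "Trg (F0 F) = FO F \<one>\<^bsub>A\<^esub>"
  "a \<in> Obj A \<Longrightarrow> a' \<in> Obj A \<Longrightarrow> Src (F2 F (a, a')) = box_fun B C (FO F a) (FO F a')"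
  "a \<in> Obj A \<Longrightarrow> a' \<in> Obj A \<Longrightarrow> Trg (F2 F (a, a')) = FO F (a \<otimes>\<^bsub>A\<^esub> a')"
  using F.FA_arr F.F0_arr F.F2_arr by simp_all

lemmas at_simps [simp] = sm_fun.FO_obj[OF at] sm_fun.FA_id[OF at] sm_fun.FA_arr[OF at]
  sm_fun.FA_comp[OF at] sm_fun.F0_arr[OF at] sm_fun.F2_arr[OF at]
  sm_nt.Cmp_arr[OF at_arr] sm_nt.Cmp_arr[OF at_F0] sm_nt.Cmp_arr[OF at_F2]

text \<open>The axioms of \<open>F\<close> are equations between transformations; these are their components at \<open>b\<close>.\<close>

lemma Cmp_FA:
  assumes "b \<in> Obj B"
  shows "a \<in> Obj A \<Longrightarrow> Cmp (FA F (Id A a)) b = Id C (FO (FO F a) b)"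
    "\<lbrakk>f \<in> Arr A; g \<in> Arr A; Cod A f = Dom A g\<rbrakk> \<Longrightarrow>
       Cmp (FA F (g \<cdot>\<^bsub>A\<^esub> f)) b = Cmp (FA F g) b \<cdot> Cmp (FA F f) b"
  using assms F.FA_id F.FA_comp by simp_all

lemma Cmp_F2_natural:
  assumes "b \<in> Obj B" "f \<in> Arr A" "g \<in> Arr A"
  shows "Cmp (F2 F (Cod A f, Cod A g)) b \<cdot> (Cmp (FA F f) b \<odot> Cmp (FA F g) b) =
    Cmp (FA F (f \<odot>\<^bsub>A\<^esub> g)) b \<cdot> Cmp (F2 F (Dom A f, Dom A g)) b"
  using assms arg_cong[OF F.F2_natural[OF assms(2,3)], of "\<lambda>\<sigma>. Cmp \<sigma> b"] by simp

lemma Cmp_F_ass: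
  assumes "b \<in> Obj B" "x \<in> Obj A" "y \<in> Obj A" "z \<in> Obj A"
  shows "Cmp (FA F (Ass A x y z)) b \<cdot> Cmp (F2 F (x, y \<otimes>\<^bsub>A\<^esub> z)) b \<cdot>
      (Id C (FO (FO F x) b) \<odot> Cmp (F2 F (y, z)) b) =
    Cmp (F2 F (x \<otimes>\<^bsub>A\<^esub> y, z)) b \<cdot> (Cmp (F2 F (x, y)) b \<odot> Id C (FO (FO F z) b)) \<cdot>
      Ass C (FO (FO F x) b) (FO (FO F y) b) (FO (FO F z) b)"
  using assms arg_cong[OF F.F_ass[OF assms(2-4)], of "\<lambda>\<sigma>. Cmp \<sigma> b"] by simp

lemma Cmp_F_run:
  assumes "b \<in> Obj B" "x \<in> Obj A"
  shows "Cmp (FA F (Run A x)) b \<cdot> Cmp (F2 F (x, \<one>\<^bsub>A\<^esub>)) b \<cdot>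
      (Id C (FO (FO F x) b) \<odot> Cmp (F0 F) b) = Run C (FO (FO F x) b)"
    "Cmp (FA F (Lun A x)) b \<cdot> Cmp (F2 F (\<one>\<^bsub>A\<^esub>, x)) b \<cdot>
      (Cmp (F0 F) b \<odot> Id C (FO (FO F x) b)) = Lun C (FO (FO F x) b)"
  using assms arg_cong[OF F.F_run[OF assms(2)], of "\<lambda>\<sigma>. Cmp \<sigma> b"]
    arg_cong[OF F.F_lun[OF assms(2)], of "\<lambda>\<sigma>. Cmp \<sigma> b"] by simp_all

lemma Cmp_F_sym:
  assumes "b \<in> Obj B" "x \<in> Obj A" "y \<in> Obj A"
  shows "Cmp (FA F (Sym A x y)) b \<cdot> Cmp (F2 F (x, y)) b =
    Cmp (F2 F (y, x)) b \<cdot> Sym C (FO (FO F x) b) (FO (FO F y) b)"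
  using assms arg_cong[OF F.F_sym[OF assms(2,3)], of "\<lambda>\<sigma>. Cmp \<sigma> b"] by simp

lemma dual_at_simps [simp]:
  "a \<in> Obj A \<Longrightarrow> FO (dual_at A F b) a = FO (FO F a) b"
  "f \<in> Arr A \<Longrightarrow> FA (dual_at A F b) f = Cmp (FA F f) b"
  "F0 (dual_at A F b) = Cmp (F0 F) b"
  "a \<in> Obj A \<Longrightarrow> a' \<in> Obj A \<Longrightarrow> F2 (dual_at A F b) (a, a') = Cmp (F2 F (a, a')) b"
  "FO (dual_at A F b) \<in> extensional (Obj A)"
  "FA (dual_at A F b) \<in> extensional (Arr A)"
  "F2 (dual_at A F b) \<in> extensional (Obj A \<times> Obj A)"
  by (auto simp: dual_at_def)

lemma dual_simps [simp]:
  "b \<in> Obj B \<Longrightarrow> FO (dual A B C F) b = dual_at A F b"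
  "g \<in> Arr B \<Longrightarrow> FA (dual A B C F) g = \<lparr> Src = dual_at A F (Dom B g), Trg = dual_at A F (Cod B g),
     Cmp = (\<lambda>a\<in>Obj A. FA (FO F a) g) \<rparr>"
  "F0 (dual A B C F) = \<lparr> Src = unit_fun A C, Trg = dual_at A F \<one>\<^bsub>B\<^esub>, Cmp = (\<lambda>a\<in>Obj A. F0 (FO F a)) \<rparr>"
  "b \<in> Obj B \<Longrightarrow> b' \<in> Obj B \<Longrightarrow> F2 (dual A B C F) (b, b') =
     \<lparr> Src = box_fun A C (dual_at A F b) (dual_at A F b'), Trg = dual_at A F (b \<otimes>\<^bsub>B\<^esub> b'),
       Cmp = (\<lambda>a\<in>Obj A. F2 (FO F a) (b, b')) \<rparr>"
  "FO (dual A B C F) \<in> extensional (Obj B)"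
  "FA (dual A B C F) \<in> extensional (Arr B)"
  "F2 (dual A B C F) \<in> extensional (Obj B \<times> Obj B)"
  by (auto simp: dual_def)

lemma sm_functor_dual_at:
  assumes [simp]: "b \<in> Obj B"
  shows "sm_functor A C (dual_at A F b)"
  by (rule sm_functorI)
    (simp_all add: Hom_def Cmp_FA Cmp_F2_natural Cmp_F_ass Cmp_F_run Cmp_F_sym)

lemma AC: "smc_pair A C"
  by unfold_locales

text \<open>
  Monoidality of \<open>F\<^sup>*(g)\<close> is the naturality of the transformations \<open>F\<^sup>0\<close> and \<open>F\<^sup>2\<close>; conversely, for
  \<open>(F\<^sup>*)\<^sup>0\<close> and \<open>(F\<^sup>*)\<^sup>2\<close> naturality is the monoidality of the transformations \<open>F(f)\<close>.
\<close>

lemma sm_trans_dual_FA: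
  assumes [simp]: "g \<in> Arr B"
  shows "sm_trans A C (FA (dual A B C F) g)"
proof -
  let ?\<rho> = "FA (dual A B C F) g"
  show ?thesis
  proof (rule sm_transI)
    fix f assume [simp]: "f \<in> Arr A"
    show "Cmp ?\<rho> (Cod A f) \<cdot> FA (Src ?\<rho>) f =
      FA (Trg ?\<rho>) f \<cdot> Cmp ?\<rho> (Dom A f)"
      using sm_nt.Cmp_natural[OF at_arr[of f], of g] by simp
  next
    show "Cmp ?\<rho> \<one>\<^bsub>A\<^esub> \<cdot> F0 (Src ?\<rho>) = F0 (Trg ?\<rho>)"
      using sm_nt.Cmp_natural[OF at_F0, of g] by simp
  next
    fix x y assume [simp]: "x \<in> Obj A" "y \<in> Obj A"
    show "Cmp ?\<rho> (x \<otimes>\<^bsub>A\<^esub> y) \<cdot> F2 (Src ?\<rho>) (x, y) =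
      F2 (Trg ?\<rho>) (x, y) \<cdot> (Cmp ?\<rho> x \<odot> Cmp ?\<rho> y)"
      using sm_nt.Cmp_natural[OF at_F2[of x y], of g] by simp
  qed (simp_all add: Hom_def sm_functor_dual_at)
qed

lemma sm_trans_dual_F0: "sm_trans A C (F0 (dual A B C F))"
proof -
  let ?\<rho> = "F0 (dual A B C F)"
  show ?thesis
  proof (rule sm_transI)
    fix f assume [simp]: "f \<in> Arr A"
    show "Cmp ?\<rho> (Cod A f) \<cdot> FA (Src ?\<rho>) f =
      FA (Trg ?\<rho>) f \<cdot> Cmp ?\<rho> (Dom A f)"
      using sm_nt.Cmp_unit[OF at_arr[of f]] by simp
  next
    show "Cmp ?\<rho> \<one>\<^bsub>A\<^esub> \<cdot> F0 (Src ?\<rho>) = F0 (Trg ?\<rho>)"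
      using sm_nt.Cmp_unit[OF at_F0] by simp
  next
    fix x y assume [simp]: "x \<in> Obj A" "y \<in> Obj A"
    have "F0 (FO F (x \<otimes>\<^bsub>A\<^esub> y)) = Cmp (F2 F (x, y)) \<one>\<^bsub>B\<^esub> \<cdot> (F0 (FO F x) \<odot> F0 (FO F y)) \<cdot>
        inv_arr C (Run C \<one>)"
      using sm_nt.Cmp_unit[OF at_F2[of x y]] by simp
    then show "Cmp ?\<rho> (x \<otimes>\<^bsub>A\<^esub> y) \<cdot> F2 (Src ?\<rho>) (x, y) =
      F2 (Trg ?\<rho>) (x, y) \<cdot> (Cmp ?\<rho> x \<odot> Cmp ?\<rho> y)"
      by simp
  qed (simp_all add: Hom_def sm_functor_dual_at smc_pair.sm_functor_unit_fun[OF AC])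
qed

text \<open>
  Monoidality of \<open>(F\<^sup>*)\<^sup>2\<close> is that of \<open>F\<^sup>2\<close> read in the other direction: the tensor product over the first
  variable and the one over the second contain transposed interchanges, which are inverse to each other.
\<close>

lemma sm_trans_dual_F2:
  assumes [simp]: "b \<in> Obj B" "b' \<in> Obj B"
  shows "sm_trans A C (F2 (dual A B C F) (b, b'))" (is "sm_trans A C ?\<rho>")
proof (rule sm_transI)
  fix f assume [simp]: "f \<in> Arr A"
  show "Cmp ?\<rho> (Cod A f) \<cdot> FA (Src ?\<rho>) f = FA (Trg ?\<rho>) f \<cdot> Cmp ?\<rho> (Dom A f)"
    using sm_nt.Cmp_tensor[OF at_arr[of f], of b b'] by simp
next
  have "Cmp ?\<rho> \<one>\<^bsub>A\<^esub> \<cdot> F0 (Src ?\<rho>) = (F2 (FO F \<one>\<^bsub>A\<^esub>) (b, b') \<cdot>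
      (Cmp (F0 F) b \<odot> Cmp (F0 F) b')) \<cdot> inv_arr C (Run C \<one>)"
    by simp
  also have "\<dots> = (Cmp (F0 F) (b \<otimes>\<^bsub>B\<^esub> b') \<cdot> Run C \<one>) \<cdot> inv_arr C (Run C \<one>)"
    using sm_nt.Cmp_tensor[OF at_F0, of b b'] by (simp del: BC.B.comp_assoc)
  also have "\<dots> = F0 (Trg ?\<rho>)"
    by simp
  finally show "Cmp ?\<rho> \<one>\<^bsub>A\<^esub> \<cdot> F0 (Src ?\<rho>) = F0 (Trg ?\<rho>)" .
next
  fix x y assume [simp]: "x \<in> Obj A" "y \<in> Obj A"
  let ?a = "FO (FO F x) b" and ?b = "FO (FO F x) b'" and ?c = "FO (FO F y) b" and ?d = "FO (FO F y) b'"
  have "Cmp ?\<rho> (x \<otimes>\<^bsub>A\<^esub> y) \<cdot> F2 (Src ?\<rho>) (x, y) =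
     (F2 (FO F (x \<otimes>\<^bsub>A\<^esub> y)) (b, b') \<cdot> (Cmp (F2 F (x, y)) b \<odot> Cmp (F2 F (x, y)) b')) \<cdot>
       interchange C ?a ?b ?c ?d"
    by simp
  also have "\<dots> = (Cmp (F2 F (x, y)) (b \<otimes>\<^bsub>B\<^esub> b') \<cdot> ((F2 (FO F x) (b, b') \<odot> F2 (FO F y) (b, b')) \<cdot>
       interchange C ?a ?c ?b ?d)) \<cdot> interchange C ?a ?b ?c ?d"
    using sm_nt.Cmp_tensor[OF at_F2[of x y], of b b'] by (simp del: BC.B.comp_assoc)
  also have "\<dots> = F2 (Trg ?\<rho>) (x, y) \<cdot> (Cmp ?\<rho> x \<odot> Cmp ?\<rho> y)"
    by (simp add: BC.B.interchange_involutive)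
  finally show "Cmp ?\<rho> (x \<otimes>\<^bsub>A\<^esub> y) \<cdot> F2 (Src ?\<rho>) (x, y) =
     F2 (Trg ?\<rho>) (x, y) \<cdot> (Cmp ?\<rho> x \<odot> Cmp ?\<rho> y)" .
qed (simp_all add: Hom_def sm_functor_dual_at smc_pair.sm_functor_box_fun[OF AC])

text \<open>
  The axioms hold at each object of \<open>A\<close>, where they are those of \<open>F(a)\<close>.
\<close>

theorem sm_functor_dual: "sm_functor B (ihom A C) (dual A B C F)"
proof -
  let ?D = "dual A B C F" and ?X = "ihom A C"
  show ?thesis
  proof (rule sm_functorI)
    show "F0 ?D \<in> Hom ?X \<one>\<^bsub>?X\<^esub> (FO ?D \<one>\<^bsub>B\<^esub>)"
      using sm_trans_dual_F0 by (simp add: Hom_def)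
  next
    fix b assume [simp]: "b \<in> Obj B"
    show "FO ?D b \<in> Obj ?X"
      by (simp add: sm_functor_dual_at)
    show "FA ?D (Id B b) = Id ?X (FO ?D b)"
      by (rule smtrans_eqI[where X = "Obj A"]) simp_all
    show "FA ?D (Run B b) \<cdot>\<^bsub>?X\<^esub> F2 ?D (b, \<one>\<^bsub>B\<^esub>) \<cdot>\<^bsub>?X\<^esub>
        (Id ?X (FO ?D b) \<odot>\<^bsub>?X\<^esub> F0 ?D) = Run ?X (FO ?D b)"
      by (rule smtrans_eqI[where X = "Obj A"]) (simp_all add: sm_fun.F_run[OF at])
    show "FA ?D (Lun B b) \<cdot>\<^bsub>?X\<^esub> F2 ?D (\<one>\<^bsub>B\<^esub>, b) \<cdot>\<^bsub>?X\<^esub>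
        (F0 ?D \<odot>\<^bsub>?X\<^esub> Id ?X (FO ?D b)) = Lun ?X (FO ?D b)"
      by (rule smtrans_eqI[where X = "Obj A"]) (simp_all add: sm_fun.F_lun[OF at])
    fix b' assume [simp]: "b' \<in> Obj B"
    show "F2 ?D (b, b') \<in> Hom ?X (FO ?D b \<otimes>\<^bsub>?X\<^esub> FO ?D b')
        (FO ?D (b \<otimes>\<^bsub>B\<^esub> b'))"
      using sm_trans_dual_F2[of b b'] by (simp add: Hom_def)
    show "FA ?D (Sym B b b') \<cdot>\<^bsub>?X\<^esub> F2 ?D (b, b') =
       F2 ?D (b', b) \<cdot>\<^bsub>?X\<^esub> Sym ?X (FO ?D b) (FO ?D b')"
      by (rule smtrans_eqI[where X = "Obj A"]) (simp_all add: sm_fun.F_sym[OF at])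
    fix b'' assume [simp]: "b'' \<in> Obj B"
    show "FA ?D (Ass B b b' b'') \<cdot>\<^bsub>?X\<^esub> F2 ?D (b, b' \<otimes>\<^bsub>B\<^esub> b'') \<cdot>\<^bsub>?X\<^esub>
        (Id ?X (FO ?D b) \<odot>\<^bsub>?X\<^esub> F2 ?D (b', b'')) =
      F2 ?D (b \<otimes>\<^bsub>B\<^esub> b', b'') \<cdot>\<^bsub>?X\<^esub>
        (F2 ?D (b, b') \<odot>\<^bsub>?X\<^esub> Id ?X (FO ?D b'')) \<cdot>\<^bsub>?X\<^esub>
        Ass ?X (FO ?D b) (FO ?D b') (FO ?D b'')"
      by (rule smtrans_eqI[where X = "Obj A"]) (simp_all add: sm_fun.F_ass[OF at])
  next
    fix g assume [simp]: "g \<in> Arr B"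
    show "FA ?D g \<in> Hom ?X (FO ?D (Dom B g)) (FO ?D (Cod B g))"
      using sm_trans_dual_FA[of g] by (simp add: Hom_def)
    fix h assume [simp]: "h \<in> Arr B"
    show "F2 ?D (Cod B g, Cod B h) \<cdot>\<^bsub>?X\<^esub> (FA ?D g \<odot>\<^bsub>?X\<^esub> FA ?D h) =
      FA ?D (g \<odot>\<^bsub>B\<^esub> h) \<cdot>\<^bsub>?X\<^esub> F2 ?D (Dom B g, Dom B h)"
      by (rule smtrans_eqI[where X = "Obj A"]) (simp_all add: sm_fun.F2_natural[OF at])
    assume "Cod B g = Dom B h"
    then show "FA ?D (h \<cdot>\<^bsub>B\<^esub> g) = FA ?D h \<cdot>\<^bsub>?X\<^esub> FA ?D g"
      by (intro smtrans_eqI[where X = "Obj A"]) simp_all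
  qed simp_all
qed

end

section \<open>The functors \<open>[D, -]\<close> and \<open>[-, B]\<close>\<close>

context smc_pair
begin

lemma inv_arr_ihom:
  assumes "sm_trans A B \<sigma>" "\<And>x. x \<in> Obj A \<Longrightarrow> iso_arr B (Cmp \<sigma> x)"
  shows "inv_arr (ihom A B) \<sigma> =
    \<lparr> Src = Trg \<sigma>, Trg = Src \<sigma>, Cmp = (\<lambda>x\<in>Obj A. inv_arr B (Cmp \<sigma> x)) \<rparr>"
proof -
  interpret ihom: smc "ihom A B" using sm_category_ihom by unfold_locales
  show ?thesis
    using inverse_pair_ihom[OF assms] by (rule ihom.inv_arr_eqI)
qed

lemma inv_run_ihom:
  "inv_arr (ihom A B) (Run (ihom A B) (unit_fun A B)) =
    \<lparr> Src = unit_fun A B, Trg = box_fun A B (unit_fun A B) (unit_fun A B),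
      Cmp = (\<lambda>x\<in>Obj A. inv_arr B (Run B \<one>)) \<rparr>"
  using sm_trans_run[OF sm_functor_unit_fun] by (subst inv_arr_ihom) (auto intro!: restrict_ext)

lemma interchange_ihom:
  assumes "sm_functor A B F" "sm_functor A B G" "sm_functor A B H" "sm_functor A B K"
  shows "interchange (ihom A B) F G H K =
    \<lparr> Src = box_fun A B (box_fun A B F G) (box_fun A B H K),
      Trg = box_fun A B (box_fun A B F H) (box_fun A B G K),
      Cmp = (\<lambda>x\<in>Obj A. interchange B (FO F x) (FO G x) (FO H x) (FO K x)) \<rparr>"
proof -
  interpret F: sm_fun A B F + G: sm_fun A B G + H: sm_fun A B H + K: sm_fun A B K
    using assms by (simp_all add: sm_fun_iff)
  have inv: "inv_arr (ihom A B) (Ass (ihom A B) P Q R) =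
      \<lparr> Src = Trg (Ass (ihom A B) P Q R), Trg = Src (Ass (ihom A B) P Q R),
        Cmp = (\<lambda>x\<in>Obj A. inv_arr B (Ass B (FO P x) (FO Q x) (FO R x))) \<rparr>"
    if "sm_functor A B P" "sm_functor A B Q" "sm_functor A B R" for P Q R
  proof -
    interpret P: sm_fun A B P + Q: sm_fun A B Q + R: sm_fun A B R
      using that by (simp_all add: sm_fun_iff)
    show ?thesis
      using sm_trans_ass[OF that] by (subst inv_arr_ihom) (auto intro!: restrict_ext)
  qed
  show ?thesis
    unfolding interchange_def[of "ihom A B"] using assms
    by (simp add: inv[unfolded ihom_simps] sm_functor_box_fun)
      (auto intro!: restrict_ext simp: interchange_def)
qed

end

text \<open>
  Strictness of \<open>[D, -]\<close>: the structure arrows agree because the interchange of \<open>[D, B]\<close> has the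
  interchanges of \<open>B\<close> as its components.
\<close>

lemma postcomp_box_fun:
  assumes D: "sm_category D" and C: "sm_category C" and B: "sm_category B"
    and F: "sm_functor C B F" and G: "sm_functor C B G"
  shows "postcomp D C B (box_fun C B F G) =
    box_fun (ihom D C) (ihom D B) (postcomp D C B F) (postcomp D C B G)"
proof -
  interpret DC: smc_pair D C using D C by unfold_locales
  interpret DB: smc_pair D B using D B by unfold_locales
  interpret CB: smc_pair C B using C B by unfold_locales
  interpret F: sm_fun C B F using F by (simp add: CB.sm_fun_iff)
  interpret G: sm_fun C B G using G by (simp add: CB.sm_fun_iff)
  note ext = postcomp_simps(5-7)[of D C B "box_fun C B F G"]
     box_fun_simps(5-7)[of "ihom D C" "ihom D B" "postcomp D C B F" "postcomp D C B G"]
  note [simp] = comp_box_fun[OF D C B _ F G] comp_unit_fun[OF D C B]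
    DC.sm_functor_unit_fun DC.sm_functor_box_fun
  show ?thesis
  proof (rule smfun_eqI[OF ext(1) ext(4) _ ext(2) ext(5) _ _ ext(3) ext(6)])
    fix H assume H: "H \<in> Obj (ihom D C)"
    then show "FO (postcomp D C B (box_fun C B F G)) H =
       FO (box_fun (ihom D C) (ihom D B) (postcomp D C B F) (postcomp D C B G)) H"
      by simp
    fix K assume K: "K \<in> Obj (ihom D C)"
    interpret H: sm_fun D C H using H by (simp add: DC.sm_fun_iff)
    interpret K: sm_fun D C K using K by (simp add: DC.sm_fun_iff)
    show "F2 (postcomp D C B (box_fun C B F G)) (H, K) =
       F2 (box_fun (ihom D C) (ihom D B) (postcomp D C B F) (postcomp D C B G)) (H, K)"
      using H K D C B F G
      by (auto intro!: smtrans_eqI[where X = "Obj D"] simp: DB.interchange_ihom sm_functor_comp_fun[of D C B])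
  next
    fix \<theta> assume "\<theta> \<in> Arr (ihom D C)"
    then interpret \<theta>: sm_nt D C \<theta> by (simp add: DC.sm_nt_iff)
    show "FA (postcomp D C B (box_fun C B F G)) \<theta> =
       FA (box_fun (ihom D C) (ihom D B) (postcomp D C B F) (postcomp D C B G)) \<theta>"
      using \<theta>.sm_trans \<theta>.S.sm_functor \<theta>.T.sm_functor
      by (auto intro!: smtrans_eqI[where X = "Obj D"])
  next
    show "F0 (postcomp D C B (box_fun C B F G)) =
       F0 (box_fun (ihom D C) (ihom D B) (postcomp D C B F) (postcomp D C B G))"
      by (simp add: DB.inv_run_ihom[unfolded ihom_simps]) (auto intro!: restrict_ext)
  qed
qed

lemma postcomp_unit_fun:
  assumes D: "sm_category D" and C: "sm_category C" and B: "sm_category B"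
  shows "postcomp D C B (unit_fun C B) = unit_fun (ihom D C) (ihom D B)"
proof -
  interpret DC: smc_pair D C using D C by unfold_locales
  interpret DB: smc_pair D B using D B by unfold_locales
  note ext = postcomp_simps(5-7)[of D C B "unit_fun C B"] unit_fun_simps(5-7)[of "ihom D C" "ihom D B"]
  note [simp] = comp_unit_fun[OF D C B] DC.sm_functor_unit_fun DC.sm_functor_box_fun
  show ?thesis
  proof (rule smfun_eqI[OF ext(1) ext(4) _ ext(2) ext(5) _ _ ext(3) ext(6)])
    fix H assume H: "H \<in> Obj (ihom D C)"
    then show "FO (postcomp D C B (unit_fun C B)) H = FO (unit_fun (ihom D C) (ihom D B)) H"
      by simp
    fix K assume K: "K \<in> Obj (ihom D C)"
    interpret H: sm_fun D C H using H by (simp add: DC.sm_fun_iff)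
    interpret K: sm_fun D C K using K by (simp add: DC.sm_fun_iff)
    show "F2 (postcomp D C B (unit_fun C B)) (H, K) = F2 (unit_fun (ihom D C) (ihom D B)) (H, K)"
      using H K by (auto intro!: smtrans_eqI[where X = "Obj D"])
  next
    fix \<theta> assume "\<theta> \<in> Arr (ihom D C)"
    then interpret \<theta>: sm_nt D C \<theta> by (simp add: DC.sm_nt_iff)
    show "FA (postcomp D C B (unit_fun C B)) \<theta> = FA (unit_fun (ihom D C) (ihom D B)) \<theta>"
      using \<theta>.sm_trans \<theta>.S.sm_functor \<theta>.T.sm_functor
      by (auto intro!: smtrans_eqI[where X = "Obj D"])
  next
    show "F0 (postcomp D C B (unit_fun C B)) = F0 (unit_fun (ihom D C) (ihom D B))"
      by (auto intro!: smtrans_eqI[where X = "Obj D"])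
  qed
qed

text \<open>
  The value \<open>[D, \<sigma>]\<close> of \<open>[D, -]\<close> on a 2-cell, and thus the action on arrows of a strict functor.
\<close>

definition postcomp_trans where
  "postcomp_trans D C B \<sigma> = \<lparr> Src = postcomp D C B (Src \<sigma>), Trg = postcomp D C B (Trg \<sigma>),
     Cmp = (\<lambda>G\<in>Obj (ihom D C). whisker_r D B \<sigma> G) \<rparr>"

lemma postcomp_trans_simps [simp]:
  "Src (postcomp_trans D C B \<sigma>) = postcomp D C B (Src \<sigma>)"
  "Trg (postcomp_trans D C B \<sigma>) = postcomp D C B (Trg \<sigma>)"
  "Cmp (postcomp_trans D C B \<sigma>) = (\<lambda>G\<in>Obj (ihom D C). whisker_r D B \<sigma> G)"
  by (simp_all add: postcomp_trans_def)

lemma hom_from_strict: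
  "hom_from D C B = strict_fun (ihom C B) (ihom (ihom D C) (ihom D B)) (postcomp D C B) (postcomp_trans D C B)"
  by (simp add: hom_from_def postcomp_trans_def[abs_def])

lemma sm_trans_postcomp_trans:
  assumes D: "sm_category D" and C: "sm_category C" and B: "sm_category B" and \<sigma>: "sm_trans C B \<sigma>"
  shows "sm_trans (ihom D C) (ihom D B) (postcomp_trans D C B \<sigma>)"
proof -
  interpret DC: smc_pair D C using D C by unfold_locales
  interpret \<sigma>: sm_nt C B \<sigma> using C B \<sigma> by (intro sm_ntI)
  let ?\<rho> = "postcomp_trans D C B \<sigma>"
  note [simp] = \<sigma>.S.sm_functor \<sigma>.T.sm_functor DC.sm_functor_unit_fun DC.sm_functor_box_fun
    sm_functor_postcomp[OF D C B] sm_trans_whisker_r[OF D C B _ \<sigma>] sm_trans_whisker_l[OF D C B]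
  show ?thesis
  proof (rule sm_transI)
    fix \<theta> assume "\<theta> \<in> Arr (ihom D C)"
    then interpret \<theta>: sm_nt D C \<theta> by (simp add: DC.sm_nt_iff)
    show "Cmp ?\<rho> (Cod (ihom D C) \<theta>) \<cdot>\<^bsub>ihom D B\<^esub> FA (Src ?\<rho>) \<theta> =
        FA (Trg ?\<rho>) \<theta> \<cdot>\<^bsub>ihom D B\<^esub> Cmp ?\<rho> (Dom (ihom D C) \<theta>)"
      using \<theta>.sm_trans \<theta>.S.sm_functor \<theta>.T.sm_functor \<sigma>.Cmp_natural[OF \<theta>.Cmp_arr(1)]
      by (auto intro!: smtrans_eqI[where X = "Obj D"])
  next
    fix H K assume HK: "H \<in> Obj (ihom D C)" "K \<in> Obj (ihom D C)"
    then interpret H: sm_fun D C H + K: sm_fun D C K by (simp_all add: DC.sm_fun_iff)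
    show "Cmp ?\<rho> (H \<otimes>\<^bsub>ihom D C\<^esub> K) \<cdot>\<^bsub>ihom D B\<^esub> F2 (Src ?\<rho>) (H, K) =
        F2 (Trg ?\<rho>) (H, K) \<cdot>\<^bsub>ihom D B\<^esub> (Cmp ?\<rho> H \<odot>\<^bsub>ihom D B\<^esub> Cmp ?\<rho> K)"
      using HK by (auto intro!: smtrans_eqI[where X = "Obj D"] simp: \<sigma>.Cmp_tensor)
  next
    show "Cmp ?\<rho> \<one>\<^bsub>ihom D C\<^esub> \<cdot>\<^bsub>ihom D B\<^esub> F0 (Src ?\<rho>) = F0 (Trg ?\<rho>)"
      by (auto intro!: smtrans_eqI[where X = "Obj D"] simp: \<sigma>.Cmp_unit)
  qed (auto simp: Hom_def)
qed

lemma sm_functor_hom_from: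
  assumes D: "sm_category D" and C: "sm_category C" and B: "sm_category B"
  shows "sm_functor (ihom C B) (ihom (ihom D C) (ihom D B)) (hom_from D C B)"
  unfolding hom_from_strict
proof (rule sm_functor_strict_fun)
  interpret DC: smc_pair D C using D C by unfold_locales
  interpret CB: smc_pair C B using C B by unfold_locales
  let ?X = "ihom C B" and ?Y = "ihom (ihom D C) (ihom D B)"
  note [simp] = sm_functor_postcomp[OF D C B] postcomp_box_fun[OF D C B] postcomp_unit_fun[OF D C B]
    sm_trans_postcomp_trans[OF D C B] CB.sm_functor_box_fun CB.sm_functor_unit_fun
    comp_box_fun[OF D C B] comp_unit_fun[OF D C B]
  have ptw: "whisker_r D B \<rho> K = \<tau>" if "Src \<tau> = comp_fun D B (Src \<rho>) K" "Trg \<tau> = comp_fun D B (Trg \<rho>) K"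
     "Cmp \<tau> \<in> extensional (Obj D)" "\<And>x. x \<in> Obj D \<Longrightarrow> Cmp \<rho> (FO K x) = Cmp \<tau> x" for \<rho> K \<tau>
    using that by (intro smtrans_eqI[where X = "Obj D"]) simp_all
  show "sm_category ?X" "sm_category ?Y"
    by (intro ihom_sm_category assms)+
  show "postcomp D C B \<one>\<^bsub>?X\<^esub> = \<one>\<^bsub>?Y\<^esub>" by simp
  {
    fix F G H assume FGH: "F \<in> Obj ?X" "G \<in> Obj ?X" "H \<in> Obj ?X"
    then interpret F: sm_fun C B F + G: sm_fun C B G + H: sm_fun C B H by (simp_all add: CB.sm_fun_iff)
    note [simp] = F.sm_functor G.sm_functor H.sm_functor
    show "postcomp D C B F \<in> Obj ?Y" by simp
    show "postcomp D C B (F \<otimes>\<^bsub>?X\<^esub> G) = postcomp D C B F \<otimes>\<^bsub>?Y\<^esub> postcomp D C B G" by simp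
    show "postcomp_trans D C B (Id ?X F) = Id ?Y (postcomp D C B F)"
      by (auto intro!: smtrans_eqI[where X = "Obj (ihom D C)"] ptw simp: sm_fun.FO_obj[OF sm_funI[OF D C]])
    show "postcomp_trans D C B (Ass ?X F G H) = Ass ?Y (postcomp D C B F) (postcomp D C B G) (postcomp D C B H)"
      by (auto intro!: smtrans_eqI[where X = "Obj (ihom D C)"] ptw simp: sm_fun.FO_obj[OF sm_funI[OF D C]])
    show "postcomp_trans D C B (Run ?X F) = Run ?Y (postcomp D C B F)"
      by (auto intro!: smtrans_eqI[where X = "Obj (ihom D C)"] ptw simp: sm_fun.FO_obj[OF sm_funI[OF D C]])
    show "postcomp_trans D C B (Lun ?X F) = Lun ?Y (postcomp D C B F)"
      by (auto intro!: smtrans_eqI[where X = "Obj (ihom D C)"] ptw simp: sm_fun.FO_obj[OF sm_funI[OF D C]])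
    show "postcomp_trans D C B (Sym ?X F G) = Sym ?Y (postcomp D C B F) (postcomp D C B G)"
      by (auto intro!: smtrans_eqI[where X = "Obj (ihom D C)"] ptw simp: sm_fun.FO_obj[OF sm_funI[OF D C]])
  }
  fix \<sigma> \<tau> assume "\<sigma> \<in> Arr ?X" "\<tau> \<in> Arr ?X"
  then interpret \<sigma>: sm_nt C B \<sigma> + \<tau>: sm_nt C B \<tau> by (simp_all add: CB.sm_nt_iff)
  note [simp] = \<sigma>.sm_trans \<sigma>.S.sm_functor \<sigma>.T.sm_functor \<tau>.sm_trans \<tau>.S.sm_functor \<tau>.T.sm_functor
  show "postcomp_trans D C B \<sigma> \<in> Hom ?Y (postcomp D C B (Dom ?X \<sigma>)) (postcomp D C B (Cod ?X \<sigma>))"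
    by (simp add: Hom_def)
  show "postcomp_trans D C B (\<sigma> \<odot>\<^bsub>?X\<^esub> \<tau>) = postcomp_trans D C B \<sigma> \<odot>\<^bsub>?Y\<^esub> postcomp_trans D C B \<tau>"
    by (auto intro!: smtrans_eqI[where X = "Obj (ihom D C)"] ptw simp: sm_fun.FO_obj[OF sm_funI[OF D C]])
  show "postcomp_trans D C B (\<tau> \<cdot>\<^bsub>?X\<^esub> \<sigma>) = postcomp_trans D C B \<tau> \<cdot>\<^bsub>?Y\<^esub> postcomp_trans D C B \<sigma>"
    by (auto intro!: smtrans_eqI[where X = "Obj (ihom D C)"] ptw simp: sm_fun.FO_obj[OF sm_funI[OF D C]])
qed

lemma bifunctorI:
  "\<lbrakk>sm_category A; sm_category B; sm_category C; sm_functor A (ihom B C) F\<rbrakk> \<Longrightarrow> bifunctor A B C F"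
  by (simp add: bifunctor_def bifunctor_axioms_def smc_pair_def smc_def)

lemma sm_functor_hom_into:
  assumes "sm_category D" "sm_category C" "sm_category B"
  shows "sm_functor (ihom D C) (ihom (ihom C B) (ihom D B)) (hom_into D C B)"
  unfolding hom_into_def
  by (intro bifunctor.sm_functor_dual bifunctorI ihom_sm_category sm_functor_hom_from assms)

section \<open>The two composites\<close>

lemma strict_fun_simps [simp]:
  "x \<in> Obj A \<Longrightarrow> FO (strict_fun A B fo fa) x = fo x"
  "f \<in> Arr A \<Longrightarrow> FA (strict_fun A B fo fa) f = fa f"
  "F0 (strict_fun A B fo fa) = Id B \<one>\<^bsub>B\<^esub>"
  "x \<in> Obj A \<Longrightarrow> y \<in> Obj A \<Longrightarrow> F2 (strict_fun A B fo fa) (x, y) = Id B (fo x \<otimes>\<^bsub>B\<^esub> fo y)"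
  by (simp_all add: strict_fun_def)

lemma hom_from_simps [simp]:
  "sm_functor C B H \<Longrightarrow> FO (hom_from D C B) H = postcomp D C B H"
  "sm_trans C B \<sigma> \<Longrightarrow> FA (hom_from D C B) \<sigma> = postcomp_trans D C B \<sigma>"
  "F0 (hom_from D C B) = Id (ihom (ihom D C) (ihom D B)) (unit_fun (ihom D C) (ihom D B))"
  "sm_functor C B H \<Longrightarrow> sm_functor C B K \<Longrightarrow> F2 (hom_from D C B) (H, K) =
    Id (ihom (ihom D C) (ihom D B)) (box_fun (ihom D C) (ihom D B) (postcomp D C B H) (postcomp D C B K))"
  by (simp_all add: hom_from_strict)

lemma dual_trans_simps [simp]:
  "Src (dual_trans A B C \<theta>) = dual A B C (Src \<theta>)"
  "Trg (dual_trans A B C \<theta>) = dual A B C (Trg \<theta>)"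
  "Cmp (dual_trans A B C \<theta>) = (\<lambda>b\<in>Obj B. \<lparr> Src = dual_at A (Src \<theta>) b, Trg = dual_at A (Trg \<theta>) b,
     Cmp = (\<lambda>a\<in>Obj A. Cmp (Cmp \<theta> a) b) \<rparr>)"
  by (simp_all add: dual_trans_def)

text \<open>
  Both composites send \<open>G\<close> to the functor \<open>a \<mapsto> F(a) \<circ> G\<close>; the second one obtains it as the dual of
  \<open>F\<^sup>* \<circ> G : D \<rightarrow> [A, B]\<close>, which is called the transpose of \<open>G\<close> below.
\<close>

locale square = A: smc A + B: smc B + C: smc C + D: smc D + F: bifunctor A C B F
  for A :: "('oa, 'aa) smcat" and B :: "('ob, 'ab) smcat"
    and C :: "('oc, 'ac) smcat" and D :: "('od, 'ad) smcat"
    and F :: "('oa, 'aa, ('oc, 'ac, 'ob, 'ab) smfun, ('oc, 'ac, 'ob, 'ab) smtrans) smfun"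
begin

abbreviation "F' \<equiv> dual A C B F"

abbreviation transpose where "transpose G \<equiv> comp_fun D (ihom A B) F' G"

sublocale G: bifunctor "ihom C B" "ihom D C" "ihom D B" "hom_from D C B"
  by (intro bifunctorI ihom_sm_category sm_functor_hom_from A.sm_category B.sm_category
      C.sm_category D.sm_category)

lemma F_values [simp]:
  "a \<in> Obj A \<Longrightarrow> sm_functor C B (FO F a)"
  "f \<in> Arr A \<Longrightarrow> sm_trans C B (FA F f)"
  "sm_trans C B (F0 F)"
  "a \<in> Obj A \<Longrightarrow> a' \<in> Obj A \<Longrightarrow> sm_trans C B (F2 F (a, a'))"
  using F.F.FO_obj F.F.FA_arr(1) F.F.F0_arr(1) F.F.F2_arr(1) by simp_all

lemma sm_functor_transpose:
  assumes "sm_functor D C G"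
  shows "sm_functor D (ihom A B) (transpose G)"
  by (intro sm_functor_comp_fun[where B = C] ihom_sm_category assms F.sm_functor_dual
      A.sm_category B.sm_category C.sm_category D.sm_category)

text \<open>
  \<open>F\<^sup>*(G d)(a) = F(a)(G d)\<close>, with the same structure arrows: both are composed of the structure arrows of
  \<open>F(a)\<close> and the image under \<open>F(a)\<close> of those of \<open>G\<close>.
\<close>

lemma dual_at_transpose:
  assumes G: "sm_functor D C G" and [simp]: "a \<in> Obj A"
  shows "dual_at D (transpose G) a = comp_fun D B (FO F a) G"
proof -
  interpret G: sm_fun D C G using C.sm_category D.sm_category G by (intro sm_funI)
  interpret T: bifunctor D A B "transpose G"
    by (intro bifunctorI sm_functor_transpose A.sm_category B.sm_category D.sm_category G)
  show ?thesis
    by (rule smfun_eqI[where X = "Obj D" and Y = "Arr D"]) simp_all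
qed

text \<open>
  The two composites agree on objects. The structure arrows of the left-hand side contain those of the
  strict functor \<open>[D, -]\<close>, which are identities and cancel.
\<close>

lemma dual_transpose:
  assumes G: "sm_functor D C G"
  shows "comp_fun A (ihom D B) (dual_at (ihom C B) (hom_from D C B) G) F = dual D A B (transpose G)"
proof -
  interpret G: sm_fun D C G using C.sm_category D.sm_category G by (intro sm_funI)
  interpret T: bifunctor D A B "transpose G"
    by (intro bifunctorI sm_functor_transpose A.sm_category B.sm_category D.sm_category G)
  note [simp] = G dual_at_transpose[OF G]
  show ?thesis
  proof (rule smfun_eqI[where X = "Obj A" and Y = "Arr A"])
    fix a assume "a \<in> Obj A"
    then show "FO (comp_fun A (ihom D B) (dual_at (ihom C B) (hom_from D C B) G) F) a = FO (dual D A B (transpose G)) a"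
      by simp
    fix a' assume "a' \<in> Obj A"
    then show "F2 (comp_fun A (ihom D B) (dual_at (ihom C B) (hom_from D C B) G) F) (a, a') = F2 (dual D A B (transpose G)) (a, a')"
      using \<open>a \<in> Obj A\<close> by (auto intro!: smtrans_eqI[where X = "Obj D"])
  next
    fix f assume "f \<in> Arr A"
    then show "FA (comp_fun A (ihom D B) (dual_at (ihom C B) (hom_from D C B) G) F) f = FA (dual D A B (transpose G)) f"
      by (auto intro!: smtrans_eqI[where X = "Obj D"])
  next
    show "F0 (comp_fun A (ihom D B) (dual_at (ihom C B) (hom_from D C B) G) F) = F0 (dual D A B (transpose G))"
      by (auto intro!: smtrans_eqI[where X = "Obj D"])
  qed (rule comp_fun_simps T.dual_simps)+
qed

abbreviation "upper \<equiv> comp_fun (ihom D C) (ihom A (ihom D B))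
  (precomp A (ihom C B) (ihom D B) F) (hom_into D C B)"

abbreviation "lower \<equiv> comp_fun (ihom D C) (ihom A (ihom D B))
  (dualizer D A B) (postcomp D C (ihom A B) F')"

lemma sm_functor_upper: "sm_functor (ihom D C) (ihom A (ihom D B)) upper"
  by (intro sm_functor_comp_fun[where B = "ihom (ihom C B) (ihom D B)"] sm_functor_hom_into
      sm_functor_precomp ihom_sm_category F.bifunctor
      A.sm_category B.sm_category C.sm_category D.sm_category)

text \<open>
  The actions on objects agree by \<open>dual_transpose\<close>, so the arrows have the same source and target and
  only their components are left to compare: at \<open>a\<close> and \<open>d\<close> they are \<open>F(a)(\<tau>\<^sub>d)\<close> for
  an arrow \<open>\<tau>\<close>, \<open>F(a)\<^sup>0\<close> for the unit and \<open>F(a)\<^sup>2\<close> at \<open>(G d, H d)\<close> for the tensor product.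
\<close>

lemma upper_eq_lower: "upper = lower"
proof -
  interpret DC: smc_pair D C by unfold_locales
  interpret DB: smc_pair D B by unfold_locales
  interpret HI: sm_fun "ihom D C" "ihom (ihom C B) (ihom D B)" "hom_into D C B"
    by (intro sm_funI ihom_sm_category sm_functor_hom_into
        B.sm_category C.sm_category D.sm_category)
  interpret PF: sm_fun "ihom D C" "ihom D (ihom A B)" "postcomp D C (ihom A B) F'"
    by (intro sm_funI ihom_sm_category sm_functor_postcomp F.sm_functor_dual
        A.sm_category B.sm_category C.sm_category D.sm_category)
  note [simp] = dual_transpose dual_at_transpose DC.sm_functor_unit_fun DC.sm_functor_box_fun
  \<comment> \<open>The maps of a functor are undefined outside its source, so the second functor of each composite
    can be evaluated only after the values of the first one are known to lie there.\<close>
  note HI_arr = HI.FO_obj HI.FA_arr(1) HI.F0_arr(1) HI.F2_arr(1)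
  note PF_arr = PF.FO_obj PF.FA_arr(1) PF.F0_arr(1) PF.F2_arr(1)
  show ?thesis
  proof (rule smfun_eqI[where X = "Obj (ihom D C)" and Y = "Arr (ihom D C)"])
    fix G assume G: "G \<in> Obj (ihom D C)"
    then interpret G: sm_fun D C G by (simp add: DC.sm_fun_iff)
    note [simp] = G.sm_functor
    show "FO upper G = FO lower G"
      using HI_arr(1)[OF G] PF_arr(1)[OF G] by (simp add: precomp_def dualizer_def hom_into_def)
    fix H assume H: "H \<in> Obj (ihom D C)"
    then interpret H: sm_fun D C H by (simp add: DC.sm_fun_iff)
    note [simp] = H.sm_functor
    note arrs = HI_arr(1)[OF G] PF_arr(1)[OF G] HI_arr(1)[OF H] PF_arr(1)[OF H] HI_arr(4)[OF G H] PF_arr(4)[OF G H]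
    show "F2 upper (G, H) = F2 lower (G, H)"
    proof (rule smtrans_eqI[where X = "Obj A"])
      fix a assume [simp]: "a \<in> Obj A"
      show "Cmp (F2 upper (G, H)) a = Cmp (F2 lower (G, H)) a"
        using arrs
        by (intro smtrans_eqI[where X = "Obj D"]) (simp_all add: precomp_def dualizer_def hom_into_def)
    qed (use arrs in \<open>simp_all add: precomp_def dualizer_def hom_into_def\<close>)
  next
    fix \<tau> assume t: "\<tau> \<in> Arr (ihom D C)"
    then interpret \<tau>: sm_nt D C \<tau> by (simp add: DC.sm_nt_iff)
    note [simp] = \<tau>.sm_trans \<tau>.S.sm_functor \<tau>.T.sm_functor
    show "FA upper \<tau> = FA lower \<tau>"
      using HI_arr(2)[OF t] PF_arr(2)[OF t]
      by (auto intro!: smtrans_eqI[where X = "Obj A"] smtrans_eqI[where X = "Obj D"]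
        simp: precomp_def dualizer_def hom_into_def)
  next
    show "F0 upper = F0 lower"
    proof (rule smtrans_eqI[where X = "Obj A"])
      fix a assume [simp]: "a \<in> Obj A"
      show "Cmp (F0 upper) a = Cmp (F0 lower) a"
        using HI_arr(3) PF_arr(3)
        by (intro smtrans_eqI[where X = "Obj D"]) (simp_all add: precomp_def dualizer_def hom_into_def)
    qed (use HI_arr(3) PF_arr(3) in \<open>simp_all add: precomp_def dualizer_def hom_into_def\<close>)
  qed (rule comp_fun_simps)+
qed

end

theorem lemma10p7:
  fixes A :: "('oa, 'aa) smcat" and B :: "('ob, 'ab) smcat"
    and C :: "('oc, 'ac) smcat" and D :: "('od, 'ad) smcat"
    and F :: "('oa, 'aa, ('oc, 'ac, 'ob, 'ab) smfun, ('oc, 'ac, 'ob, 'ab) smtrans) smfun"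
  assumes "sm_category A" "sm_category B" "sm_category C" "sm_category D"
    and "sm_functor A (ihom C B) F"
  defines "upper \<equiv> comp_fun (ihom D C) (ihom A (ihom D B))
             (precomp A (ihom C B) (ihom D B) F) (hom_into D C B)"
    and "lower \<equiv> comp_fun (ihom D C) (ihom A (ihom D B))
             (dualizer D A B) (postcomp D C (ihom A B) (dual A C B F))"
  shows "sm_functor (ihom D C) (ihom A (ihom D B)) upper \<and>
         sm_functor (ihom D C) (ihom A (ihom D B)) lower \<and>
         upper = lower"
proof -
  interpret square A B C D F
    using assms(1-5) by (intro square.intro smc.intro bifunctorI)
  show ?thesis
    unfolding upper_def lower_def using sm_functor_upper upper_eq_lower by simp
qed

end
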